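(* Let $p\in(1,\infty)$, $s\in(0,1)$, let $\Omega\subset\mathbb{R}^N$ be a smooth bounded domain with $N>sp$, and let $f:\Omega\to[0,\infty)$ be measurable and not a.e. equal to zero. (i) If $0<\gamma\le 1$ and $f\in L^m(\Omega)$ with $m:=\frac{Np}{N(p-1)+sp+\gamma(N-sp)}$, then the problem $$(-\Delta)_p^s u=\frac{f(x)}{u^\gamma}\ \text{ in }\Omega,\qquad u>0\ \text{ in }\Omega,\qquad u=0\ \text{ in }\mathbb{R}^N\setminus\Omega \qquad (P)$$ has a weak solution $u\in W^{s,p}_0(\Omega)$ such that $\operatorname{ess\,inf}_K u>0$ for every compact $K\Subset\Omega$. (ii) If $\gamma>1$ and $f\in L^1(\Omega)$, then $(P)$ has a weak solution $u\in W^{s,p}_{\rm loc}(\Omega)\cap L^{p-1}(\Omega)$ such that $u^{(\gamma+p-1)/p}\in W^{s,p}_0(\Omega)$ and $\operatorname{ess\,inf}_K u>0$ for every compact $K\Subset\Omega$.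
   Context: For measurable $u:\mathbb{R}^N\to\mathbb{R}$ let $[u]_{D^{s,p}(\mathbb{R}^N)}:=\left(\int_{\mathbb{R}^{2N}}\frac{|u(x)-u(y)|^p}{|x-y|^{N+sp}}\,dx\,dy\right)^{1/p}$, $W^{s,p}(\mathbb{R}^N):=\{u\in L^p(\mathbb{R}^N):[u]_{D^{s,p}(\mathbb{R}^N)}<\infty\}$, and $W^{s,p}_0(\Omega):=\{u\in W^{s,p}(\mathbb{R}^N): u=0 \text{ in }\mathbb{R}^N\setminus\Omega\}$. $W^{s,p}_{\rm loc}(\Omega)$ is the set of functions $u$ with $u\in L^p(K)$ and $\int_{K\times K}\frac{|u(x)-u(y)|^p}{|x-y|^{N+sp}}\,dx\,dy<\infty$ for all $K\Subset\Omega$. Here $(-\Delta)^s_p$ is the fractional $p$-Laplacian, formally $(-\Delta)^s_p u(x)=2\lim_{\varepsilon\searrow0}\int_{\mathbb{R}^N\setminus B_\varepsilon(x)}\frac{|u(x)-u(y)|^{p-2}(u(x)-u(y))}{|x-y|^{N+sp}}\,dy$. Weak solution of $(P)$: a function $u\in W^{s,p}_{\rm loc}(\Omega)\cap L^{p-1}(\Omega)$, with $u>0$ in $\Omega$ and $u=0$ in $\mathbb{R}^N\setminus\Omega$, such that $u^{\max\{\frac{\gamma+p-1}{p},1\}}\in W^{s,p}_0(\Omega)$, $\frac{f}{u^\gamma}\in L^1_{\rm loc}(\Omega)$, and $$\int_{\mathbb{R}^{2N}}\frac{|u(x)-u(y)|^{p-2}(u(x)-u(y))(\varphi(x)-\varphi(y))}{|x-y|^{N+sp}}\,dx\,dy=\int_\Omega\frac{f(x)}{u^\gamma}\varphi\,dx\qquad\text{for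 every }\varphi\in C^\infty_c(\Omega).$$ *)

theory Defs
  imports "HOL-Analysis.Analysis" "HOL-Probability.Essential_Supremum"
begin

text \<open>
  Throughout, \<open>\<real>\<^sup>N\<close> is a type \<open>'a::euclidean_space\<close> with \<open>N = DIM('a)\<close>, and measurability and
  integrals refer to the Lebesgue \<open>\<sigma>\<close>-algebra and measure.  Functions on a subset of \<open>\<real>\<^sup>N\<close> are
  total functions of which only the values on that subset are used.
\<close>

subsection \<open>Smooth functions and smooth bounded domains\<close>

primrec Ck_fun :: "nat \<Rightarrow> ('a::real_normed_vector \<Rightarrow> real) \<Rightarrow> bool" where
  "Ck_fun 0 g \<longleftrightarrow> continuous_on UNIV g"
| "Ck_fun (Suc k) g \<longleftrightarrow>
     (\<forall>x. g differentiable (at x)) \<and> (\<forall>v. Ck_fun k (\<lambda>x. frechet_derivative g (at x) v))"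

definition smooth_fun :: "('a::real_normed_vector \<Rightarrow> real) \<Rightarrow> bool" where
  "smooth_fun g \<longleftrightarrow> (\<forall>k. Ck_fun k g)"

text \<open>
  Near each of its boundary points the set is the strict epigraph, in a direction \<open>\<nu>\<close>, of a smooth
  function on the hyperplane orthogonal to \<open>\<nu>\<close>.  The function \<open>g\<close> is defined on the whole space but
  is only evaluated at orthogonal projections onto that hyperplane; every smooth function on the
  hyperplane has such an extension.
\<close>

definition smooth_boundary :: "'a::euclidean_space set \<Rightarrow> bool" where
  "smooth_boundary \<Omega> \<longleftrightarrow>
     (\<forall>x0\<in>frontier \<Omega>. \<exists>r>0. \<exists>\<nu> g. norm \<nu> = 1 \<and> smooth_fun g \<and>
        \<Omega> \<inter> ball x0 r = {x \<in> ball x0 r. g (x - (x \<bullet> \<nu>) *\<^sub>R \<nu>) < x \<bullet> \<nu>})"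

definition smooth_bounded_domain :: "'a::euclidean_space set \<Rightarrow> bool" where
  "smooth_bounded_domain \<Omega> \<longleftrightarrow>
     \<Omega> \<noteq> {} \<and> open \<Omega> \<and> connected \<Omega> \<and> bounded \<Omega> \<and> smooth_boundary \<Omega>"

definition test_functions :: "'a::euclidean_space set \<Rightarrow> ('a \<Rightarrow> real) set" where
  "test_functions \<Omega> =
     {\<phi>. smooth_fun \<phi> \<and> compact (closure {x. \<phi> x \<noteq> 0}) \<and> closure {x. \<phi> x \<noteq> 0} \<subseteq> \<Omega>}"

subsection \<open>Lebesgue and fractional Sobolev spaces\<close>

definition Lp_on :: "real \<Rightarrow> 'a::euclidean_space set \<Rightarrow> ('a \<Rightarrow> real) set" where
  "Lp_on q A = {u. u \<in> borel_measurable (lebesgue_on A) \<and>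
                   integrable (lebesgue_on A) (\<lambda>x. \<bar>u x\<bar> powr q)}"

definition L1_loc :: "'a::euclidean_space set \<Rightarrow> ('a \<Rightarrow> real) set" where
  "L1_loc \<Omega> = {u. \<forall>K. compact K \<and> K \<subseteq> \<Omega> \<longrightarrow> integrable (lebesgue_on K) u}"

text \<open>
  On the diagonal the integrand below is \<open>0 / 0 = 0\<close>; the diagonal is a null set.
\<close>

definition gagliardo_energy ::
    "real \<Rightarrow> real \<Rightarrow> 'a::euclidean_space set \<Rightarrow> ('a \<Rightarrow> real) \<Rightarrow> ennreal" where
  "gagliardo_energy s p A u =
     (\<integral>\<^sup>+ (x, y). ennreal (\<bar>u x - u y\<bar> powr p / norm (x - y) powr (real DIM('a) + s * p))
        \<partial>lebesgue_on (A \<times> A))"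

definition gagliardo_seminorm :: "real \<Rightarrow> real \<Rightarrow> ('a::euclidean_space \<Rightarrow> real) \<Rightarrow> ennreal" where
  "gagliardo_seminorm s p u =
     (if gagliardo_energy s p UNIV u = \<infinity> then \<infinity>
      else ennreal (enn2real (gagliardo_energy s p UNIV u) powr (1 / p)))"

definition frac_sobolev :: "real \<Rightarrow> real \<Rightarrow> ('a::euclidean_space \<Rightarrow> real) set" where
  "frac_sobolev s p = {u \<in> Lp_on p UNIV. gagliardo_seminorm s p u < \<infinity>}"

definition frac_sobolev0 ::
    "real \<Rightarrow> real \<Rightarrow> 'a::euclidean_space set \<Rightarrow> ('a \<Rightarrow> real) set" where
  "frac_sobolev0 s p \<Omega> = {u \<in> frac_sobolev s p. AE x in lebesgue. x \<notin> \<Omega> \<longrightarrow> u x = 0}"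

definition frac_sobolev_loc ::
    "real \<Rightarrow> real \<Rightarrow> 'a::euclidean_space set \<Rightarrow> ('a \<Rightarrow> real) set" where
  "frac_sobolev_loc s p \<Omega> =
     {u. \<forall>K. compact K \<and> K \<subseteq> \<Omega> \<longrightarrow> u \<in> Lp_on p K \<and> gagliardo_energy s p K u < \<infinity>}"

definition ess_inf_on :: "'a::euclidean_space set \<Rightarrow> ('a \<Rightarrow> real) \<Rightarrow> ereal" where
  "ess_inf_on K u = - esssup (lebesgue_on K) (\<lambda>x. - ereal (u x))"

subsection \<open>Weak solutions of the singular problem\<close>

definition frac_p_integrand ::
    "real \<Rightarrow> real \<Rightarrow> ('a::euclidean_space \<Rightarrow> real) \<Rightarrow> ('a \<Rightarrow> real) \<Rightarrow> 'a \<times> 'a \<Rightarrow> real" where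
  "frac_p_integrand s p u \<phi> = (\<lambda>(x, y).
     \<bar>u x - u y\<bar> powr (p - 2) * (u x - u y) * (\<phi> x - \<phi> y) /
     norm (x - y) powr (real DIM('a) + s * p))"

text \<open>
  The sign and exterior conditions are required at every point.  A function satisfying them almost
  everywhere has a representative satisfying them everywhere, and the other conditions do not
  depend on the representative.  Integrability of the left-hand integrand is
  required explicitly, since the Bochner integral of a non-integrable function is \<open>0\<close>; on the right
  it follows from the local integrability condition.
\<close>

definition weak_solution ::
    "real \<Rightarrow> real \<Rightarrow> real \<Rightarrow> 'a::euclidean_space set \<Rightarrow> ('a \<Rightarrow> real) \<Rightarrow> ('a \<Rightarrow> real) \<Rightarrow> bool" where
  "weak_solution s p \<gamma> \<Omega> f u \<longleftrightarrow>
     u \<in> frac_sobolev_loc s p \<Omega> \<and> u \<in> Lp_on (p - 1) \<Omega> \<and>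
     (\<forall>x\<in>\<Omega>. 0 < u x) \<and> (\<forall>x. x \<notin> \<Omega> \<longrightarrow> u x = 0) \<and>
     (\<lambda>x. u x powr max ((\<gamma> + p - 1) / p) 1) \<in> frac_sobolev0 s p \<Omega> \<and>
     (\<lambda>x. f x / u x powr \<gamma>) \<in> L1_loc \<Omega> \<and>
     (\<forall>\<phi>\<in>test_functions \<Omega>.
        integrable lebesgue (frac_p_integrand s p u \<phi>) \<and>
        integral\<^sup>L lebesgue (frac_p_integrand s p u \<phi>) =
          (\<integral>x. f x / u x powr \<gamma> * \<phi> x \<partial>lebesgue_on \<Omega>))"

end

theory Submission
  imports Defs
begin

text \<open>
  The problem is approximated by the data \<open>min f n\<close> and the regularised singularity
  \<open>(u\<^sup>+ + 1/n) powr (- \<gamma>)\<close>, for which the energy functional is convex: a minimising sequence is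
  Cauchy in energy by uniform convexity of \<open>\<bar>\<cdot>\<bar> powr p\<close>, so no compactness is needed.  By comparison the
  solutions \<open>u\<^sub>n\<close> increase.  Testing with \<open>min u\<^sub>n T powr max \<gamma> 1\<close>
  bounds the energy of \<open>u\<^sub>n powr q\<close>, \<open>q = (max \<gamma> 1 + p - 1) / p\<close>; for \<open>\<gamma> < 1\<close> this uses the
  fractional Sobolev inequality.

  For the interior lower bound of the supersolution \<open>u = u\<^sub>1\<close>, test with \<open>(k \<psi> - t - u)\<^sup>+\<close>, where
  \<open>\<psi>\<close> is a cutoff function.  Since \<open>u \<ge> \<delta>\<close> on a set of positive measure, the nonlocal term alone
  makes \<open>{u < k \<psi> - k / 4}\<close> of measure at most \<open>C k powr (p - 1)\<close>, and De Giorgi's iteration in \<open>t\<close>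
  then shows \<open>u \<ge> k / 2\<close> where \<open>\<psi> = 1\<close>, for small \<open>k\<close>.

  If \<open>c \<le> u\<^sub>n x\<close> then \<open>\<bar>u\<^sub>n x - u\<^sub>n y\<bar> \<le> c powr (1 - q) * \<bar>u\<^sub>n x powr q - u\<^sub>n y powr q\<bar>\<close> for every \<open>y\<close>.
  Hence the energy bound on the powers is an \<open>L\<^sup>p\<close> bound on all difference quotients that are seen by
  a test function, and one can pass to the limit.
\<close>

subsection \<open>Pointwise inequalities\<close>

text \<open>For \<open>\<gamma> > 1\<close> the equation yields no bound for the approximations in
  the energy space, and \<open>f / u powr \<gamma>\<close> is only locally integrable; so the lower
  bound and the passage to the limit have to be local. The operator is not: a test function
  supported in a compact set still sees every pair with just one point in that set, which is why the
  estimates on gaps must work with information at one point only. The exponents fit because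
  \<open>(q - 1) * p = max \<gamma> 1 - 1\<close>: the p-th power of the gap of
  \<open>u powr q\<close> is then dominated by the flux of \<open>u\<close> times the gap of
  \<open>u powr max \<gamma> 1\<close>. All analysis is done with Borel functions that vanish at
  every point outside \<open>\<Omega>\<close> and with a single measure \<open>M\<close> on pairs
  whose density is the kernel, so that Fatou's lemma, dominated convergence and strict monotonicity
  of the flux apply directly. Lebesgue measurable data are replaced by Borel representatives only at
  the end.\<close>

definition pflux :: "real \<Rightarrow> real \<Rightarrow> real" where
  "pflux p t = \<bar>t\<bar> powr (p - 2) * t"

lemma pflux_zero [simp]: "pflux p 0 = 0"
  by (simp add: pflux_def)

lemma pflux_minus [simp]: "pflux p (- t) = - pflux p t"
  by (simp add: pflux_def)

lemma abs_pflux: "\<bar>pflux p t\<bar> = \<bar>t\<bar> powr (p - 1)"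
proof -
  have "\<bar>pflux p t\<bar> = \<bar>t\<bar> * \<bar>t\<bar> powr (p - 2)"
    by (simp add: pflux_def abs_mult)
  also have "\<dots> = \<bar>t\<bar> powr (1 + (p - 2))"
    by (rule powr_mult_base) simp
  finally show ?thesis by simp
qed

lemma pflux_nonneg: "0 \<le> t \<Longrightarrow> pflux p t = t powr (p - 1)"
  using abs_pflux[of p t] by (simp add: pflux_def)

lemma pflux_nonpos: "t \<le> 0 \<Longrightarrow> pflux p t = - ((- t) powr (p - 1))"
  using pflux_nonneg[of "- t" p] by simp

lemma pflux_mult_self: "pflux p t * t = \<bar>t\<bar> powr p"
proof -
  have "pflux p t * t = \<bar>t\<bar> powr (p - 2) * (\<bar>t\<bar> * \<bar>t\<bar>)"
    by (simp add: pflux_def)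
  also have "\<dots> = \<bar>t\<bar> powr (1 + (1 + (p - 2)))"
    by (simp only: powr_mult_base[symmetric] abs_ge_zero) (simp add: mult_ac)
  finally show ?thesis by simp
qed

lemma pflux_strict_mono:
  assumes "1 < p" "a < b"
  shows "pflux p a < pflux p b"
proof (cases "0 \<le> a")
  case True
  then show ?thesis using assms by (simp add: pflux_nonneg powr_less_mono2)
next
  case a: False
  show ?thesis
  proof (cases "b \<le> 0")
    case True
    then show ?thesis using assms a by (simp add: pflux_nonpos powr_less_mono2)
  next
    case False
    have "pflux p a < 0" using a by (simp add: pflux_nonpos)
    moreover have "0 < pflux p b" using False by (simp add: pflux_nonneg)
    ultimately show ?thesis by linarith
  qed
qed

lemma pflux_mono: "1 < p \<Longrightarrow> a \<le> b \<Longrightarrow> pflux p a \<le> pflux p b"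
  using pflux_strict_mono[of p a b] by (cases "a = b") auto

lemma continuous_pflux:
  assumes "1 < p"
  shows "continuous_on UNIV (pflux p)"
proof -
  have eq: "pflux p = (\<lambda>t. (max t 0) powr (p - 1) - (max (- t) 0) powr (p - 1))"
  proof
    fix t show "pflux p t = (max t 0) powr (p - 1) - (max (- t) 0) powr (p - 1)"
      by (cases "0 \<le> t") (auto simp: pflux_nonneg pflux_nonpos max_def)
  qed
  show ?thesis
    unfolding eq using assms by (intro continuous_on_diff continuous_on_powr' continuous_intros) auto
qed

lemma measurable_pflux [measurable]: "pflux p \<in> borel_measurable borel"
  unfolding pflux_def[abs_def] by measurable

lemma Young_weighted:
  fixes x y p :: real
  assumes "1 < p" "0 \<le> x" "0 \<le> y"
  shows "p * (x powr (p - 1) * y) \<le> (p - 1) * x powr p + y powr p"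
proof -
  define q where "q = p / (p - 1)"
  have q: "1 < q" "1 / q + 1 / p = 1" "(p - 1) * q = p"
    using assms by (auto simp: q_def field_simps)
  have "x powr (p - 1) * y \<le> (x powr (p - 1)) powr q / q + y powr p / p"
    by (rule Youngs_inequality) (use assms q in auto)
  also have "(x powr (p - 1)) powr q = x powr p" by (simp add: powr_powr q)
  finally have "p * (x powr (p - 1) * y) \<le> p * (x powr p / q + y powr p / p)"
    using assms by (intro mult_left_mono) auto
  also have "\<dots> = (p - 1) * x powr p + y powr p"
    using assms by (simp add: q_def field_simps)
  finally show ?thesis .
qed

text \<open>Convexity of \<open>\<bar>t\<bar> powr p\<close> in tangent form: the slope at
  \<open>a\<close> is \<open>p * pflux p a\<close>. Young's inequality gives it for all signs at
  once, without differentiating at 0.\<close>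

lemma powr_tangent:
  fixes a b p :: real
  assumes "1 < p"
  shows "p * pflux p a * (b - a) \<le> \<bar>b\<bar> powr p - \<bar>a\<bar> powr p"
proof -
  have "pflux p a * b \<le> \<bar>a\<bar> powr (p - 1) * \<bar>b\<bar>"
    by (metis abs_ge_self abs_mult abs_pflux)
  then have "p * (pflux p a * b) \<le> p * (\<bar>a\<bar> powr (p - 1) * \<bar>b\<bar>)"
    using assms by simp
  also have "\<dots> \<le> (p - 1) * \<bar>a\<bar> powr p + \<bar>b\<bar> powr p"
    using assms by (intro Young_weighted) auto
  finally show ?thesis
    using pflux_mult_self[of p a] by (simp add: algebra_simps)
qed

text \<open>The tangent at the midpoint alone gives only the weak inequality. Strictness comes from
  a second tangent at a point \<open>c\<close> between the midpoint and \<open>b\<close>, where the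
  slope is strictly larger.\<close>

lemma powr_strict_midpoint:
  fixes a b p :: real
  assumes p: "1 < p" and ab: "a < b"
  shows "\<bar>(a + b) / 2\<bar> powr p < (\<bar>a\<bar> powr p + \<bar>b\<bar> powr p) / 2"
proof -
  define m where "m = (a + b) / 2"
  define c where "c = (m + b) / 2"
  have o: "a < m" "m < c" "c < b" using ab by (auto simp: m_def c_def)
  have 1: "p * pflux p m * (a - m) \<le> \<bar>a\<bar> powr p - \<bar>m\<bar> powr p"
    by (rule powr_tangent[OF p])
  have 2: "p * pflux p m * (c - m) \<le> \<bar>c\<bar> powr p - \<bar>m\<bar> powr p"
    by (rule powr_tangent[OF p])
  have 3: "p * pflux p c * (b - c) \<le> \<bar>b\<bar> powr p - \<bar>c\<bar> powr p"
    by (rule powr_tangent[OF p])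
  have "p * pflux p m * (b - c) < p * pflux p c * (b - c)"
    using o p pflux_strict_mono[OF p o(2)] by simp
  with 2 3 have "p * pflux p m * (b - m) < \<bar>b\<bar> powr p - \<bar>m\<bar> powr p"
    by (simp add: algebra_simps)
  with 1 have "p * pflux p m * (a - m) + p * pflux p m * (b - m)
      < \<bar>a\<bar> powr p + \<bar>b\<bar> powr p - 2 * \<bar>m\<bar> powr p" by linarith
  moreover have "p * pflux p m * (a - m) + p * pflux p m * (b - m) = 0"
    by (simp add: m_def field_simps)
  ultimately show ?thesis by (simp add: m_def)
qed

lemma powr_midpoint:
  fixes a b p :: real
  assumes "1 < p"
  shows "\<bar>(a + b) / 2\<bar> powr p \<le> (\<bar>a\<bar> powr p + \<bar>b\<bar> powr p) / 2"
  using powr_strict_midpoint[OF assms, of a b] powr_strict_midpoint[OF assms, of b a]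
  by (cases a b rule: linorder_cases) (auto simp: add.commute)

text \<open>A substitute for Clarkson's inequalities that treats all exponents alike.\<close>

lemma powr_uniform_convexity:
  fixes p \<epsilon> :: real
  assumes p: "1 < p" and \<epsilon>: "0 < \<epsilon>"
  obtains C where "0 \<le> C"
    "\<And>a b. \<bar>a - b\<bar> powr p \<le> \<epsilon> * (\<bar>a\<bar> powr p + \<bar>b\<bar> powr p)
        + C * ((\<bar>a\<bar> powr p + \<bar>b\<bar> powr p) / 2 - \<bar>(a + b) / 2\<bar> powr p)"
proof -
  \<comment> \<open>By homogeneity it suffices to take \<open>b = 1\<close> and
    \<open>\<bar>a\<bar> \<le> 1\<close>. There the defect \<open>h\<close> vanishes only at
    \<open>a = 1\<close>; on the compact set \<open>K\<close>, which stays away from 1, it has a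
    positive minimum, and off \<open>K\<close> the term with \<open>\<epsilon>\<close> alone is
    enough.\<close>
  define h where "h a = (\<bar>a\<bar> powr p + 1) / 2 - \<bar>(a + 1) / 2\<bar> powr p" for a :: real
  define K where "K = {-1..1} \<inter> {a::real. \<epsilon> \<le> \<bar>a - 1\<bar> powr p}"
  have conth: "continuous_on UNIV h"
    unfolding h_def[abs_def] using p by (intro continuous_intros continuous_on_powr') auto
  have "closed {a::real. \<epsilon> \<le> \<bar>a - 1\<bar> powr p}"
    using p by (intro closed_Collect_le continuous_intros continuous_on_powr') auto
  then have K: "compact K" unfolding K_def by (intro compact_Int_closed) auto
  have h_nonneg: "0 \<le> h a" for a
    using powr_midpoint[OF p, of a 1] by (simp add: h_def)
  have "\<exists>C\<ge>0. \<forall>a\<in>K. 2 powr p \<le> C * h a"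
  proof (cases "K = {}")
    case False
    obtain a0 where a0: "a0 \<in> K" "\<And>a. a \<in> K \<Longrightarrow> h a0 \<le> h a"
      using continuous_attains_inf[OF K False continuous_on_subset[OF conth]] by auto
    have "a0 \<noteq> 1" using a0(1) \<epsilon> by (auto simp: K_def)
    then have "a0 < 1" using a0(1) by (auto simp: K_def)
    then have pos: "0 < h a0" using powr_strict_midpoint[OF p, of a0 1] by (simp add: h_def)
    have "2 powr p \<le> 2 powr p / h a0 * h a" if "a \<in> K" for a
      using a0(2)[OF that] pos by (simp add: field_simps)
    then show ?thesis using pos by (intro exI[of _ "2 powr p / h a0"]) auto
  qed auto
  then obtain C where C: "0 \<le> C" "\<And>a. a \<in> K \<Longrightarrow> 2 powr p \<le> C * h a" by auto
  have norm1: "\<bar>a - 1\<bar> powr p \<le> \<epsilon> * (\<bar>a\<bar> powr p + 1) + C * h a" if a: "\<bar>a\<bar> \<le> 1" for a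
  proof (cases "a \<in> K")
    case True
    have "\<bar>a - 1\<bar> powr p \<le> 2 powr p" using a p by (intro powr_mono2) auto
    moreover have "0 \<le> \<epsilon> * (\<bar>a\<bar> powr p + 1)" using \<epsilon> by simp
    ultimately show ?thesis using C(2)[OF True] by linarith
  next
    case False
    then have "\<bar>a - 1\<bar> powr p \<le> \<epsilon> * 1" using a by (auto simp: K_def)
    also have "\<dots> \<le> \<epsilon> * (\<bar>a\<bar> powr p + 1)" using \<epsilon> by (intro mult_left_mono) auto
    finally show ?thesis using C(1) h_nonneg[of a] mult_nonneg_nonneg[of C "h a"] by linarith
  qed
  have le: "\<bar>a - b\<bar> powr p \<le> \<epsilon> * (\<bar>a\<bar> powr p + \<bar>b\<bar> powr p)
        + C * ((\<bar>a\<bar> powr p + \<bar>b\<bar> powr p) / 2 - \<bar>(a + b) / 2\<bar> powr p)" if ab: "\<bar>a\<bar> \<le> \<bar>b\<bar>" for a b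
  proof (cases "b = 0")
    case False
    define t where "t = a / b"
    have a: "a = t * b" using False by (simp add: t_def)
    have t: "\<bar>t\<bar> \<le> 1" using ab False by (simp add: t_def field_simps)
    have e1: "\<bar>a - b\<bar> powr p = \<bar>b\<bar> powr p * \<bar>t - 1\<bar> powr p"
    proof -
      have "\<bar>a - b\<bar> = \<bar>b\<bar> * \<bar>t - 1\<bar>" by (simp add: a abs_mult[symmetric] algebra_simps)
      then show ?thesis by (simp add: powr_mult)
    qed
    have e2: "\<bar>a\<bar> powr p = \<bar>b\<bar> powr p * \<bar>t\<bar> powr p"
      by (simp add: a abs_mult powr_mult)
    have e3: "\<bar>(a + b) / 2\<bar> powr p = \<bar>b\<bar> powr p * \<bar>(t + 1) / 2\<bar> powr p"
    proof -
      have "\<bar>(a + b) / 2\<bar> = \<bar>b\<bar> * \<bar>(t + 1) / 2\<bar>" by (simp add: a abs_mult[symmetric] algebra_simps)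
      then show ?thesis by (simp only: powr_mult abs_ge_zero)
    qed
    have "\<bar>b\<bar> powr p * \<bar>t - 1\<bar> powr p \<le> \<bar>b\<bar> powr p * (\<epsilon> * (\<bar>t\<bar> powr p + 1) + C * h t)"
      by (rule mult_left_mono[OF norm1[OF t]]) simp
    then show ?thesis unfolding e1 e2 e3 h_def by (simp add: algebra_simps)
  qed (use ab p in simp)
  show ?thesis
  proof (rule that[OF C(1)])
    fix a b
    show "\<bar>a - b\<bar> powr p \<le> \<epsilon> * (\<bar>a\<bar> powr p + \<bar>b\<bar> powr p)
        + C * ((\<bar>a\<bar> powr p + \<bar>b\<bar> powr p) / 2 - \<bar>(a + b) / 2\<bar> powr p)"
      using le[of a b] le[of b a] by (cases "\<bar>a\<bar> \<le> \<bar>b\<bar>") (auto simp: abs_minus_commute add.commute)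
  qed
qed

lemma powr_sum_le:
  fixes a b p :: real
  assumes "0 \<le> p"
  shows "\<bar>a + b\<bar> powr p \<le> 2 powr p * (\<bar>a\<bar> powr p + \<bar>b\<bar> powr p)"
proof -
  define m where "m = max \<bar>a\<bar> \<bar>b\<bar>"
  have "\<bar>a + b\<bar> powr p \<le> (2 * m) powr p"
    using assms by (intro powr_mono2) (auto simp: m_def)
  also have "\<dots> = 2 powr p * m powr p" by (simp add: powr_mult m_def)
  also have "m powr p \<le> \<bar>a\<bar> powr p + \<bar>b\<bar> powr p" by (auto simp: m_def max_def)
  finally show ?thesis by simp
qed

lemma powr_diff_le:
  fixes a b p :: real
  assumes "0 \<le> p"
  shows "\<bar>a - b\<bar> powr p \<le> 2 powr p * (\<bar>a\<bar> powr p + \<bar>b\<bar> powr p)"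
  using powr_sum_le[OF assms, of a "- b"] by simp

lemma powr_mult_le_sum:
  fixes a b p :: real
  assumes "1 < p"
  shows "\<bar>a\<bar> powr (p - 1) * \<bar>b\<bar> \<le> \<bar>a\<bar> powr p + \<bar>b\<bar> powr p"
proof (cases "\<bar>a\<bar> \<le> \<bar>b\<bar>")
  case True
  have "\<bar>a\<bar> powr (p - 1) * \<bar>b\<bar> \<le> \<bar>b\<bar> powr (p - 1) * \<bar>b\<bar>"
    using True assms by (intro mult_right_mono powr_mono2) auto
  also have "\<dots> = \<bar>b\<bar> powr p" using powr_mult_base[of "\<bar>b\<bar>" "p - 1"] by (simp add: mult.commute)
  finally show ?thesis by (smt (verit) powr_ge_zero)
next
  case False
  have "\<bar>a\<bar> powr (p - 1) * \<bar>b\<bar> \<le> \<bar>a\<bar> powr (p - 1) * \<bar>a\<bar>"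
    using False assms by (intro mult_left_mono) auto
  also have "\<dots> = \<bar>a\<bar> powr p" using powr_mult_base[of "\<bar>a\<bar>" "p - 1"] by (simp add: mult.commute)
  finally show ?thesis by (smt (verit) powr_ge_zero)
qed

text \<open>Here \<open>b\<close> is the gap of the solution, \<open>a\<close> that of a comparison
  function and \<open>a - b\<close> that of the test function. The product equals
  \<open>pflux p b * a\<close> minus \<open>\<bar>b\<bar> powr p\<close>; half of the latter absorbs
  the former, and the other half controls \<open>\<bar>a - b\<bar> powr p\<close> up to a multiple
  of \<open>\<bar>a\<bar> powr p\<close>.\<close>

lemma pflux_coercive:
  fixes a b p :: real
  assumes p: "1 < p"
  shows "pflux p b * (a - b) \<le> 2 powr p * \<bar>a\<bar> powr p - 2 powr (- p - 1) * \<bar>a - b\<bar> powr p"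
proof -
  have "pflux p b * a \<le> \<bar>b\<bar> powr (p - 1) * \<bar>a\<bar>"
    by (metis abs_ge_self abs_mult abs_pflux)
  also have "\<dots> \<le> \<bar>b\<bar> powr p / 2 + 2 powr (p - 1) * \<bar>a\<bar> powr p"
  proof (cases "2 * \<bar>a\<bar> \<le> \<bar>b\<bar>")
    case True
    have "\<bar>b\<bar> powr (p - 1) * \<bar>a\<bar> \<le> \<bar>b\<bar> powr (p - 1) * (\<bar>b\<bar> / 2)"
      using True by (intro mult_left_mono) auto
    also have "\<dots> = \<bar>b\<bar> powr p / 2"
      using powr_mult_base[of "\<bar>b\<bar>" "p - 1"] by (simp add: mult.commute)
    finally have "\<bar>b\<bar> powr (p - 1) * \<bar>a\<bar> \<le> \<bar>b\<bar> powr p / 2" .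
    moreover have "0 \<le> 2 powr (p - 1) * \<bar>a\<bar> powr p" by simp
    ultimately show ?thesis by linarith
  next
    case False
    have "\<bar>b\<bar> powr (p - 1) * \<bar>a\<bar> \<le> (2 * \<bar>a\<bar>) powr (p - 1) * \<bar>a\<bar>"
      using False p by (intro mult_right_mono powr_mono2) auto
    also have "\<dots> = 2 powr (p - 1) * \<bar>a\<bar> powr p"
      using powr_mult_base[of "\<bar>a\<bar>" "p - 1"] by (simp add: powr_mult mult_ac)
    finally show ?thesis using powr_ge_zero[of "\<bar>b\<bar>" p] by linarith
  qed
  finally have 1: "pflux p b * (a - b) \<le> 2 powr (p - 1) * \<bar>a\<bar> powr p - \<bar>b\<bar> powr p / 2"
    using pflux_mult_self[of p b] by (simp add: algebra_simps)
  have "\<bar>a - b\<bar> powr p \<le> 2 powr p * (\<bar>a\<bar> powr p + \<bar>b\<bar> powr p)"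
    using p by (intro powr_diff_le) auto
  then have "2 powr (- p - 1) * \<bar>a - b\<bar> powr p
      \<le> 2 powr (- p - 1) * (2 powr p * (\<bar>a\<bar> powr p + \<bar>b\<bar> powr p))"
    by (rule mult_left_mono) simp
  also have "\<dots> = (2 powr (- p - 1) * 2 powr p) * (\<bar>a\<bar> powr p + \<bar>b\<bar> powr p)" by simp
  also have "2 powr (- p - 1) * 2 powr p = (1/2::real)"
    by (subst powr_add[symmetric]) (simp add: powr_minus)
  finally have 2: "2 powr (- p - 1) * \<bar>a - b\<bar> powr p \<le> (\<bar>a\<bar> powr p + \<bar>b\<bar> powr p) / 2" by simp
  have "2 powr (1 - 1) \<le> 2 powr (p - 1)" using p by (intro powr_mono) auto
  moreover have "2 powr p = 2 * 2 powr (p - 1)" by (simp add: powr_diff)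
  ultimately have "1 / 2 + 2 powr (p - 1) \<le> 2 powr p" by simp
  then have "(1 / 2 + 2 powr (p - 1)) * \<bar>a\<bar> powr p \<le> 2 powr p * \<bar>a\<bar> powr p"
    by (rule mult_right_mono) simp
  with 1 2 show ?thesis by (simp add: algebra_simps)
qed

lemma powr_diff_lower:
  fixes A B q :: real
  assumes "1 \<le> q" "0 \<le> B" "B \<le> A"
  shows "A powr (q - 1) * (A - B) \<le> A powr q - B powr q"
proof -
  have "B powr q = B powr (q - 1) * B"
    using powr_mult_base[of B "q - 1"] assms by (simp add: mult.commute)
  also have "\<dots> \<le> A powr (q - 1) * B"
    using assms by (intro mult_right_mono powr_mono2) auto
  finally show ?thesis
    using powr_mult_base[of A "q - 1"] assms by (simp add: algebra_simps)
qed

lemma powr_diff_upper: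
  fixes A B q :: real
  assumes "1 \<le> q" "0 \<le> B" "B \<le> A"
  shows "A powr q - B powr q \<le> q * A powr (q - 1) * (A - B)"
proof (cases "q = 1")
  case False
  then have "q * pflux q A * (B - A) \<le> \<bar>B\<bar> powr q - \<bar>A\<bar> powr q"
    using assms by (intro powr_tangent) auto
  then show ?thesis using assms by (simp add: pflux_nonneg algebra_simps)
qed (use assms in simp)

text \<open>The pointwise estimate behind testing with a power of the solution, truncated at \<open>T\<close>.\<close>

lemma pflux_test_power_ordered:
  fixes a b p \<gamma> T :: real
  assumes p: "1 < p" and \<gamma>: "1 \<le> \<gamma>" and T: "0 \<le> T" and ab: "0 \<le> b" "b \<le> a"
  defines "q \<equiv> (\<gamma> + p - 1) / p"
  shows "(min a T powr q - min b T powr q) powr p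
      \<le> q powr p * (pflux p (a - b) * (min a T powr \<gamma> - min b T powr \<gamma>))"
proof -
  define A where "A = min a T"
  define B where "B = min b T"
  have AB: "0 \<le> B" "B \<le> A" "A - B \<le> a - b" using ab T by (auto simp: A_def B_def)
  have q: "1 \<le> q" using p \<gamma> by (simp add: q_def field_simps)
  \<comment> \<open>The defining property of \<open>q\<close>: the p-th power of
    \<open>A powr (q - 1) * (A - B)\<close> is
    \<open>A powr (\<gamma> - 1) * (A - B) powr p\<close>. One factor \<open>A - B\<close> is spent
    on the difference of the \<gamma>-th powers, and the remaining power \<open>p - 1\<close> forms
    the flux.\<close>
  have qp: "(q - 1) * p = \<gamma> - 1" using p by (simp add: q_def field_simps)
  have "(A powr q - B powr q) powr p \<le> (q * A powr (q - 1) * (A - B)) powr p"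
    using powr_diff_upper[OF q AB(1,2)] AB q p by (intro powr_mono2) (auto intro!: powr_mono2)
  also have "\<dots> = q powr p * (A powr (\<gamma> - 1) * (A - B) powr p)"
    using AB q by (simp add: powr_mult powr_powr qp)
  also have "(A - B) powr p = (A - B) powr (p - 1) * (A - B)"
    using powr_mult_base[of "A - B" "p - 1"] AB by (simp add: mult.commute)
  also have "A powr (\<gamma> - 1) * ((A - B) powr (p - 1) * (A - B))
      = (A - B) powr (p - 1) * (A powr (\<gamma> - 1) * (A - B))" by simp
  also have "\<dots> \<le> (A - B) powr (p - 1) * (A powr \<gamma> - B powr \<gamma>)"
    by (intro mult_left_mono powr_diff_lower \<gamma> AB) auto
  also have "\<dots> \<le> (a - b) powr (p - 1) * (A powr \<gamma> - B powr \<gamma>)"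
    using AB p \<gamma> by (intro mult_right_mono powr_mono2) (auto intro!: powr_mono2)
  finally show ?thesis
    using ab q by (simp add: A_def B_def pflux_nonneg)
qed

lemma pflux_test_power:
  fixes a b p \<gamma> T :: real
  assumes p: "1 < p" and \<gamma>: "1 \<le> \<gamma>" and T: "0 \<le> T" and ab: "0 \<le> a" "0 \<le> b"
  defines "q \<equiv> (\<gamma> + p - 1) / p"
  shows "\<bar>min a T powr q - min b T powr q\<bar> powr p
      \<le> q powr p * (pflux p (a - b) * (min a T powr \<gamma> - min b T powr \<gamma>))"
proof -
  have q: "1 \<le> q" using p \<gamma> by (simp add: q_def field_simps)
  show ?thesis
  proof (cases "b \<le> a")
    case True
    then have "min b T powr q \<le> min a T powr q" using ab T q by (intro powr_mono2) auto
    then show ?thesis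
      using pflux_test_power_ordered[OF p \<gamma> T ab(2) True] by (simp add: q_def)
  next
    case False
    then have "min a T powr q \<le> min b T powr q" using ab T q by (intro powr_mono2) auto
    moreover have "pflux p (a - b) = - pflux p (b - a)" using pflux_minus[of p "b - a"] by simp
    ultimately show ?thesis
      using pflux_test_power_ordered[OF p \<gamma> T ab(1), of b] False by (simp add: q_def algebra_simps)
  qed
qed

text \<open>Only the larger of the two values enters the slope bound \<open>powr_diff_lower\<close>,
  and it is at least \<open>c\<close> even if \<open>b\<close> is close to 0.\<close>

lemma abs_diff_le_powr_diff:
  fixes a b c q :: real
  assumes q: "1 \<le> q" and c: "0 < c" and ab: "c \<le> a" "0 \<le> b"
  shows "\<bar>a - b\<bar> \<le> c powr (1 - q) * \<bar>a powr q - b powr q\<bar>"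
proof -
  define A where "A = max a b"
  define B where "B = min a b"
  have AB: "0 \<le> B" "B \<le> A" "c \<le> A" using ab c by (auto simp: A_def B_def)
  have "c powr (q - 1) * (A - B) \<le> A powr (q - 1) * (A - B)"
    using AB c q by (intro mult_right_mono powr_mono2) auto
  also have "\<dots> \<le> A powr q - B powr q" by (rule powr_diff_lower[OF q AB(1,2)])
  also have "\<dots> \<le> \<bar>a powr q - b powr q\<bar>" by (auto simp: A_def B_def max_def min_def)
  finally have "c powr (1 - q) * (c powr (q - 1) * (A - B)) \<le> c powr (1 - q) * \<bar>a powr q - b powr q\<bar>"
    by (rule mult_left_mono) simp
  moreover have "c powr (1 - q) * (c powr (q - 1) * (A - B)) = \<bar>a - b\<bar>"
  proof -
    have "c powr (1 - q) * c powr (q - 1) = 1"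
      using c by (simp add: powr_add[symmetric])
    moreover have "A - B = \<bar>a - b\<bar>" by (auto simp: A_def B_def)
    ultimately show ?thesis by (metis mult.assoc mult_1)
  qed
  ultimately show ?thesis by metis
qed

text \<open>The pointwise estimate behind the Caccioppoli inequality for \<open>\<phi> = (w - u)\<^sup>+\<close>; here
  \<open>u\<^sub>1, u\<^sub>2\<close> and \<open>w\<^sub>1, w\<^sub>2\<close> are the values at two points.\<close>

lemma pflux_caccioppoli:
  fixes p u1 u2 w1 w2 :: real
  assumes p: "1 < p"
  defines "f1 \<equiv> max 0 (w1 - u1)" and "f2 \<equiv> max 0 (w2 - u2)"
  shows "pflux p (u1 - u2) * (f1 - f2)
     \<le> 2 powr p * (if f1 > 0 \<or> f2 > 0 then \<bar>w1 - w2\<bar> powr p else 0)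
        - 2 powr (- p - 1) * \<bar>f1 - f2\<bar> powr p"
proof -
  \<comment> \<open>If only the first point carries the test function, monotonicity of the flux
    allows \<open>v2\<close> to be lowered to \<open>z2\<close>, which reduces the case to
    \<open>pflux_coercive\<close> with the gap \<open>z1 - z2\<close>.\<close>
  have one: "pflux p (v1 - v2) * (z1 - v1)
      \<le> 2 powr p * \<bar>z1 - z2\<bar> powr p - 2 powr (- p - 1) * \<bar>z1 - v1\<bar> powr p"
    if "v1 < z1" "z2 \<le> v2" for v1 v2 z1 z2 :: real
  proof -
    let ?a = "z1 - z2" and ?f = "z1 - v1"
    have "pflux p (v1 - v2) * ?f \<le> pflux p (?a - ?f) * ?f"
      using that p by (intro mult_right_mono pflux_mono) auto
    then show ?thesis using pflux_coercive[OF p, of "?a - ?f" ?a] by simp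
  qed
  consider "u1 < w1" "u2 < w2" | "u1 < w1" "w2 \<le> u2" | "w1 \<le> u1" "u2 < w2" | "w1 \<le> u1" "w2 \<le> u2"
    by linarith
  then show ?thesis
  proof cases
    case 1
    then show ?thesis
      using pflux_coercive[OF p, of "u1 - u2" "w1 - w2"] by (simp add: f1_def f2_def algebra_simps)
  next
    case 2
    then show ?thesis using one[of u1 w1 w2 u2] by (simp add: f1_def f2_def)
  next
    case 3
    have "pflux p (u1 - u2) = - pflux p (u2 - u1)" using pflux_minus[of p "u2 - u1"] by simp
    then show ?thesis using one[of u2 w2 w1 u1] 3
      by (simp add: f1_def f2_def abs_minus_commute algebra_simps)
  next
    case 4
    then show ?thesis by (simp add: f1_def f2_def)
  qed
qed

subsection \<open>The energy space\<close>

lemma dyadic_interval: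
  fixes h :: real
  assumes "0 < h"
  obtains i :: int where "2 powr of_int i \<le> h" "h < 2 powr (of_int i + 1)"
proof
  show "2 powr of_int \<lfloor>log 2 h\<rfloor> \<le> h"
    using assms by (simp add: le_log_iff[symmetric])
  show "h < 2 powr (of_int \<lfloor>log 2 h\<rfloor> + 1)"
    using assms by (simp add: log_less_iff[symmetric])
qed

lemma suminf_ennreal_geometric:
  fixes c b :: real
  assumes "0 \<le> c" "b < 0"
  shows "(\<Sum>k. ennreal (c * 2 powr (real k * b))) = ennreal (c / (1 - 2 powr b))"
proof -
  have "2 powr b < 2 powr 0" using assms by (intro powr_less_mono) auto
  then have q: "\<bar>2 powr b\<bar> < (1::real)" by simp
  have eq: "2 powr (real k * b) = (2 powr b) ^ k" for k
    by (simp add: powr_powr[symmetric] powr_realpow mult.commute)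
  have "(\<Sum>k. ennreal (c * (2 powr b) ^ k)) = ennreal (\<Sum>k. c * (2 powr b) ^ k)"
    using q assms by (intro suminf_ennreal2) (auto intro!: summable_mult summable_geometric)
  also have "(\<Sum>k. c * (2 powr b) ^ k) = c / (1 - 2 powr b)"
    using q by (subst suminf_mult) (auto simp: suminf_geometric intro!: summable_geometric)
  finally show ?thesis by (simp add: eq)
qed

lemma emeasure_ball_powr:
  fixes x :: "'a::euclidean_space"
  assumes "0 < r"
  shows "emeasure lborel (ball x r) = ennreal (unit_ball_vol DIM('a) * r powr DIM('a))"
  using assms by (simp add: emeasure_ball powr_realpow)

text \<open>Fatou's lemma for real-valued integrals; it replaces weak lower semicontinuity whenever
  a bound on energies or norms passes to an almost everywhere limit.\<close>

lemma integrable_AE_limit: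
  fixes f :: "nat \<Rightarrow> 'b \<Rightarrow> real"
  assumes [measurable]: "\<And>n. f n \<in> borel_measurable M" "g \<in> borel_measurable M"
    and nn: "\<And>n. AE x in M. 0 \<le> f n x"
    and int: "\<And>n. integrable M (f n)" and le: "\<And>n. integral\<^sup>L M (f n) \<le> C"
    and lim: "AE x in M. (\<lambda>n. f n x) \<longlonglongrightarrow> g x"
  shows "integrable M g" "integral\<^sup>L M g \<le> C"
proof -
  have nn_all: "AE x in M. \<forall>n. 0 \<le> f n x" using nn by (simp add: AE_all_countable)
  then have g_nn: "AE x in M. 0 \<le> g x"
    using lim by eventually_elim (auto intro: LIMSEQ_le_const)
  have C: "0 \<le> C" using integral_nonneg_AE[OF nn[of 0]] le[of 0] by linarith
  have "(\<integral>\<^sup>+x. ennreal (g x) \<partial>M) = (\<integral>\<^sup>+x. liminf (\<lambda>n. ennreal (f n x)) \<partial>M)"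
  proof (rule nn_integral_cong_AE)
    show "AE x in M. ennreal (g x) = liminf (\<lambda>n. ennreal (f n x))"
      using lim
    proof eventually_elim
      case (elim x)
      have "(\<lambda>n. ennreal (f n x)) \<longlonglongrightarrow> ennreal (g x)" by (rule tendsto_ennrealI[OF elim])
      then show ?case by (rule lim_imp_Liminf[symmetric, rotated]) simp
    qed
  qed
  also have "\<dots> \<le> liminf (\<lambda>n. \<integral>\<^sup>+x. ennreal (f n x) \<partial>M)"
    by (rule nn_integral_liminf) simp
  also have "\<dots> \<le> liminf (\<lambda>n::nat. ennreal C)"
  proof (rule Liminf_mono, rule always_eventually, rule allI)
    fix n
    have "(\<integral>\<^sup>+x. ennreal (f n x) \<partial>M) = ennreal (integral\<^sup>L M (f n))"
      by (rule nn_integral_eq_integral[OF int nn])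
    then show "(\<integral>\<^sup>+x. ennreal (f n x) \<partial>M) \<le> ennreal C" using le by (simp add: ennreal_leI)
  qed
  also have "\<dots> = ennreal C" by (simp add: Liminf_const)
  finally have fin: "(\<integral>\<^sup>+x. ennreal (g x) \<partial>M) \<le> ennreal C" .
  show "integrable M g"
    using fin g_nn by (intro integrableI_nonneg) (auto simp: le_less_trans)
  then have "(\<integral>\<^sup>+x. ennreal (g x) \<partial>M) = ennreal (integral\<^sup>L M g)"
    by (rule nn_integral_eq_integral[OF _ g_nn])
  with fin show "integral\<^sup>L M g \<le> C" using C by (simp add: ennreal_le_iff)
qed

abbreviation gap :: "('a \<Rightarrow> real) \<Rightarrow> 'a \<times> 'a \<Rightarrow> real" where
  "gap u z \<equiv> u (fst z) - u (snd z)"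

locale frac_space =
  fixes p s N :: real and \<Omega> :: "'a::euclidean_space set"
  assumes p: "1 < p" and s_pos: "0 < s" and s_less: "s < 1"
    and N_eq: "N = DIM('a)" and sp: "s * p < N"
    and open_\<Omega>: "open \<Omega>" and bounded_\<Omega>: "bounded \<Omega>"
begin

lemma N_pos: "0 < N"
  by (simp add: N_eq)

definition pst :: real where
  "pst = N * p / (N - s * p)"

definition kernel :: "'a \<times> 'a \<Rightarrow> real" where
  "kernel z = 1 / norm (fst z - snd z) powr (N + s * p)"

text \<open>Absorbing the kernel into the measure makes \<open>energy u\<close> the p-th power of an
  L^p norm of \<open>gap u\<close>, and \<open>form u \<phi>\<close> the pairing of its flux with
  \<open>gap \<phi>\<close>.\<close>

definition M :: "('a \<times> 'a) measure" where
  "M = density lborel (\<lambda>z. ennreal (kernel z))"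

text \<open>The Sobolev space with zero exterior values, in Borel representatives that vanish at
  every point outside \<open>\<Omega>\<close>. That its elements lie in L^p is not part of the
  definition; it follows from the Sobolev inequality.\<close>

definition X :: "('a \<Rightarrow> real) set" where
  "X = {u \<in> borel_measurable borel. (\<forall>x. x \<notin> \<Omega> \<longrightarrow> u x = 0) \<and>
          integrable M (\<lambda>z. \<bar>gap u z\<bar> powr p)}"

definition energy :: "('a \<Rightarrow> real) \<Rightarrow> real" where
  "energy u = (\<integral>z. \<bar>gap u z\<bar> powr p \<partial>M)"

definition form :: "('a \<Rightarrow> real) \<Rightarrow> ('a \<Rightarrow> real) \<Rightarrow> real" where
  "form u \<phi> = (\<integral>z. pflux p (gap u z) * gap \<phi> z \<partial>M)"

lemma sp_pos: "0 < s * p"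
  using p s_pos by simp

lemma pst_gt: "p < pst"
  using p sp sp_pos by (simp add: pst_def field_simps)

lemma pst_pos: "0 < pst"
  using pst_gt p by simp

lemma sets_\<Omega> [measurable]: "\<Omega> \<in> sets borel"
  using open_\<Omega> by simp

lemma kernel_nonneg [simp]: "0 \<le> kernel z"
  by (simp add: kernel_def)

lemma measurable_kernel [measurable]: "kernel \<in> borel_measurable borel"
  unfolding kernel_def[abs_def] borel_prod[symmetric] by measurable

lemma sets_M [simp, measurable_cong]: "sets M = sets borel"
  by (simp add: M_def)

lemma space_M [simp]: "space M = UNIV"
  by (simp add: M_def)

lemma measurable_gap [measurable]:
  "u \<in> borel_measurable borel \<Longrightarrow> gap u \<in> borel_measurable (borel :: ('a \<times> 'a) measure)"
  by (simp add: borel_prod[symmetric])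

lemma nn_integral_M:
  fixes F :: "'a \<times> 'a \<Rightarrow> ennreal"
  assumes [measurable]: "F \<in> borel_measurable borel"
  shows "(\<integral>\<^sup>+z. F z \<partial>M) = (\<integral>\<^sup>+x. \<integral>\<^sup>+y. ennreal (kernel (x, y)) * F (x, y) \<partial>lborel \<partial>lborel)"
    and "(\<integral>\<^sup>+z. F z \<partial>M) = (\<integral>\<^sup>+y. \<integral>\<^sup>+x. ennreal (kernel (x, y)) * F (x, y) \<partial>lborel \<partial>lborel)"
proof -
  have m: "(\<lambda>z. ennreal (kernel z) * F z) \<in> borel_measurable (lborel \<Otimes>\<^sub>M lborel)"
    by (simp add: lborel_prod)
  have 0: "(\<integral>\<^sup>+z. F z \<partial>M) = (\<integral>\<^sup>+z. ennreal (kernel z) * F z \<partial>(lborel \<Otimes>\<^sub>M lborel))"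
    by (simp add: M_def nn_integral_density lborel_prod)
  show 1: "(\<integral>\<^sup>+z. F z \<partial>M) = (\<integral>\<^sup>+x. \<integral>\<^sup>+y. ennreal (kernel (x, y)) * F (x, y) \<partial>lborel \<partial>lborel)"
    unfolding 0 by (rule lborel.nn_integral_fst[OF m, symmetric])
  show "(\<integral>\<^sup>+z. F z \<partial>M) = (\<integral>\<^sup>+y. \<integral>\<^sup>+x. ennreal (kernel (x, y)) * F (x, y) \<partial>lborel \<partial>lborel)"
    unfolding 1 using m by (intro lborel_pair.Fubini'[symmetric]) (simp add: case_prod_unfold)
qed

lemma kernel_swap: "kernel (x, y) = kernel (y, x)"
  by (simp add: kernel_def norm_minus_commute)

lemma nn_integral_M_swap:
  fixes F :: "'a \<times> 'a \<Rightarrow> ennreal"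
  assumes F [measurable]: "F \<in> borel_measurable borel"
  shows "(\<integral>\<^sup>+z. F (snd z, fst z) \<partial>M) = (\<integral>\<^sup>+z. F z \<partial>M)"
proof -
  have "(\<lambda>z. F (snd z, fst z)) \<in> borel_measurable borel"
    using F unfolding borel_prod[symmetric] by measurable
  then show ?thesis
    by (simp add: nn_integral_M(1)[of "\<lambda>z. F (snd z, fst z)"] nn_integral_M(2)[OF F] kernel_swap)
qed

text \<open>The exceptional pairs lie in two cylinders over a null set. These are null for the
  product measure, with respect to which \<open>M\<close> has a density.\<close>

lemma AE_M:
  assumes "AE x in lborel. P x"
  shows "AE z in M. P (fst z) \<and> P (snd z)"
proof -
  obtain N' where N': "N' \<in> null_sets lborel" "{x. \<not> P x} \<subseteq> N'"
    using assms unfolding eventually_ae_filter by auto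
  have "emeasure (lborel \<Otimes>\<^sub>M lborel) (N' \<times> UNIV) = 0" "emeasure (lborel \<Otimes>\<^sub>M lborel) (UNIV \<times> N') = 0"
    using N' by (simp_all add: lborel.emeasure_pair_measure_Times null_sets_def)
  then have "N' \<times> UNIV \<in> null_sets (lborel \<Otimes>\<^sub>M lborel)" "UNIV \<times> N' \<in> null_sets (lborel \<Otimes>\<^sub>M lborel)"
    using N' by (simp_all add: null_sets_def pair_measureI)
  then have "AE z in lborel \<Otimes>\<^sub>M lborel. z \<notin> N' \<times> UNIV \<and> z \<notin> UNIV \<times> N'"
    by (intro AE_conjI AE_not_in)
  then have "AE z in lborel \<Otimes>\<^sub>M lborel. P (fst z) \<and> P (snd z)"
    by (rule eventually_mono) (use N'(2) in \<open>auto simp: mem_Times_iff\<close>)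
  then show ?thesis
    unfolding M_def lborel_prod by (subst AE_density) auto
qed

lemma emeasure_\<Omega>: "emeasure lborel \<Omega> < \<infinity>"
  using bounded_\<Omega> by (rule emeasure_bounded_finite)

subsection \<open>The kernel\<close>

text \<open>With \<open>h = norm (x - y)\<close>, the integrand is of order
  \<open>h powr (p - N - s * p)\<close> near the diagonal, integrable because \<open>s < 1\<close>,
  and of order \<open>h powr (- N - s * p)\<close> far away, integrable because
  \<open>s > 0\<close>. Dyadic annuli turn both facts into geometric series and take the place of
  polar coordinates.\<close>

lemma kernel_integral_bounded:
  assumes L: "0 \<le> L"
  shows "\<exists>C\<ge>0. \<forall>x.
    (\<integral>\<^sup>+y. ennreal (kernel (x, y)) * ennreal (min 1 (L * norm (x - y)) powr p) \<partial>lborel) \<le> ennreal C"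
proof -
  define a where "a = N + s * p"
  define w where "w = unit_ball_vol N"
  define c where "c = L powr p + 1"
  have w: "0 \<le> w" by (simp add: w_def N_eq)
  have c: "1 \<le> c" by (simp add: c_def)
  have a: "0 < a" using sp_pos N_pos by (simp add: a_def)
  \<comment> \<open>\<open>T1 k\<close> covers the annulus from \<open>2 powr k\<close> to
    \<open>2 powr (k + 1)\<close>, and \<open>T2 k\<close> the one from
    \<open>2 powr (- k - 1)\<close> to \<open>2 powr (- k)\<close>. Indicators of full balls stand
    for those of the annuli; this changes only the constants.\<close>
  define T1 where "T1 k x y = ennreal (c * 2 powr (- real k * a)) * indicator (ball x (2 powr (real k + 1))) y"
    for k and x y :: 'a
  define T2 where "T2 k x y = ennreal (c * 2 powr a * 2 powr (real k * (a - p))) * indicator (ball x (2 powr (- real k))) y"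
    for k and x y :: 'a
  have bound: "ennreal (kernel (x, y)) * ennreal (min 1 (L * norm (x - y)) powr p)
      \<le> (\<Sum>k. T1 k x y) + (\<Sum>k. T2 k x y)" for x y
  proof (cases "x = y")
    case True
    then show ?thesis using p by simp
  next
    case False
    define h where "h = norm (x - y)"
    have h: "0 < h" using False by (simp add: h_def)
    have ker: "kernel (x, y) = h powr (- a)" unfolding kernel_def h_def a_def by (simp only: powr_minus_divide fst_conv snd_conv)
    have le_h: "min 1 (L * h) powr p \<le> c * h powr p"
    proof -
      have "min 1 (L * h) powr p \<le> (L * h) powr p" using p L h by (intro powr_mono2) auto
      also have "\<dots> = L powr p * h powr p" using L h by (simp add: powr_mult)
      also have "\<dots> \<le> c * h powr p" by (intro mult_right_mono) (auto simp: c_def)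
      finally show ?thesis .
    qed
    have le_1: "min 1 (L * h) powr p \<le> c"
    proof -
      have "min 1 (L * h) powr p \<le> 1 powr p" using p L h by (intro powr_mono2) auto
      then show ?thesis using c by simp
    qed
    obtain i :: int where i: "2 powr of_int i \<le> h" "h < 2 powr (of_int i + 1)"
      using dyadic_interval[OF h] by blast
    show ?thesis
    proof (cases "0 \<le> i")
      case True
      define k where "k = nat i"
      have k: "real_of_int i = real k" using True by (simp add: k_def)
      have "kernel (x, y) * min 1 (L * h) powr p \<le> (2 powr real k) powr (- a) * c"
        unfolding ker using i le_1 a by (intro mult_mono powr_mono2') (auto simp: k)
      also have "\<dots> = c * 2 powr (- real k * a)" by (simp add: powr_powr)
      finally have "ennreal (kernel (x, y)) * ennreal (min 1 (L * h) powr p) \<le> T1 k x y"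
        using i by (auto simp: T1_def k h_def[symmetric] dist_norm ennreal_mult[symmetric] intro!: ennreal_leI)
      also have "\<dots> \<le> (\<Sum>k. T1 k x y)"
        using sum_le_suminf[of "\<lambda>k. T1 k x y" "{k}"] by (simp add: summableI)
      finally show ?thesis by (simp add: h_def add_increasing2)
    next
      case False
      define k where "k = nat (- i - 1)"
      have k: "real_of_int i = - real k - 1" using False by (simp add: k_def)
      \<comment> \<open>The sign of \<open>p - a\<close> is not known, so the largest value may sit
        at either end of the annulus; the factor \<open>2 powr a\<close> covers both cases.\<close>
      have *: "h powr (p - a) \<le> 2 powr a * 2 powr (real k * (a - p))"
      proof (cases "p \<le> a")
        case True
        have "h powr (p - a) \<le> (2 powr (- real k - 1)) powr (p - a)"
          using True i by (intro powr_mono2') (auto simp: k)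
        also have "\<dots> = 2 powr (a - p + real k * (a - p))" by (simp add: powr_powr algebra_simps)
        also have "\<dots> \<le> 2 powr (a + real k * (a - p))" using p by (intro powr_mono) auto
        finally show ?thesis by (simp add: powr_add)
      next
        case False
        have "h powr (p - a) \<le> (2 powr (- real k)) powr (p - a)"
          using False i h by (intro powr_mono2) (auto simp: k)
        also have "\<dots> = 2 powr (0 + real k * (a - p))" by (simp add: powr_powr algebra_simps)
        also have "\<dots> \<le> 2 powr (a + real k * (a - p))" using a by (intro powr_mono) auto
        finally show ?thesis by (simp add: powr_add)
      qed
      have "kernel (x, y) * min 1 (L * h) powr p \<le> h powr (- a) * (c * h powr p)"
        unfolding ker using le_h by (intro mult_left_mono) auto
      also have "\<dots> = c * h powr (p - a)" using h by (simp add: powr_add[symmetric] powr_diff powr_minus field_simps)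
      also have "\<dots> \<le> c * (2 powr a * 2 powr (real k * (a - p)))"
        using * c by (intro mult_left_mono) auto
      finally have "ennreal (kernel (x, y)) * ennreal (min 1 (L * h) powr p) \<le> T2 k x y"
        using i by (auto simp: T2_def k h_def[symmetric] dist_norm ennreal_mult[symmetric] mult.assoc intro!: ennreal_leI)
      also have "\<dots> \<le> (\<Sum>k. T2 k x y)"
        using sum_le_suminf[of "\<lambda>k. T2 k x y" "{k}"] by (simp add: summableI)
      finally show ?thesis by (simp add: h_def add_increasing)
    qed
  qed
  define C where "C = c * w * 2 powr N / (1 - 2 powr (- (s * p))) + c * 2 powr a * w / (1 - 2 powr (- (p - s * p)))"
  have q1: "- (s * p) < 0" using sp_pos by simp
  have q2: "- (p - s * p) < 0" using p s_less by simp
  have "2 powr (- (s * p)) < 2 powr 0" using q1 by (intro powr_less_mono) auto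
  moreover have "2 powr (- (p - s * p)) < 2 powr 0" using q2 by (intro powr_less_mono) auto
  ultimately have C1: "0 \<le> c * w * 2 powr N / (1 - 2 powr (- (s * p)))"
    and C2: "0 \<le> c * 2 powr a * w / (1 - 2 powr (- (p - s * p)))"
    using c w by auto
  have main: "(\<integral>\<^sup>+y. ennreal (kernel (x, y)) * ennreal (min 1 (L * norm (x - y)) powr p) \<partial>lborel) \<le> ennreal C" for x
  proof -
    have i1: "(\<integral>\<^sup>+y. T1 k x y \<partial>lborel) = ennreal (c * w * 2 powr N * 2 powr (real k * (- (s * p))))" for k
    proof -
      have "(\<integral>\<^sup>+y. T1 k x y \<partial>lborel) = ennreal (c * 2 powr (- real k * a)) * emeasure lborel (ball x (2 powr (real k + 1)))"
        unfolding T1_def by (subst nn_integral_cmult) (auto intro!: borel_measurable_indicator)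
      also have "\<dots> = ennreal (c * 2 powr (- real k * a) * (w * (2 powr (real k + 1)) powr N))"
        using c w by (subst emeasure_ball_powr) (auto simp: w_def N_eq ennreal_mult)
      also have "c * 2 powr (- real k * a) * (w * (2 powr (real k + 1)) powr N)
          = c * w * (2 powr (- real k * a) * 2 powr ((real k + 1) * N))" by (simp add: powr_powr)
      also have "2 powr (- real k * a) * 2 powr ((real k + 1) * N) = 2 powr N * 2 powr (real k * (- (s * p)))"
        by (simp add: powr_add[symmetric] a_def algebra_simps)
      finally show ?thesis by (simp add: mult_ac)
    qed
    have i2: "(\<integral>\<^sup>+y. T2 k x y \<partial>lborel) = ennreal (c * 2 powr a * w * 2 powr (real k * (- (p - s * p))))" for k
    proof -
      have "(\<integral>\<^sup>+y. T2 k x y \<partial>lborel) = ennreal (c * 2 powr a * 2 powr (real k * (a - p))) * emeasure lborel (ball x (2 powr (- real k)))"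
        unfolding T2_def by (subst nn_integral_cmult) (auto intro!: borel_measurable_indicator)
      also have "\<dots> = ennreal (c * 2 powr a * 2 powr (real k * (a - p)) * (w * (2 powr (- real k)) powr N))"
        using c w by (subst emeasure_ball_powr) (auto simp: w_def N_eq ennreal_mult)
      also have "c * 2 powr a * 2 powr (real k * (a - p)) * (w * (2 powr (- real k)) powr N)
          = c * 2 powr a * w * (2 powr (real k * (a - p)) * 2 powr (- real k * N))" by (simp add: powr_powr)
      also have "2 powr (real k * (a - p)) * 2 powr (- real k * N) = 2 powr (real k * (- (p - s * p)))"
        by (simp add: powr_add[symmetric] a_def algebra_simps)
      finally show ?thesis .
    qed
    have [measurable]: "ball x r \<in> sets borel" for r by simp
    have [measurable]: "(\<lambda>y. T1 k x y) \<in> borel_measurable borel" "(\<lambda>y. T2 k x y) \<in> borel_measurable borel" for k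
      unfolding T1_def T2_def by measurable
    have "(\<integral>\<^sup>+y. ennreal (kernel (x, y)) * ennreal (min 1 (L * norm (x - y)) powr p) \<partial>lborel)
        \<le> (\<integral>\<^sup>+y. (\<Sum>k. T1 k x y) + (\<Sum>k. T2 k x y) \<partial>lborel)"
      by (intro nn_integral_mono bound)
    also have "\<dots> = (\<integral>\<^sup>+y. (\<Sum>k. T1 k x y) \<partial>lborel) + (\<integral>\<^sup>+y. (\<Sum>k. T2 k x y) \<partial>lborel)"
      by (rule nn_integral_add) auto
    also have "(\<integral>\<^sup>+y. (\<Sum>k. T1 k x y) \<partial>lborel) = (\<Sum>k. \<integral>\<^sup>+y. T1 k x y \<partial>lborel)"
      by (rule nn_integral_suminf) auto
    also have "(\<integral>\<^sup>+y. (\<Sum>k. T2 k x y) \<partial>lborel) = (\<Sum>k. \<integral>\<^sup>+y. T2 k x y \<partial>lborel)"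
      by (rule nn_integral_suminf) auto
    also have "(\<Sum>k. \<integral>\<^sup>+y. T1 k x y \<partial>lborel) = ennreal (c * w * 2 powr N / (1 - 2 powr (- (s * p))))"
      unfolding i1 using c w q1 by (intro suminf_ennreal_geometric) auto
    also have "(\<Sum>k. \<integral>\<^sup>+y. T2 k x y \<partial>lborel) = ennreal (c * 2 powr a * w / (1 - 2 powr (- (p - s * p))))"
      unfolding i2 using c w q2 by (intro suminf_ennreal_geometric) auto
    also have "ennreal (c * w * 2 powr N / (1 - 2 powr (- (s * p)))) + ennreal (c * 2 powr a * w / (1 - 2 powr (- (p - s * p)))) = ennreal C"
      unfolding C_def using C1 C2 by (rule ennreal_plus[symmetric])
    finally show ?thesis .
  qed
  have "0 \<le> C" unfolding C_def using C1 C2 by simp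
  with main show ?thesis by blast
qed

text \<open>A bounded Lipschitz function satisfies \<open>\<bar>\<psi> x - \<psi> y\<bar> \<le> b *
  min 1 (L * norm (x - y))\<close>, so each fibre has mass at most a fixed constant. The bound over
  strips, linear in the measure of \<open>S\<close>, is what later ties the error in the Caccioppoli
  inequality to the measure of a level set.\<close>

lemma lipschitz_gap_integral:
  fixes \<psi> :: "'a \<Rightarrow> real"
  assumes [measurable]: "\<psi> \<in> borel_measurable borel"
    and B: "\<And>x. \<bar>\<psi> x\<bar> \<le> B" and L: "0 \<le> L" "\<And>x y. \<bar>\<psi> x - \<psi> y\<bar> \<le> L * norm (x - y)"
  shows "\<exists>C\<ge>0. \<forall>S\<in>sets borel.
       (\<integral>\<^sup>+z. ennreal (\<bar>gap \<psi> z\<bar> powr p) * indicator S (fst z) \<partial>M) \<le> ennreal C * emeasure lborel S \<and>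
       (\<integral>\<^sup>+z. ennreal (\<bar>gap \<psi> z\<bar> powr p) * indicator S (snd z) \<partial>M) \<le> ennreal C * emeasure lborel S"
proof -
  obtain C where C: "0 \<le> C"
    "\<And>x. (\<integral>\<^sup>+y. ennreal (kernel (x, y)) * ennreal (min 1 (L * norm (x - y)) powr p) \<partial>lborel) \<le> ennreal C"
    using kernel_integral_bounded[OF L(1)] by auto
  \<comment> \<open>\<open>2 * B\<close> bounds the gap; the added 1 gives \<open>1 \<le> b\<close>,
    so that the Lipschitz bound is preserved when the factor is inserted.\<close>
  define b where "b = 2 * B + 1"
  have "0 \<le> B" using B[of undefined] by linarith
  then have b: "1 \<le> b" by (simp add: b_def)
  have gap: "ennreal (\<bar>\<psi> x - \<psi> y\<bar> powr p) \<le> ennreal (b powr p) * ennreal (min 1 (L * norm (x - y)) powr p)" for x y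
  proof -
    have "\<bar>\<psi> x - \<psi> y\<bar> \<le> b * min 1 (L * norm (x - y))"
    proof (cases "1 \<le> L * norm (x - y)")
      case True
      then show ?thesis using B[of x] B[of y] by (simp add: b_def min_def)
    next
      case False
      have "1 * (L * norm (x - y)) \<le> b * (L * norm (x - y))" using b L by (intro mult_right_mono) auto
      then show ?thesis using False L(2)[of x y] by (simp add: min_def)
    qed
    then have "\<bar>\<psi> x - \<psi> y\<bar> powr p \<le> (b * min 1 (L * norm (x - y))) powr p"
      using p by (intro powr_mono2) auto
    also have "\<dots> = b powr p * min 1 (L * norm (x - y)) powr p"
      using b L by (simp add: powr_mult)
    finally show ?thesis by (simp add: ennreal_mult[symmetric] ennreal_leI)
  qed
  have gap': "ennreal (kernel (x, y)) * ennreal (\<bar>\<psi> x - \<psi> y\<bar> powr p)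
      \<le> ennreal (b powr p) * (ennreal (kernel (x, y)) * ennreal (min 1 (L * norm (x - y)) powr p))" for x y
    using mult_left_mono[OF gap, of "ennreal (kernel (x, y))" x y] by (simp add: mult.left_commute)
  have [measurable]: "(\<lambda>y. kernel (x, y)) \<in> borel_measurable borel" for x
    by (simp add: kernel_def)
  show ?thesis
  proof (intro exI[of _ "b powr p * C"] conjI ballI)
    show "0 \<le> b powr p * C" using C by simp
    fix S :: "'a set" assume [measurable]: "S \<in> sets borel"
    have [measurable]: "(\<lambda>z. indicator S (fst z) :: ennreal) \<in> borel_measurable (borel :: ('a \<times> 'a) measure)"
      by (simp add: borel_prod[symmetric])
    have "(\<integral>\<^sup>+z. ennreal (\<bar>gap \<psi> z\<bar> powr p) * indicator S (fst z) \<partial>M)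
      = (\<integral>\<^sup>+x. \<integral>\<^sup>+y. ennreal (kernel (x, y)) * (ennreal (\<bar>\<psi> x - \<psi> y\<bar> powr p) * indicator S x) \<partial>lborel \<partial>lborel)"
      by (subst nn_integral_M) auto
    also have "\<dots> \<le> (\<integral>\<^sup>+x. ennreal (b powr p * C) * indicator S x \<partial>lborel)"
    proof (rule nn_integral_mono)
      fix x
      have "(\<integral>\<^sup>+y. ennreal (kernel (x, y)) * (ennreal (\<bar>\<psi> x - \<psi> y\<bar> powr p) * indicator S x) \<partial>lborel)
         \<le> (\<integral>\<^sup>+y. (ennreal (b powr p) * indicator S x) * (ennreal (kernel (x, y)) * ennreal (min 1 (L * norm (x - y)) powr p)) \<partial>lborel)"
        using gap' by (intro nn_integral_mono) (auto simp: indicator_def)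
      also have "\<dots> = (ennreal (b powr p) * indicator S x) * (\<integral>\<^sup>+y. ennreal (kernel (x, y)) * ennreal (min 1 (L * norm (x - y)) powr p) \<partial>lborel)"
        by (rule nn_integral_cmult) auto
      also have "\<dots> \<le> (ennreal (b powr p) * indicator S x) * ennreal C"
        by (intro mult_left_mono C) auto
      also have "\<dots> = ennreal (b powr p * C) * indicator S x"
        using C by (simp add: ennreal_mult mult_ac)
      finally show "(\<integral>\<^sup>+y. ennreal (kernel (x, y)) * (ennreal (\<bar>\<psi> x - \<psi> y\<bar> powr p) * indicator S x) \<partial>lborel)
        \<le> ennreal (b powr p * C) * indicator S x" .
    qed
    also have "\<dots> = ennreal (b powr p * C) * emeasure lborel S"
      by (subst nn_integral_cmult) (auto intro!: borel_measurable_indicator)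
    finally show *: "(\<integral>\<^sup>+z. ennreal (\<bar>gap \<psi> z\<bar> powr p) * indicator S (fst z) \<partial>M) \<le> ennreal (b powr p * C) * emeasure lborel S" .
    have "(\<integral>\<^sup>+z. ennreal (\<bar>gap \<psi> z\<bar> powr p) * indicator S (snd z) \<partial>M)
        = (\<integral>\<^sup>+z. ennreal (\<bar>gap \<psi> z\<bar> powr p) * indicator S (fst z) \<partial>M)"
      using nn_integral_M_swap[of "\<lambda>z. ennreal (\<bar>gap \<psi> z\<bar> powr p) * indicator S (fst z)"]
      by (simp add: abs_minus_commute)
    with * show "(\<integral>\<^sup>+z. ennreal (\<bar>gap \<psi> z\<bar> powr p) * indicator S (snd z) \<partial>M) \<le> ennreal (b powr p * C) * emeasure lborel S"
      by simp
  qed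
qed

section \<open>Closure properties of the energy space\<close>

lemma X_D:
  assumes "u \<in> X"
  shows "u \<in> borel_measurable borel" "x \<notin> \<Omega> \<Longrightarrow> u x = 0" "integrable M (\<lambda>z. \<bar>gap u z\<bar> powr p)"
  using assms by (auto simp: X_def)

lemma measurable_gap_M [measurable]: "u \<in> borel_measurable borel \<Longrightarrow> gap u \<in> borel_measurable M"
  using measurable_gap[of u] by (simp cong: measurable_cong_sets)

lemma X_dominated:
  assumes [measurable]: "v \<in> borel_measurable borel" and "\<And>x. x \<notin> \<Omega> \<Longrightarrow> v x = 0"
    and g: "integrable M g" and le: "AE z in M. \<bar>gap v z\<bar> powr p \<le> g z"
  shows "v \<in> X" "energy v \<le> (\<integral>z. g z \<partial>M)"
proof -
  have i: "integrable M (\<lambda>z. \<bar>gap v z\<bar> powr p)"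
    by (rule Bochner_Integration.integrable_bound[OF g])
       (measurable, use le in \<open>auto elim!: eventually_mono\<close>)
  then show "v \<in> X" using assms by (auto simp: X_def)
  show "energy v \<le> (\<integral>z. g z \<partial>M)"
    unfolding energy_def using le by (intro integral_mono_AE i g)
qed

lemma X_nn:
  assumes [measurable]: "v \<in> borel_measurable borel" and "\<And>x. x \<notin> \<Omega> \<Longrightarrow> v x = 0"
    and "(\<integral>\<^sup>+z. ennreal (\<bar>gap v z\<bar> powr p) \<partial>M) < \<infinity>"
  shows "v \<in> X"
  using assms by (auto simp: X_def intro!: integrableI_bounded)

lemma nn_energy:
  assumes "u \<in> X"
  shows "(\<integral>\<^sup>+z. ennreal (\<bar>gap u z\<bar> powr p) \<partial>M) = ennreal (energy u)"
  unfolding energy_def using X_D(3)[OF assms] by (intro nn_integral_eq_integral) auto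

lemma energy_nonneg [simp]: "0 \<le> energy u"
  unfolding energy_def by (intro integral_nonneg_AE) auto

lemma X_zero: "(\<lambda>x. 0) \<in> X"
  using p by (auto simp: X_def)

text \<open>The Lipschitz bound is asked only along values of \<open>u\<close>, so that truncated
  powers of a nonnegative \<open>u\<close>, which are controlled for nonnegative arguments, are
  covered.\<close>

lemma X_lipschitz_comp:
  assumes u: "u \<in> X" and T [measurable]: "T \<in> borel_measurable borel" and T0: "T 0 = 0"
    and lip: "\<And>x y. \<bar>T (u x) - T (u y)\<bar> \<le> L * \<bar>u x - u y\<bar>" and L: "0 \<le> L"
  shows "(\<lambda>x. T (u x)) \<in> X" "energy (\<lambda>x. T (u x)) \<le> L powr p * energy u"
proof -
  note [measurable] = X_D(1)[OF u]
  have g: "integrable M (\<lambda>z. L powr p * \<bar>gap u z\<bar> powr p)"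
    using X_D(3)[OF u] by simp
  have le: "\<bar>gap (\<lambda>x. T (u x)) z\<bar> powr p \<le> L powr p * \<bar>gap u z\<bar> powr p" for z
  proof -
    have "\<bar>gap (\<lambda>x. T (u x)) z\<bar> powr p \<le> (L * \<bar>gap u z\<bar>) powr p"
      using p lip by (intro powr_mono2) auto
    then show ?thesis using L by (simp add: powr_mult)
  qed
  show "(\<lambda>x. T (u x)) \<in> X"
    by (rule X_dominated(1)[OF _ _ g]) (use le X_D(2)[OF u] T0 in auto)
  have "energy (\<lambda>x. T (u x)) \<le> (\<integral>z. L powr p * \<bar>gap u z\<bar> powr p \<partial>M)"
    by (rule X_dominated(2)[OF _ _ g]) (use le X_D(2)[OF u] T0 in auto)
  then show "energy (\<lambda>x. T (u x)) \<le> L powr p * energy u"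
    by (simp add: energy_def)
qed

lemma X_add_scaled:
  assumes u: "u \<in> X" and v: "v \<in> X"
  shows "(\<lambda>x. u x + c * v x) \<in> X"
proof -
  note [measurable] = X_D(1)[OF u] X_D(1)[OF v]
  have g: "integrable M (\<lambda>z. 2 powr p * (\<bar>gap u z\<bar> powr p + \<bar>c\<bar> powr p * \<bar>gap v z\<bar> powr p))"
    using X_D(3)[OF u] X_D(3)[OF v] by simp
  show ?thesis
  proof (rule X_dominated(1)[OF _ _ g])
    have "\<bar>gap (\<lambda>x. u x + c * v x) z\<bar> powr p
        \<le> 2 powr p * (\<bar>gap u z\<bar> powr p + \<bar>c\<bar> powr p * \<bar>gap v z\<bar> powr p)" for z
    proof -
      have eq: "gap (\<lambda>x. u x + c * v x) z = gap u z + c * gap v z" by (simp add: algebra_simps)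
      show ?thesis
        unfolding eq using powr_sum_le[of p "gap u z" "c * gap v z"] p by (simp add: abs_mult powr_mult)
    qed
    then show "AE z in M. \<bar>gap (\<lambda>x. u x + c * v x) z\<bar> powr p
        \<le> 2 powr p * (\<bar>gap u z\<bar> powr p + \<bar>c\<bar> powr p * \<bar>gap v z\<bar> powr p)" by simp
  qed (use X_D(2)[OF u] X_D(2)[OF v] in auto)
qed

lemma X_diff:
  assumes "u \<in> X" "v \<in> X"
  shows "(\<lambda>x. u x - v x) \<in> X"
  using X_add_scaled[OF assms, of "-1"] by simp

lemma X_midpoint:
  assumes "u \<in> X" "v \<in> X"
  shows "(\<lambda>x. (u x + v x) / 2) \<in> X"
proof -
  have w: "(\<lambda>x. u x + 1 * v x) \<in> X" by (rule X_add_scaled[OF assms])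
  have "(\<lambda>x. (u x + v x) / 2) = (\<lambda>x. 0 + 1 / 2 * (u x + 1 * v x))" by (auto simp: field_simps)
  then show ?thesis using X_add_scaled[OF X_zero w, of "1 / 2"] by simp
qed

lemma X_excess:
  assumes u: "u \<in> X" and t: "0 \<le> t"
  shows "(\<lambda>x. max 0 (u x - t)) \<in> X"
  using X_lipschitz_comp(1)[OF u, of "\<lambda>r. max 0 (r - t)" 1] t by (auto simp: max_def)

lemma X_pos_part: "u \<in> X \<Longrightarrow> (\<lambda>x. max 0 (u x)) \<in> X"
  using X_excess[of u 0] by simp

text \<open>A pair with both points outside \<open>\<Omega>\<close> has gap 0, so the two strips
  over \<open>\<Omega>\<close>, which has finite measure, carry all the energy.\<close>

lemma X_lipschitz:
  fixes \<psi> :: "'a \<Rightarrow> real"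
  assumes m [measurable]: "\<psi> \<in> borel_measurable borel"
    and B: "\<And>x. \<bar>\<psi> x\<bar> \<le> B" and L: "0 \<le> L" "\<And>x y. \<bar>\<psi> x - \<psi> y\<bar> \<le> L * norm (x - y)"
    and out: "\<And>x. x \<notin> \<Omega> \<Longrightarrow> \<psi> x = 0"
  shows "\<psi> \<in> X"
proof (rule X_nn)
  obtain C where C: "\<And>S. S \<in> sets borel \<Longrightarrow>
       (\<integral>\<^sup>+z. ennreal (\<bar>gap \<psi> z\<bar> powr p) * indicator S (fst z) \<partial>M) \<le> ennreal C * emeasure lborel S"
    "\<And>S. S \<in> sets borel \<Longrightarrow>
       (\<integral>\<^sup>+z. ennreal (\<bar>gap \<psi> z\<bar> powr p) * indicator S (snd z) \<partial>M) \<le> ennreal C * emeasure lborel S"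
    using lipschitz_gap_integral[OF m B L] by blast
  have [measurable]: "(\<lambda>z. indicator \<Omega> (fst z) :: ennreal) \<in> borel_measurable (borel :: ('a \<times> 'a) measure)"
      "(\<lambda>z. indicator \<Omega> (snd z) :: ennreal) \<in> borel_measurable (borel :: ('a \<times> 'a) measure)"
    by (simp_all add: borel_prod[symmetric])
  have "(\<integral>\<^sup>+z. ennreal (\<bar>gap \<psi> z\<bar> powr p) \<partial>M)
     \<le> (\<integral>\<^sup>+z. ennreal (\<bar>gap \<psi> z\<bar> powr p) * indicator \<Omega> (fst z)
          + ennreal (\<bar>gap \<psi> z\<bar> powr p) * indicator \<Omega> (snd z) \<partial>M)"
  proof (rule nn_integral_mono)
    fix z
    show "ennreal (\<bar>gap \<psi> z\<bar> powr p) \<le> ennreal (\<bar>gap \<psi> z\<bar> powr p) * indicator \<Omega> (fst z)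
          + ennreal (\<bar>gap \<psi> z\<bar> powr p) * indicator \<Omega> (snd z)"
      using out p by (cases "fst z \<in> \<Omega>"; cases "snd z \<in> \<Omega>") auto
  qed
  also have "\<dots> = (\<integral>\<^sup>+z. ennreal (\<bar>gap \<psi> z\<bar> powr p) * indicator \<Omega> (fst z) \<partial>M)
     + (\<integral>\<^sup>+z. ennreal (\<bar>gap \<psi> z\<bar> powr p) * indicator \<Omega> (snd z) \<partial>M)"
    by (rule nn_integral_add) auto
  also have "\<dots> \<le> ennreal C * emeasure lborel \<Omega> + ennreal C * emeasure lborel \<Omega>"
    by (intro add_mono C) auto
  also have "\<dots> < \<infinity>" using emeasure_\<Omega> by (simp add: ennreal_mult_less_top)
  finally show "(\<integral>\<^sup>+z. ennreal (\<bar>gap \<psi> z\<bar> powr p) \<partial>M) < \<infinity>" .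
qed (use out in auto)

text \<open>The pointwise bound by the sum of the two p-th powers does the work of Hoelder's
  inequality.\<close>

lemma form_integrable:
  assumes u: "u \<in> X" and v: "v \<in> X"
  shows "integrable M (\<lambda>z. pflux p (gap u z) * gap v z)"
proof (rule Bochner_Integration.integrable_bound)
  note [measurable] = X_D(1)[OF u] X_D(1)[OF v]
  show "integrable M (\<lambda>z. \<bar>gap u z\<bar> powr p + \<bar>gap v z\<bar> powr p)"
    using X_D(3)[OF u] X_D(3)[OF v] by simp
  show "(\<lambda>z. pflux p (gap u z) * gap v z) \<in> borel_measurable M" by measurable
  show "AE z in M. norm (pflux p (gap u z) * gap v z) \<le> norm (\<bar>gap u z\<bar> powr p + \<bar>gap v z\<bar> powr p)"
    using powr_mult_le_sum[OF p] by (simp add: abs_mult abs_pflux)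
qed

lemma X_AE_cong:
  assumes u: "u \<in> X" and v [measurable]: "v \<in> borel_measurable borel"
    and out: "\<And>x. x \<notin> \<Omega> \<Longrightarrow> v x = 0" and eq: "AE x in lborel. u x = v x"
  shows "v \<in> X" "energy v = energy u" "\<phi> \<in> X \<Longrightarrow> form v \<phi> = form u \<phi>"
proof -
  note [measurable] = X_D(1)[OF u]
  have eq2: "AE z in M. gap v z = gap u z"
    using AE_M[OF eq] by eventually_elim simp
  show "v \<in> X"
    by (rule X_dominated(1)[OF v out X_D(3)[OF u]]) (use eq2 in \<open>auto elim!: eventually_mono\<close>)
  show "energy v = energy u"
    unfolding energy_def by (rule integral_cong_AE) (use eq2 in \<open>auto elim!: eventually_mono\<close>)
  assume "\<phi> \<in> X"
  note [measurable] = X_D(1)[OF this]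
  show "form v \<phi> = form u \<phi>"
    unfolding form_def by (rule integral_cong_AE) (use eq2 in \<open>auto elim!: eventually_mono\<close>)
qed

subsection \<open>The fractional Sobolev inequality\<close>

text \<open>The constant of the half-ball estimate in \<open>sobolev_pointwise\<close>: the first
  factor undoes \<open>(t / 2) powr p\<close> and half the volume of the unit ball, the second the
  numerical part of \<open>Q powr (- (s * p / N))\<close>.\<close>

definition sob :: real where
  "sob = 2 powr (p + 1) / unit_ball_vol N * (2 powr (1 + pst) / unit_ball_vol N) powr (s * p / N)"

lemma unit_ball_vol_N: "0 < unit_ball_vol N"
  by (simp add: N_eq)

lemma sob_pos: "0 < sob"
  using unit_ball_vol_N by (simp add: sob_def)

text \<open>If \<open>r\<close> is chosen such that \<open>\<bar>u\<bar> \<le> \<bar>u x\<bar> / 2\<close> on at least half of the ball of radius \<open>r\<close> about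
  \<open>x\<close>, then that half alone makes the inner integral large.\<close>

lemma sobolev_pointwise:
  assumes u [measurable]: "u \<in> borel_measurable borel" and A: "0 < A"
    and int: "(\<integral>\<^sup>+y. ennreal (\<bar>u y\<bar> powr pst) \<partial>lborel) \<le> ennreal A"
  shows "ennreal (\<bar>u x\<bar> powr pst)
     \<le> ennreal (sob * A powr (s * p / N)) * (\<integral>\<^sup>+y. ennreal (kernel (x, y)) * ennreal (\<bar>u x - u y\<bar> powr p) \<partial>lborel)"
proof (cases "u x = 0")
  case False
  define t where "t = \<bar>u x\<bar>"
  define w where "w = unit_ball_vol N"
  \<comment> \<open>With \<open>r powr N = Q\<close> the ball has volume \<open>w * Q\<close>, and
    Markov's inequality bounds the set \<open>S\<close> by
    \<open>2 powr pst * A / t powr pst\<close>, which is exactly \<open>w * Q / 2\<close>.\<close>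
  define Q where "Q = 2 powr (1 + pst) * A / (w * t powr pst)"
  define r where "r = Q powr (1 / N)"
  define S where "S = {y. t / 2 < \<bar>u y\<bar>}"
  define G where "G = ball x r - S"
  have t: "0 < t" using False by (simp add: t_def)
  have w: "0 < w" unfolding w_def by (rule unit_ball_vol_N)
  have Q: "0 < Q" using A w t by (simp add: Q_def)
  have r: "0 < r" using Q by (simp add: r_def)
  have rN: "r powr N = Q" using Q N_pos by (simp add: r_def powr_powr)
  have [measurable]: "S \<in> sets borel" unfolding S_def by measurable
  have [measurable]: "G \<in> sets borel" unfolding G_def by measurable
  have ball: "emeasure lborel (ball x r) = ennreal (w * Q)"
    using emeasure_ball_powr[OF r, of x] rN by (simp add: w_def N_eq)
  have "ennreal ((t / 2) powr pst) * emeasure lborel S = (\<integral>\<^sup>+y. ennreal ((t / 2) powr pst) * indicator S y \<partial>lborel)"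
    by (subst nn_integral_cmult) (auto intro!: borel_measurable_indicator)
  also have "\<dots> \<le> (\<integral>\<^sup>+y. ennreal (\<bar>u y\<bar> powr pst) \<partial>lborel)"
    using t pst_pos by (intro nn_integral_mono) (auto simp: indicator_def S_def intro!: ennreal_leI powr_mono2)
  also have "\<dots> \<le> ennreal A" by (rule int)
  finally have markov: "ennreal ((t / 2) powr pst) * emeasure lborel S \<le> ennreal A" .
  have S: "emeasure lborel S \<le> ennreal (w * Q / 2)"
  proof -
    have "emeasure lborel S = ennreal ((2 / t) powr pst) * (ennreal ((t / 2) powr pst) * emeasure lborel S)"
    proof -
      have "(2 / t) powr pst * (t / 2) powr pst = 1"
        using t by (simp add: powr_mult[symmetric])
      then have "ennreal ((2 / t) powr pst) * ennreal ((t / 2) powr pst) = 1"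
        by (simp add: ennreal_mult[symmetric])
      then show ?thesis by (simp add: mult.assoc[symmetric])
    qed
    also have "\<dots> \<le> ennreal ((2 / t) powr pst) * ennreal A"
      by (intro mult_left_mono markov) simp
    also have "\<dots> = ennreal (w * Q / 2)"
      using A w t by (simp add: ennreal_mult[symmetric] Q_def powr_add powr_divide)
    finally show ?thesis .
  qed
  have G: "ennreal (w * Q / 2) \<le> emeasure lborel G"
  proof -
    have "ennreal (w * Q / 2) + ennreal (w * Q / 2) = ennreal (w * Q)"
      using w Q by (simp add: ennreal_plus[symmetric] del: ennreal_plus)
    also have "\<dots> = emeasure lborel (ball x r)" by (simp add: ball)
    also have "\<dots> \<le> emeasure lborel (G \<union> S)" by (intro emeasure_mono) (auto simp: G_def)
    also have "\<dots> \<le> emeasure lborel G + emeasure lborel S" by (rule emeasure_subadditive) auto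
    also have "\<dots> \<le> emeasure lborel G + ennreal (w * Q / 2)" by (intro add_left_mono S)
    finally show ?thesis by (simp add: add.commute)
  qed
  define c where "c = r powr (- (N + s * p)) * (t / 2) powr p"
  \<comment> \<open>An equality: the powers of \<open>t\<close> match because the Sobolev exponent
    satisfies \<open>p + pst * (s * p / N) = pst\<close>, and \<open>sob\<close> collects all other
    constants.\<close>
  have key: "t powr pst = sob * A powr (s * p / N) * (c * (w * Q / 2))"
  proof -
    have rr: "r powr (- (N + s * p)) * Q = Q powr (- (s * p / N))"
    proof -
      have "r powr (- (N + s * p)) * Q = r powr (- (N + s * p)) * r powr N" by (simp add: rN)
      also have "\<dots> = r powr (- (s * p))" by (simp add: powr_add[symmetric])
      also have "\<dots> = Q powr (- (s * p / N))" by (simp add: r_def powr_powr)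
      finally show ?thesis .
    qed
    have "Q powr (- (s * p / N)) = (t powr pst) powr (s * p / N) / ((2 powr (1 + pst) / w) powr (s * p / N) * A powr (s * p / N))"
    proof -
      have "Q = ((2 powr (1 + pst) / w) * A) / t powr pst" by (simp add: Q_def)
      then have "Q powr (s * p / N) = ((2 powr (1 + pst) / w) powr (s * p / N) * A powr (s * p / N)) / (t powr pst) powr (s * p / N)"
        using A w t by (simp only: powr_mult powr_divide)
      then show ?thesis by (simp add: powr_minus)
    qed
    moreover have "c * (w * Q / 2) = (r powr (- (N + s * p)) * Q) * (t / 2) powr p * w / 2"
      by (simp add: c_def)
    moreover have "(t / 2) powr p = t powr p / 2 powr p" using t by (simp add: powr_divide)
    moreover have "t powr p * (t powr pst) powr (s * p / N) = t powr pst"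
    proof -
      have "p + pst * (s * p / N) = pst"
      proof -
        have "pst * (N - s * p) = N * p" using sp by (simp add: pst_def)
        then show ?thesis using N_pos by (simp add: field_simps)
      qed
      then show ?thesis by (simp add: powr_powr powr_add[symmetric])
    qed
    moreover have "2 * P / w * W * a * (T / (W * a) * (t' / P) * w / 2) = t' * T"
      if "0 < W" "0 < a" "0 < P" for W a P T t' :: real
      using that w by (simp add: field_simps)
    ultimately show ?thesis
      using w A unfolding sob_def w_def[symmetric] rr by (simp add: powr_add mult.commute)
  qed
  have "ennreal (t powr pst) = ennreal (sob * A powr (s * p / N)) * (ennreal c * ennreal (w * Q / 2))"
    unfolding key using sob_pos w Q by (simp add: ennreal_mult[symmetric] c_def)
  also have "\<dots> \<le> ennreal (sob * A powr (s * p / N)) * (ennreal c * emeasure lborel G)"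
    by (intro mult_left_mono G) auto
  also have "ennreal c * emeasure lborel G = (\<integral>\<^sup>+y. ennreal c * indicator G y \<partial>lborel)"
    by (subst nn_integral_cmult) (auto intro!: borel_measurable_indicator)
  also have "ennreal (sob * A powr (s * p / N)) * \<dots> \<le> ennreal (sob * A powr (s * p / N)) *
      (\<integral>\<^sup>+y. ennreal (kernel (x, y)) * ennreal (\<bar>u x - u y\<bar> powr p) \<partial>lborel)"
  proof (intro mult_left_mono nn_integral_mono)
    fix y
    show "ennreal c * indicator G y \<le> ennreal (kernel (x, y)) * ennreal (\<bar>u x - u y\<bar> powr p)"
    proof (cases "y \<in> G")
      case True
      have uy: "\<bar>u y\<bar> \<le> t / 2" and d: "norm (x - y) < r" using True by (auto simp: G_def S_def dist_norm)
      have "u x \<noteq> u y" using uy t by (auto simp: t_def)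
      then have xy: "0 < norm (x - y)" by auto
      have "c \<le> norm (x - y) powr (- (N + s * p)) * \<bar>u x - u y\<bar> powr p"
        unfolding c_def
      proof (rule mult_mono)
        show "r powr (- (N + s * p)) \<le> norm (x - y) powr (- (N + s * p))"
          by (rule powr_mono2') (use d xy N_pos sp_pos in auto)
        have "t / 2 \<le> \<bar>u x - u y\<bar>" using uy unfolding t_def by linarith
        then show "(t / 2) powr p \<le> \<bar>u x - u y\<bar> powr p"
          by (intro powr_mono2) (use t p in auto)
      qed auto
      also have "norm (x - y) powr (- (N + s * p)) = kernel (x, y)"
        unfolding kernel_def by (simp only: powr_minus_divide fst_conv snd_conv)
      finally show ?thesis using True by (simp add: ennreal_mult[symmetric] ennreal_leI)
    qed simp
  qed simp
  finally show ?thesis by (simp add: t_def)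
qed (use pst_pos in simp)

text \<open>Integrating the pointwise bound gives \<open>A \<le> sob * A powr e * energy u\<close>
  with \<open>e = s * p / N < 1\<close>. Dividing by \<open>A powr e\<close> requires
  \<open>A\<close> to be finite, which boundedness of \<open>u\<close> and of
  \<open>\<Omega>\<close> guarantees; the exponent then comes from
  \<open>1 - e = p / pst\<close>.\<close>

lemma sobolev_bounded:
  assumes u: "u \<in> X" and B: "\<And>x. \<bar>u x\<bar> \<le> B"
  shows "(\<integral>\<^sup>+x. ennreal (\<bar>u x\<bar> powr pst) \<partial>lborel) \<le> ennreal ((sob * energy u) powr (pst / p))"
proof -
  note [measurable] = X_D(1)[OF u]
  define A where "A = enn2real (\<integral>\<^sup>+x. ennreal (\<bar>u x\<bar> powr pst) \<partial>lborel)"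
  have "(\<integral>\<^sup>+x. ennreal (\<bar>u x\<bar> powr pst) \<partial>lborel) \<le> (\<integral>\<^sup>+x. ennreal (B powr pst) * indicator \<Omega> x \<partial>lborel)"
    using B X_D(2)[OF u] pst_pos
    by (intro nn_integral_mono) (auto simp: indicator_def intro!: ennreal_leI powr_mono2)
  also have "\<dots> = ennreal (B powr pst) * emeasure lborel \<Omega>"
    by (subst nn_integral_cmult) (auto intro!: borel_measurable_indicator)
  also have "\<dots> < \<infinity>" using emeasure_\<Omega> by (simp add: ennreal_mult_less_top)
  finally have A: "(\<integral>\<^sup>+x. ennreal (\<bar>u x\<bar> powr pst) \<partial>lborel) = ennreal A"
    by (simp add: A_def)
  show ?thesis
  proof (cases "A = 0")
    case False
    then have A_pos: "0 < A" by (simp add: A_def order_less_le)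
    define e where "e = s * p / N"
    have e: "e < 1" "1 - e = p / pst" using sp N_pos pst_pos p by (auto simp: e_def pst_def field_simps)
    have [measurable]: "(\<lambda>y. kernel (x, y)) \<in> borel_measurable borel" for x
      by (simp add: kernel_def)
    have [measurable]: "(\<lambda>x. \<integral>\<^sup>+y. ennreal (kernel (x, y)) * ennreal (\<bar>u x - u y\<bar> powr p) \<partial>lborel) \<in> borel_measurable borel"
    proof -
      have "(\<lambda>z. ennreal (kernel z) * ennreal (\<bar>gap u z\<bar> powr p)) \<in> borel_measurable (lborel \<Otimes>\<^sub>M lborel)"
        by (simp add: lborel_prod)
      from lborel.borel_measurable_nn_integral_fst[OF this] show ?thesis by simp
    qed
    have "ennreal A = (\<integral>\<^sup>+x. ennreal (\<bar>u x\<bar> powr pst) \<partial>lborel)" by (simp add: A)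
    also have "\<dots> \<le> (\<integral>\<^sup>+x. ennreal (sob * A powr e) * (\<integral>\<^sup>+y. ennreal (kernel (x, y)) * ennreal (\<bar>u x - u y\<bar> powr p) \<partial>lborel) \<partial>lborel)"
      unfolding e_def by (intro nn_integral_mono sobolev_pointwise) (auto simp: A A_pos)
    also have "\<dots> = ennreal (sob * A powr e) * (\<integral>\<^sup>+x. \<integral>\<^sup>+y. ennreal (kernel (x, y)) * ennreal (\<bar>u x - u y\<bar> powr p) \<partial>lborel \<partial>lborel)"
      by (rule nn_integral_cmult) simp
    also have "(\<integral>\<^sup>+x. \<integral>\<^sup>+y. ennreal (kernel (x, y)) * ennreal (\<bar>u x - u y\<bar> powr p) \<partial>lborel \<partial>lborel) = (\<integral>\<^sup>+z. ennreal (\<bar>gap u z\<bar> powr p) \<partial>M)"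
      by (subst nn_integral_M(1)) auto
    also have "\<dots> = ennreal (energy u)" by (rule nn_energy[OF u])
    finally have "ennreal A \<le> ennreal (sob * A powr e * energy u)"
      using sob_pos by (simp add: ennreal_mult[symmetric])
    then have "A \<le> sob * A powr e * energy u"
      using sob_pos by (simp add: ennreal_le_iff)
    then have "A * A powr (- e) \<le> sob * A powr e * energy u * A powr (- e)"
      by (rule mult_right_mono) simp
    also have "sob * A powr e * energy u * A powr (- e) = sob * energy u * (A powr e * A powr (- e))" by simp
    also have "A powr e * A powr (- e) = 1" using A_pos by (simp add: powr_add[symmetric])
    also have "A * A powr (- e) = A powr (p / pst)"
      using A_pos powr_mult_base[of A "- e"] e by simp
    finally have "(A powr (p / pst)) powr (pst / p) \<le> (sob * energy u) powr (pst / p)"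
      using p pst_pos by (intro powr_mono2) auto
    moreover have "(A powr (p / pst)) powr (pst / p) = A"
      using A_pos p pst_pos by (simp add: powr_powr)
    ultimately show ?thesis unfolding A by (simp add: ennreal_leI)
  qed (simp add: A)
qed

text \<open>Truncation at height \<open>n\<close> does not increase the energy, and Fatou's lemma
  removes it.\<close>

theorem sobolev:
  assumes u: "u \<in> X"
  shows "integrable lborel (\<lambda>x. \<bar>u x\<bar> powr pst)"
    and "(\<integral>x. \<bar>u x\<bar> powr pst \<partial>lborel) \<le> (sob * energy u) powr (pst / p)"
proof -
  note [measurable] = X_D(1)[OF u]
  define T where "T n r = max (- real n) (min (real n) r)" for n r
  let ?C = "(sob * energy u) powr (pst / p)"
  have Tm [measurable]: "T n \<in> borel_measurable borel" for n unfolding T_def[abs_def] by measurable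
  have lip: "\<bar>T n (u x) - T n (u y)\<bar> \<le> 1 * \<bar>u x - u y\<bar>" for n x y by (auto simp: T_def)
  have TX: "(\<lambda>x. T n (u x)) \<in> X" and TE: "energy (\<lambda>x. T n (u x)) \<le> 1 powr p * energy u" for n
    by (rule X_lipschitz_comp[OF u Tm _ lip]; simp add: T_def)+
  have bd: "(\<integral>\<^sup>+x. ennreal (\<bar>T n (u x)\<bar> powr pst) \<partial>lborel) \<le> ennreal ?C" for n
  proof -
    have "(\<integral>\<^sup>+x. ennreal (\<bar>T n (u x)\<bar> powr pst) \<partial>lborel) \<le> ennreal ((sob * energy (\<lambda>x. T n (u x))) powr (pst / p))"
      by (rule sobolev_bounded[OF TX, of _ "real n"]) (auto simp: T_def)
    also have "\<dots> \<le> ennreal ?C"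
      using TE[of n] sob_pos p pst_pos by (intro ennreal_leI powr_mono2 mult_left_mono) auto
    finally show ?thesis .
  qed
  have int: "integrable lborel (\<lambda>x. \<bar>T n (u x)\<bar> powr pst)" for n
    using bd[of n] by (intro integrableI_nonneg) (auto simp: le_less_trans)
  have le: "(\<integral>x. \<bar>T n (u x)\<bar> powr pst \<partial>lborel) \<le> ?C" for n
    using bd[of n] by (simp add: nn_integral_eq_integral[OF int] ennreal_le_iff)
  have lim: "(\<lambda>n. \<bar>T n (u x)\<bar> powr pst) \<longlonglongrightarrow> \<bar>u x\<bar> powr pst" for x
  proof (rule tendsto_eventually)
    obtain n0 where "\<bar>u x\<bar> \<le> real n0" using real_arch_simple by blast
    then have "T n (u x) = u x" if "n0 \<le> n" for n using that by (auto simp: T_def)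
    then show "\<forall>\<^sub>F n in sequentially. \<bar>T n (u x)\<bar> powr pst = \<bar>u x\<bar> powr pst"
      unfolding eventually_sequentially by metis
  qed
  show "integrable lborel (\<lambda>x. \<bar>u x\<bar> powr pst)" "(\<integral>x. \<bar>u x\<bar> powr pst \<partial>lborel) \<le> ?C"
    by (rule integrable_AE_limit[where f = "\<lambda>n x. \<bar>T n (u x)\<bar> powr pst", OF _ _ _ int le];
        use lim in simp)+
qed

text \<open>Splitting at a height \<open>\<tau>\<close> bounds \<open>\<bar>u\<bar> powr q\<close>
  by \<open>\<tau> powr q\<close> on \<open>\<Omega>\<close> plus
  \<open>\<tau> powr (q - pst) * \<bar>u\<bar> powr pst\<close>, which also works for
  \<open>q < 1\<close>. The height \<open>(sob * energy u) powr (1 / p)\<close> balances the two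
  terms.\<close>

lemma lower_norm_bound:
  assumes q: "0 < q" "q \<le> pst"
  obtains C where "0 < C" "\<And>u. u \<in> X \<Longrightarrow> integrable lborel (\<lambda>x. \<bar>u x\<bar> powr q)"
    "\<And>u. u \<in> X \<Longrightarrow> (\<integral>x. \<bar>u x\<bar> powr q \<partial>lborel) \<le> C * energy u powr (q / p)"
proof -
  define m where "m = measure lborel \<Omega>"
  define C where "C = sob powr (q / p) * (m + 1)"
  have "0 \<le> m" by (simp add: m_def)
  then have C: "0 < C" using sob_pos by (simp add: C_def)
  have "integrable lborel (\<lambda>x. \<bar>u x\<bar> powr q) \<and> (\<integral>x. \<bar>u x\<bar> powr q \<partial>lborel) \<le> C * energy u powr (q / p)"
    if u: "u \<in> X" for u
  proof -
    note [measurable] = X_D(1)[OF u]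
    have bound: "\<bar>u x\<bar> powr q \<le> \<tau> powr q * indicator \<Omega> x + \<tau> powr (q - pst) * \<bar>u x\<bar> powr pst" if \<tau>: "0 < \<tau>" for x \<tau>
    proof (cases "x \<in> \<Omega>")
      case True
      show ?thesis
      proof (cases "\<bar>u x\<bar> \<le> \<tau>")
        case True
        have "\<bar>u x\<bar> powr q \<le> \<tau> powr q" using True q by (intro powr_mono2) auto
        then show ?thesis using \<open>x \<in> \<Omega>\<close> by simp (smt (verit) mult_nonneg_nonneg powr_ge_zero)
      next
        case False
        have "\<bar>u x\<bar> powr q = \<bar>u x\<bar> powr (q - pst) * \<bar>u x\<bar> powr pst"
          using False \<tau> by (simp add: powr_add[symmetric])
        also have "\<dots> \<le> \<tau> powr (q - pst) * \<bar>u x\<bar> powr pst"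
          using False \<tau> q by (intro mult_right_mono powr_mono2') auto
        finally show ?thesis using \<open>x \<in> \<Omega>\<close> by simp (smt (verit) powr_ge_zero)
      qed
    qed (use X_D(2)[OF u] q in simp)
    have g: "integrable lborel (\<lambda>x. \<tau> powr q * indicator \<Omega> x + \<tau> powr (q - pst) * \<bar>u x\<bar> powr pst)" for \<tau>
      using sobolev(1)[OF u] emeasure_\<Omega> by (intro Bochner_Integration.integrable_add integrable_mult_right) auto
    have int: "integrable lborel (\<lambda>x. \<bar>u x\<bar> powr q)"
      by (rule Bochner_Integration.integrable_bound[OF g[of 1]]) (use bound[of 1] in auto)
    have le: "(\<integral>x. \<bar>u x\<bar> powr q \<partial>lborel) \<le> \<tau> powr q * m + \<tau> powr (q - pst) * (\<integral>x. \<bar>u x\<bar> powr pst \<partial>lborel)" if \<tau>: "0 < \<tau>" for \<tau>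
    proof -
      have "(\<integral>x. \<bar>u x\<bar> powr q \<partial>lborel) \<le> (\<integral>x. \<tau> powr q * indicator \<Omega> x + \<tau> powr (q - pst) * \<bar>u x\<bar> powr pst \<partial>lborel)"
        by (rule integral_mono[OF int g]) (rule bound[OF \<tau>])
      also have "\<dots> = \<tau> powr q * m + \<tau> powr (q - pst) * (\<integral>x. \<bar>u x\<bar> powr pst \<partial>lborel)"
        using sobolev(1)[OF u] emeasure_\<Omega>
        by (subst Bochner_Integration.integral_add) (auto simp: m_def)
      finally show ?thesis .
    qed
    have "(\<integral>x. \<bar>u x\<bar> powr q \<partial>lborel) \<le> C * energy u powr (q / p)"
    proof (cases "energy u = 0")
      case True
      then have "(\<integral>x. \<bar>u x\<bar> powr pst \<partial>lborel) \<le> 0" using sobolev(2)[OF u] by simp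
      then have "(\<integral>x. \<bar>u x\<bar> powr pst \<partial>lborel) = 0" by (intro antisym) auto
      then have "AE x in lborel. \<bar>u x\<bar> powr pst = 0"
        using sobolev(1)[OF u] by (subst (asm) integral_nonneg_eq_0_iff_AE) auto
      then have "AE x in lborel. \<bar>u x\<bar> powr q = 0" by eventually_elim auto
      then have "(\<integral>x. \<bar>u x\<bar> powr q \<partial>lborel) = 0" by (rule integral_eq_zero_AE)
      then show ?thesis using C by simp
    next
      case False
      then have E: "0 < sob * energy u" using sob_pos by (simp add: order_less_le)
      define \<tau> where "\<tau> = (sob * energy u) powr (1 / p)"
      have \<tau>: "0 < \<tau>" using E by (auto simp: \<tau>_def)
      have "(\<integral>x. \<bar>u x\<bar> powr pst \<partial>lborel) \<le> \<tau> powr pst"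
        using sobolev(2)[OF u] by (simp add: \<tau>_def powr_powr)
      then have "\<tau> powr (q - pst) * (\<integral>x. \<bar>u x\<bar> powr pst \<partial>lborel) \<le> \<tau> powr (q - pst) * \<tau> powr pst"
        by (intro mult_left_mono) auto
      also have "\<dots> = \<tau> powr q" by (simp add: powr_add[symmetric])
      finally have "(\<integral>x. \<bar>u x\<bar> powr q \<partial>lborel) \<le> \<tau> powr q * (m + 1)"
        using le[OF \<tau>] by (simp add: algebra_simps)
      also have "\<tau> powr q = sob powr (q / p) * energy u powr (q / p)"
        using sob_pos by (simp add: \<tau>_def powr_powr powr_mult)
      finally show ?thesis by (simp add: C_def algebra_simps)
    qed
    with int show ?thesis by simp
  qed
  then show ?thesis using that[OF C] by blast
qed

lemma energy_zero_imp_AE_zero: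
  assumes u: "u \<in> X" and "energy u \<le> 0"
  shows "AE x in lborel. u x = 0"
proof -
  have "energy u = 0" using assms(2) energy_nonneg[of u] by linarith
  then have "(\<integral>x. \<bar>u x\<bar> powr pst \<partial>lborel) \<le> 0" using sobolev(2)[OF u] by simp
  then have "(\<integral>x. \<bar>u x\<bar> powr pst \<partial>lborel) = 0" by (intro antisym) auto
  then have "AE x in lborel. \<bar>u x\<bar> powr pst = 0"
    using sobolev(1)[OF u] by (subst (asm) integral_nonneg_eq_0_iff_AE) auto
  then show ?thesis by eventually_elim simp
qed

end

subsection \<open>Bounded right-hand sides: existence and comparison\<close>

text \<open>Beyond the threshold \<open>R\<close>, where
  \<open>c * R powr (\<theta> - 1) = e\<close>, the sublinear term is below the linear one; up to
  \<open>R\<close> it is at most \<open>c * R powr \<theta>\<close>. This absorbs a lower power of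
  the energy into the energy.\<close>

lemma sublinear_absorb:
  fixes c \<theta> e :: real
  assumes c: "0 \<le> c" and \<theta>: "0 \<le> \<theta>" "\<theta> < 1" and e: "0 < e"
  shows "\<exists>C\<ge>0. \<forall>E\<ge>0. c * E powr \<theta> \<le> e * E + C"
proof (cases "c = 0")
  case True
  then show ?thesis using e by (intro exI[of _ 0]) auto
next
  case False
  define R where "R = (c / e) powr (1 / (1 - \<theta>))"
  have R: "0 < R" using False e by (simp add: R_def)
  have Rp: "R powr (\<theta> - 1) = e / c"
  proof -
    have "1 / (1 - \<theta>) * (\<theta> - 1) = -1" using \<theta> by (simp add: field_simps)
    then have "R powr (\<theta> - 1) = (c / e) powr (- 1)" by (simp add: R_def powr_powr)
    also have "\<dots> = e / c" using c e False by (simp add: powr_minus)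
    finally show ?thesis .
  qed
  have "c * E powr \<theta> \<le> e * E + c * R powr \<theta>" if E: "0 \<le> E" for E
  proof (cases "R \<le> E")
    case True
    have "E powr \<theta> = E * E powr (\<theta> - 1)" using powr_mult_base[of E "\<theta> - 1"] E by simp
    also have "\<dots> \<le> E * R powr (\<theta> - 1)" using True R \<theta> E by (intro mult_left_mono powr_mono2') auto
    finally have "c * E powr \<theta> \<le> c * (E * (e / c))" using c by (intro mult_left_mono) (auto simp: Rp)
    also have "\<dots> = e * E" using False by simp
    finally show ?thesis using c by (simp add: add_increasing2)
  next
    case False
    then have "c * E powr \<theta> \<le> c * R powr \<theta>" using c \<theta> E by (intro mult_left_mono powr_mono2) auto
    then show ?thesis using e E by (simp add: add_increasing)
  qed
  then show ?thesis using c by (intro exI[of _ "c * R powr \<theta>"]) auto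
qed

text \<open>The inequality is concavity of a primitive in tangent form, from the mean value theorem
  and the monotonicity of \<open>h\<close>. The normalisation at 0 makes
  \<open>F x * H (u x)\<close> vanish wherever \<open>u\<close> does, in particular outside
  \<open>\<Omega>\<close>.\<close>

lemma concave_antiderivative:
  fixes h :: "real \<Rightarrow> real"
  assumes cont: "continuous_on UNIV h" and anti: "antimono h"
  obtains H where "H 0 = 0" "\<And>a b. h b * (b - a) \<le> H b - H a"
proof -
  obtain G where G: "\<And>x. (G has_vector_derivative h x) (at x)"
    using einterval_antiderivative[of "-\<infinity>" "\<infinity>" h] cont
    by (auto simp: continuous_on_eq_continuous_at)
  have D: "(G has_real_derivative h x) (at x)" for x
    using G[of x] by (simp add: has_real_derivative_iff_has_vector_derivative)
  have *: "h b * (b - a) \<le> G b - G a" for a b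
  proof (cases a b rule: linorder_cases)
    case less
    have "\<exists>z>a. z < b \<and> G b - G a = (b - a) * h z" by (rule MVT2[OF less D])
    then obtain z where z: "a < z" "z < b" "G b - G a = (b - a) * h z" by auto
    have "h b \<le> h z" using z(2) by (intro antimonoD[OF anti]) simp
    then show ?thesis using z less by (simp add: mult.commute)
  next
    case greater
    have "\<exists>z>b. z < a \<and> G a - G b = (a - b) * h z" by (rule MVT2[OF greater D])
    then obtain z where z: "b < z" "z < a" "G a - G b = (a - b) * h z" by auto
    have "h z \<le> h b" using z(1) by (intro antimonoD[OF anti]) simp
    then have "(a - b) * h z \<le> (a - b) * h b" using greater by simp
    then show ?thesis using z by (simp add: algebra_simps)
  qed simp
  show ?thesis
    by (rule that[of "\<lambda>x. G x - G 0"]) (use * in auto)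
qed

context frac_space
begin

text \<open>The gap of \<open>\<phi> = max 0 (u - v)\<close> is zero or has the sign of
  \<open>gap u - gap v\<close>, so by monotonicity of the flux the integrand \<open>k\<close> is
  nonnegative. The hypothesis makes its integral nonpositive, hence \<open>k = 0\<close> almost
  everywhere, and strict monotonicity then forces \<open>\<phi>\<close> to have energy 0.\<close>

lemma comparison:
  assumes u: "u \<in> X" and v: "v \<in> X"
    and le: "form u (\<lambda>x. max 0 (u x - v x)) \<le> form v (\<lambda>x. max 0 (u x - v x))"
  shows "AE x in lborel. u x \<le> v x"
proof -
  define \<phi> where "\<phi> = (\<lambda>x. max 0 (u x - v x))"
  have \<phi>: "\<phi> \<in> X" unfolding \<phi>_def using X_pos_part[OF X_diff[OF u v]] by simp
  note [measurable] = X_D(1)[OF u] X_D(1)[OF v] X_D(1)[OF \<phi>]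
  define k where "k z = pflux p (gap u z) * gap \<phi> z - pflux p (gap v z) * gap \<phi> z" for z
  have int: "integrable M k" unfolding k_def
    by (intro Bochner_Integration.integrable_diff form_integrable u v \<phi>)
  have "(\<integral>z. k z \<partial>M) = form u \<phi> - form v \<phi>"
    unfolding k_def form_def
    by (intro Bochner_Integration.integral_diff form_integrable u v \<phi>)
  then have int_le: "(\<integral>z. k z \<partial>M) \<le> 0" using le by (simp add: \<phi>_def)
  have k: "0 \<le> k z \<and> (k z = 0 \<longrightarrow> gap \<phi> z = 0)" for z
  proof (cases "gap v z" "gap u z" rule: linorder_cases)
    case less
    then have "pflux p (gap v z) < pflux p (gap u z)" by (rule pflux_strict_mono[OF p])
    moreover have "0 \<le> gap \<phi> z" using less by (auto simp: \<phi>_def max_def)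
    ultimately show ?thesis by (auto simp: k_def left_diff_distrib[symmetric])
  next
    case equal
    then show ?thesis by (auto simp: k_def \<phi>_def max_def)
  next
    case greater
    then have "pflux p (gap u z) < pflux p (gap v z)" by (rule pflux_strict_mono[OF p])
    moreover have "gap \<phi> z \<le> 0" using greater by (auto simp: \<phi>_def max_def)
    ultimately show ?thesis
      by (auto simp: k_def left_diff_distrib[symmetric] intro!: mult_nonpos_nonpos)
  qed
  have "(\<integral>z. k z \<partial>M) = 0" using int_le k by (intro antisym integral_nonneg_AE) auto
  then have "AE z in M. k z = 0"
    using k int by (subst (asm) integral_nonneg_eq_0_iff_AE) auto
  then have "AE z in M. \<bar>gap \<phi> z\<bar> powr p = 0"
  proof eventually_elim
    case (elim z)
    then show ?case using k[of z] by simp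
  qed
  then have "energy \<phi> = 0" unfolding energy_def by (rule integral_eq_zero_AE)
  then have "AE x in lborel. \<phi> x = 0" by (intro energy_zero_imp_AE_zero \<phi>) simp
  then show ?thesis by eventually_elim (auto simp: \<phi>_def max_def split: if_splits)
qed

lemma X_L1:
  obtains C where "0 < C" "\<And>u. u \<in> X \<Longrightarrow> integrable lborel u"
    "\<And>u. u \<in> X \<Longrightarrow> (\<integral>x. \<bar>u x\<bar> \<partial>lborel) \<le> C * energy u powr (1 / p)"
proof -
  obtain C where C: "0 < C" "\<And>u. u \<in> X \<Longrightarrow> integrable lborel (\<lambda>x. \<bar>u x\<bar> powr 1)"
    "\<And>u. u \<in> X \<Longrightarrow> (\<integral>x. \<bar>u x\<bar> powr 1 \<partial>lborel) \<le> C * energy u powr (1 / p)"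
    using lower_norm_bound[of 1] pst_gt p by auto
  have "integrable lborel u" if "u \<in> X" for u
    using C(2)[OF that] X_D(1)[OF that] by (simp add: integrable_abs_iff)
  then show ?thesis using that[OF C(1)] C(3) by auto
qed

end

text \<open>Nonnegative \<open>F\<close> and antitone \<open>h\<close> make the functional
  \<open>J\<close> below convex; the bounds \<open>B\<close> and \<open>K\<close> make its second
  term Lipschitz in the L1 norm.\<close>

locale bounded_rhs = frac_space p s N \<Omega>
  for p s N :: real and \<Omega> :: "'a::euclidean_space set" +
  fixes F :: "'a \<Rightarrow> real" and h :: "real \<Rightarrow> real" and B K :: real
  assumes F_meas [measurable]: "F \<in> borel_measurable borel"
    and F: "\<And>x. 0 \<le> F x" "\<And>x. F x \<le> B"
    and h_cont: "continuous_on UNIV h" and h_anti: "antimono h"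
    and h: "\<And>t. 0 \<le> h t" "\<And>t. h t \<le> K"
begin

lemma h_meas [measurable]: "h \<in> borel_measurable borel"
  using h_cont by (rule borel_measurable_continuous_onI)

lemma BK: "0 \<le> B" "0 \<le> K"
  using F[of undefined] h[of 0] by linarith+

lemma rhs_integrable:
  assumes [measurable]: "u \<in> borel_measurable borel" and \<phi>: "\<phi> \<in> X"
  shows "integrable lborel (\<lambda>x. F x * h (u x) * \<phi> x)"
proof (rule Bochner_Integration.integrable_bound)
  obtain C where "integrable lborel \<phi>" using X_L1 \<phi> by metis
  then show "integrable lborel (\<lambda>x. B * K * \<phi> x)" by simp
  show "(\<lambda>x. F x * h (u x) * \<phi> x) \<in> borel_measurable lborel"
    using X_D(1)[OF \<phi>] by simp
  show "AE x in lborel. norm (F x * h (u x) * \<phi> x) \<le> norm (B * K * \<phi> x)"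
    using F h BK by (simp add: abs_mult mult_mono mult_right_mono)
qed

context
  fixes H :: "real \<Rightarrow> real"
  assumes H0: "H 0 = 0" and H: "\<And>a b. h b * (b - a) \<le> H b - H a"
begin

lemma H_lipschitz: "\<bar>H b - H a\<bar> \<le> K * \<bar>b - a\<bar>"
proof -
  have K: "\<bar>h t * r\<bar> \<le> K * \<bar>r\<bar>" for t r using h by (simp add: abs_mult mult_right_mono)
  have "H b - H a \<le> h a * (b - a)" using H[of a b] by (simp add: algebra_simps)
  then show ?thesis using H[of b a] K[of b "b - a"] K[of a "b - a"] by linarith
qed

lemma H_meas [measurable]: "H \<in> borel_measurable borel"
proof (rule borel_measurable_continuous_onI)
  have "K-lipschitz_on UNIV H"
    using H_lipschitz BK by (intro lipschitz_onI) (auto simp: dist_real_def)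
  then show "continuous_on UNIV H" by (rule lipschitz_on_continuous_on)
qed

lemma H_midpoint: "(H a + H b) / 2 \<le> H ((a + b) / 2)"
  using H[of "(a + b) / 2" a] H[of "(a + b) / 2" b] by (simp add: field_simps)

lemma FH_integrable:
  assumes u: "u \<in> X"
  shows "integrable lborel (\<lambda>x. F x * H (u x))"
proof (rule Bochner_Integration.integrable_bound)
  obtain C where "integrable lborel u" using X_L1 u by metis
  then show "integrable lborel (\<lambda>x. B * K * u x)" by simp
  show "(\<lambda>x. F x * H (u x)) \<in> borel_measurable lborel"
    using X_D(1)[OF u] by simp
  have "\<bar>H t\<bar> \<le> K * \<bar>t\<bar>" for t using H_lipschitz[of t 0] H0 by simp
  then show "AE x in lborel. norm (F x * H (u x)) \<le> norm (B * K * u x)"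
    using F BK by (auto simp: abs_mult mult.assoc intro!: mult_mono)
qed

lemma FH_diff:
  assumes u: "u \<in> X" and v: "v \<in> X"
  shows "\<bar>(\<integral>x. F x * H (u x) \<partial>lborel) - (\<integral>x. F x * H (v x) \<partial>lborel)\<bar>
      \<le> B * K * (\<integral>x. \<bar>u x - v x\<bar> \<partial>lborel)"
proof -
  obtain C where i: "integrable lborel u" "integrable lborel v" using X_L1 u v by metis
  have "\<bar>(\<integral>x. F x * H (u x) \<partial>lborel) - (\<integral>x. F x * H (v x) \<partial>lborel)\<bar>
     = \<bar>\<integral>x. F x * H (u x) - F x * H (v x) \<partial>lborel\<bar>"
    using FH_integrable u v by simp
  also have "\<dots> \<le> (\<integral>x. \<bar>F x * H (u x) - F x * H (v x)\<bar> \<partial>lborel)"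
    by (rule integral_abs_bound)
  also have "\<dots> \<le> (\<integral>x. B * K * \<bar>u x - v x\<bar> \<partial>lborel)"
  proof (rule integral_mono)
    show "integrable lborel (\<lambda>x. \<bar>F x * H (u x) - F x * H (v x)\<bar>)"
      using FH_integrable u v by (intro integrable_abs Bochner_Integration.integrable_diff)
    show "integrable lborel (\<lambda>x. B * K * \<bar>u x - v x\<bar>)" using i by simp
    fix x
    have "\<bar>F x * H (u x) - F x * H (v x)\<bar> = F x * \<bar>H (u x) - H (v x)\<bar>"
      using F by (simp add: right_diff_distrib[symmetric] abs_mult)
    also have "\<dots> \<le> B * (K * \<bar>u x - v x\<bar>)"
      using F BK H_lipschitz by (intro mult_mono) auto
    finally show "\<bar>F x * H (u x) - F x * H (v x)\<bar> \<le> B * K * \<bar>u x - v x\<bar>" by simp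
  qed
  finally show ?thesis using i by simp
qed

section \<open>Minimisation of the energy functional\<close>

definition J :: "('a \<Rightarrow> real) \<Rightarrow> real" where
  "J u = energy u / p - (\<integral>x. F x * H (u x) \<partial>lborel)"

text \<open>The linear growth of \<open>H\<close> produces a term of order
  \<open>energy u powr (1 / p)\<close>, which is sublinear because \<open>p > 1\<close> and is
  absorbed by half of \<open>energy u / p\<close>.\<close>

lemma J_coercive:
  obtains C where "\<And>u. u \<in> X \<Longrightarrow> energy u \<le> 2 * p * (J u + C)"
proof -
  obtain C1 where C1: "0 < C1" "\<And>u. u \<in> X \<Longrightarrow> (\<integral>x. \<bar>u x\<bar> \<partial>lborel) \<le> C1 * energy u powr (1 / p)"
    using X_L1 by metis
  obtain C where C: "\<And>E. 0 \<le> E \<Longrightarrow> B * K * C1 * E powr (1 / p) \<le> 1 / (2 * p) * E + C"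
    using sublinear_absorb[of "B * K * C1" "1 / p" "1 / (2 * p)"] BK C1(1) p by auto
  have "energy u \<le> 2 * p * (J u + C)" if u: "u \<in> X" for u
  proof -
    have "(\<integral>x. F x * H (u x) \<partial>lborel) \<le> B * K * (\<integral>x. \<bar>u x\<bar> \<partial>lborel)"
      using FH_diff[OF u X_zero] H0 by simp
    also have "\<dots> \<le> B * K * (C1 * energy u powr (1 / p))"
      using C1(2)[OF u] BK by (intro mult_left_mono) auto
    also have "\<dots> \<le> 1 / (2 * p) * energy u + C" using C[of "energy u"] by (simp add: mult.assoc)
    finally have "energy u / p - (1 / (2 * p) * energy u + C) \<le> J u" by (simp add: J_def)
    then show ?thesis using p by (simp add: field_simps)
  qed
  then show ?thesis using that by blast
qed

lemma J_minimizer: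
  obtains u where "u \<in> X" "\<And>v. v \<in> X \<Longrightarrow> J u \<le> J v"
proof -
  obtain C where C: "\<And>u. u \<in> X \<Longrightarrow> energy u \<le> 2 * p * (J u + C)" using J_coercive by blast
  define I where "I = Inf (J ` X)"
  have lowerC: "- C \<le> J u" if "u \<in> X" for u
  proof -
    have "0 \<le> 2 * p * (J u + C)" using C[OF that] energy_nonneg[of u] by linarith
    then show ?thesis using p by (simp add: zero_le_mult_iff)
  qed
  have bdd: "bdd_below (J ` X)" using lowerC by (auto intro!: bdd_belowI[of _ "- C"])
  have I: "I \<le> J u" if "u \<in> X" for u unfolding I_def using bdd that by (intro cInf_lower) auto
  have "\<exists>u\<in>X. J u < I + 1 / real (Suc n)" for n
  proof -
    have "Inf (J ` X) < I + 1 / real (Suc n)" by (simp add: I_def)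
    then show ?thesis using cInf_lessD[of "J ` X"] X_zero by blast
  qed
  then obtain v where v: "\<And>n. v n \<in> X" "\<And>n. J (v n) < I + 1 / real (Suc n)" by metis
  define E0 where "E0 = 2 * p * (I + 1 + C)"
  have E0: "energy (v n) \<le> E0" for n
  proof -
    have "J (v n) \<le> I + 1" using v(2)[of n] by (simp add: divide_le_eq less_eq_real_def) (smt (verit) divide_le_eq_1 of_nat_0_le_iff)
    then have "2 * p * (J (v n) + C) \<le> E0" using p by (simp add: E0_def)
    then show ?thesis using C[OF v(1)[of n]] by linarith
  qed
  have E0_nn: "0 \<le> E0" using E0[of 0] energy_nonneg[of "v 0"] by linarith
  note [measurable] = X_D(1)[OF v(1)]
  \<comment> \<open>Concavity of \<open>H\<close> bounds the convexity defect of the energy by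
    \<open>p\<close> times the midpoint defect of \<open>J\<close>. The latter is at most
    \<open>1 / Suc n\<close>, since both end points are within that distance of the infimum and the
    midpoint is not below it.\<close>
  have mid: "(energy (v i) + energy (v j)) / 2 - energy (\<lambda>x. (v i x + v j x) / 2) \<le> p / real (Suc n)"
    if ij: "n \<le> i" "n \<le> j" for i j n
  proof -
    let ?m = "\<lambda>x. (v i x + v j x) / 2"
    have m: "?m \<in> X" by (rule X_midpoint[OF v(1) v(1)])
    have "((\<integral>x. F x * H (v i x) \<partial>lborel) + (\<integral>x. F x * H (v j x) \<partial>lborel)) / 2
       = (\<integral>x. (F x * H (v i x) + F x * H (v j x)) / 2 \<partial>lborel)"
      using FH_integrable v(1) by simp
    also have "\<dots> \<le> (\<integral>x. F x * H (?m x) \<partial>lborel)"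
    proof (rule integral_mono)
      show "integrable lborel (\<lambda>x. (F x * H (v i x) + F x * H (v j x)) / 2)"
        using FH_integrable v(1) by simp
      show "integrable lborel (\<lambda>x. F x * H (?m x))" by (rule FH_integrable[OF m])
      fix x
      have "F x * ((H (v i x) + H (v j x)) / 2) \<le> F x * H (?m x)"
        using F by (intro mult_left_mono H_midpoint) auto
      then show "(F x * H (v i x) + F x * H (v j x)) / 2 \<le> F x * H (?m x)"
        by (simp add: algebra_simps)
    qed
    finally have FH: "((\<integral>x. F x * H (v i x) \<partial>lborel) + (\<integral>x. F x * H (v j x) \<partial>lborel)) / 2
       \<le> (\<integral>x. F x * H (?m x) \<partial>lborel)" .
    have "((energy (v i) + energy (v j)) / 2 - energy ?m) / p
        = (energy (v i) / p + energy (v j) / p) / 2 - energy ?m / p"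
      by (simp add: diff_divide_distrib add_divide_distrib)
    moreover have "e \<le> (a - S + (b - T)) / 2 - (c - U)"
      if "e = (a + b) / 2 - c" "(S + T) / 2 \<le> U" for e a b c S T U :: real
      using that by (simp add: field_simps)
    ultimately have "((energy (v i) + energy (v j)) / 2 - energy ?m) / p \<le> (J (v i) + J (v j)) / 2 - J ?m"
      unfolding J_def using FH by blast
    also have "\<dots> \<le> 1 / real (Suc n)"
    proof -
      have "1 / real (Suc i) \<le> 1 / real (Suc n)" "1 / real (Suc j) \<le> 1 / real (Suc n)"
        using ij by (auto intro!: divide_left_mono)
      moreover have "(a + b) / 2 - c \<le> d"
        if "a < I + e1" "b < I + e2" "I \<le> c" "e1 \<le> d" "e2 \<le> d" for a b c d e1 e2 :: real
        using that by (simp add: field_simps)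
      ultimately show ?thesis using v(2)[of i] v(2)[of j] I[OF m] by blast
    qed
    finally show ?thesis using p by (simp add: field_simps)
  qed
  have cauchy_E: "\<exists>n. \<forall>i\<ge>n. \<forall>j\<ge>n. energy (\<lambda>x. v i x - v j x) \<le> \<eta>" if \<eta>: "0 < \<eta>" for \<eta>
  proof -
    \<comment> \<open>Makes \<open>\<epsilon> * (2 * E0) \<le> \<eta> / 2\<close>; the summand 1
      covers \<open>E0 = 0\<close>.\<close>
    define \<epsilon> where "\<epsilon> = \<eta> / (4 * E0 + 1)"
    have \<epsilon>: "0 < \<epsilon>" using \<eta> E0_nn by (simp add: \<epsilon>_def)
    obtain D where D: "0 \<le> D" "\<And>a b. \<bar>a - b\<bar> powr p \<le> \<epsilon> * (\<bar>a\<bar> powr p + \<bar>b\<bar> powr p)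
        + D * ((\<bar>a\<bar> powr p + \<bar>b\<bar> powr p) / 2 - \<bar>(a + b) / 2\<bar> powr p)"
      using powr_uniform_convexity[OF p \<epsilon>] by blast
    obtain n where n: "D * p / (\<eta> / 2) < real n" using reals_Archimedean2 by blast
    have "energy (\<lambda>x. v i x - v j x) \<le> \<eta>" if ij: "n \<le> i" "n \<le> j" for i j
    proof -
      let ?m = "\<lambda>x. (v i x + v j x) / 2"
      have m: "?m \<in> X" by (rule X_midpoint[OF v(1) v(1)])
      note ints = X_D(3)[OF v(1)[of i]] X_D(3)[OF v(1)[of j]] X_D(3)[OF m]
      have "energy (\<lambda>x. v i x - v j x) \<le> (\<integral>z. \<epsilon> * (\<bar>gap (v i) z\<bar> powr p + \<bar>gap (v j) z\<bar> powr p)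
         + D * ((\<bar>gap (v i) z\<bar> powr p + \<bar>gap (v j) z\<bar> powr p) / 2 - \<bar>gap ?m z\<bar> powr p) \<partial>M)"
        unfolding energy_def
      proof (rule integral_mono)
        show "integrable M (\<lambda>z. \<bar>gap (\<lambda>x. v i x - v j x) z\<bar> powr p)"
          by (rule X_D(3)[OF X_diff[OF v(1) v(1)]])
        show "integrable M (\<lambda>z. \<epsilon> * (\<bar>gap (v i) z\<bar> powr p + \<bar>gap (v j) z\<bar> powr p)
         + D * ((\<bar>gap (v i) z\<bar> powr p + \<bar>gap (v j) z\<bar> powr p) / 2 - \<bar>gap ?m z\<bar> powr p))"
          by (intro Bochner_Integration.integrable_add integrable_mult_right
              Bochner_Integration.integrable_diff integrable_divide ints)
        fix z
        have e1: "gap (\<lambda>x. v i x - v j x) z = gap (v i) z - gap (v j) z" by simp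
        have e2: "gap ?m z = (gap (v i) z + gap (v j) z) / 2" by (simp add: field_simps)
        show "\<bar>gap (\<lambda>x. v i x - v j x) z\<bar> powr p \<le> \<epsilon> * (\<bar>gap (v i) z\<bar> powr p + \<bar>gap (v j) z\<bar> powr p)
         + D * ((\<bar>gap (v i) z\<bar> powr p + \<bar>gap (v j) z\<bar> powr p) / 2 - \<bar>gap ?m z\<bar> powr p)"
          unfolding e1 e2 by (rule D(2))
      qed
      also have "\<dots> = \<epsilon> * (energy (v i) + energy (v j)) + D * ((energy (v i) + energy (v j)) / 2 - energy ?m)"
        using ints by (simp add: energy_def)
      also have "\<dots> \<le> \<epsilon> * (2 * E0) + D * (p / real (Suc n))"
        using E0[of i] E0[of j] \<epsilon> D(1) mid[OF ij] by (intro add_mono mult_left_mono) auto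
      also have "\<dots> \<le> \<eta> / 2 + \<eta> / 2"
      proof (rule add_mono)
        show "\<epsilon> * (2 * E0) \<le> \<eta> / 2" using \<eta> E0_nn by (simp add: \<epsilon>_def field_simps)
        have "D * p \<le> (\<eta> / 2) * real (Suc n)" using n \<eta> by (simp add: field_simps)
        then show "D * (p / real (Suc n)) \<le> \<eta> / 2" by (simp add: field_simps)
      qed
      finally show ?thesis by simp
    qed
    then show ?thesis by blast
  qed
  obtain C1 where C1: "0 < C1" "\<And>u. u \<in> X \<Longrightarrow> integrable lborel u"
    "\<And>u. u \<in> X \<Longrightarrow> (\<integral>x. \<bar>u x\<bar> \<partial>lborel) \<le> C1 * energy u powr (1 / p)" using X_L1 by blast
  \<comment> \<open>The Cauchy property in energy acts through the L1 norm, which provides an almost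
    everywhere convergent subsequence.\<close>
  have cauchy_L1: "\<exists>n. \<forall>i\<ge>n. \<forall>j\<ge>n. (\<integral>x. \<bar>v i x - v j x\<bar> \<partial>lborel) < e" if e: "0 < e" for e
  proof -
    define \<eta> where "\<eta> = (e / (2 * C1)) powr p"
    have \<eta>: "0 < \<eta>" using e C1(1) by (simp add: \<eta>_def)
    obtain n where n: "\<And>i j. n \<le> i \<Longrightarrow> n \<le> j \<Longrightarrow> energy (\<lambda>x. v i x - v j x) \<le> \<eta>"
      using cauchy_E[OF \<eta>] by blast
    have "(\<integral>x. \<bar>v i x - v j x\<bar> \<partial>lborel) < e" if ij: "n \<le> i" "n \<le> j" for i j
    proof -
      have "(\<integral>x. \<bar>v i x - v j x\<bar> \<partial>lborel) \<le> C1 * energy (\<lambda>x. v i x - v j x) powr (1 / p)"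
        by (rule C1(3)[OF X_diff[OF v(1) v(1)]])
      also have "\<dots> \<le> C1 * \<eta> powr (1 / p)"
        using n[OF ij] C1(1) p by (intro mult_left_mono powr_mono2) auto
      also have "\<eta> powr (1 / p) = e / (2 * C1)" using p e C1(1) by (simp add: \<eta>_def powr_powr)
      also have "C1 * (e / (2 * C1)) < e" using C1(1) e by simp
      finally show ?thesis .
    qed
    then show ?thesis by blast
  qed
  obtain r where r: "strict_mono r" "AE x in lborel. Cauchy (\<lambda>i. v (r i) x)"
    using cauchy_L1_AE_cauchy_subseq[of lborel v] C1(2)[OF v(1)] cauchy_L1 by auto
  \<comment> \<open>A pointwise limit, so that the zero exterior values survive at every point; on
    the null set of divergence the value is arbitrary.\<close>
  define u where "u x = lim (\<lambda>i. v (r i) x)" for x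
  have [measurable]: "u \<in> borel_measurable borel" unfolding u_def[abs_def] by measurable
  have u_out: "u x = 0" if "x \<notin> \<Omega>" for x using X_D(2)[OF v(1) that] by (simp add: u_def)
  have lim: "AE x in lborel. (\<lambda>i. v (r i) x) \<longlonglongrightarrow> u x"
    using r(2) by eventually_elim (auto simp: u_def Cauchy_convergent_iff convergent_LIMSEQ_iff)
  have L1: "\<exists>n. \<forall>i\<ge>n. (\<integral>x. \<bar>v (r i) x - u x\<bar> \<partial>lborel) \<le> e" if e: "0 < e" for e
  proof -
    obtain n where n: "\<And>i j. n \<le> i \<Longrightarrow> n \<le> j \<Longrightarrow> (\<integral>x. \<bar>v i x - v j x\<bar> \<partial>lborel) < e"
      using cauchy_L1[OF e] by blast
    have "(\<integral>x. \<bar>v (r i) x - u x\<bar> \<partial>lborel) \<le> e" if i: "n \<le> i" for i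
    proof (rule integrable_AE_limit(2)[where f = "\<lambda>j x. \<bar>v (r i) x - v (r (j + n)) x\<bar>"])
      show "integrable lborel (\<lambda>x. \<bar>v (r i) x - v (r (j + n)) x\<bar>)" for j
        using C1(2)[OF v(1)] by simp
      have "n \<le> r i" using i seq_suble[OF r(1), of i] by linarith
      moreover have "n \<le> r (j + n)" for j using seq_suble[OF r(1), of "j + n"] by linarith
      ultimately show "(\<integral>x. \<bar>v (r i) x - v (r (j + n)) x\<bar> \<partial>lborel) \<le> e" for j
        using n[of "r i" "r (j + n)"] by simp
      show "AE x in lborel. (\<lambda>j. \<bar>v (r i) x - v (r (j + n)) x\<bar>) \<longlonglongrightarrow> \<bar>v (r i) x - u x\<bar>"
        using lim
      proof eventually_elim
        case (elim x)
        show ?case using LIMSEQ_ignore_initial_segment[OF elim, of n] by (intro tendsto_intros)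
      qed
    qed auto
    then show ?thesis by blast
  qed
  have lim2: "AE z in M. (\<lambda>i. \<bar>gap (v (r (i + n))) z\<bar> powr p) \<longlonglongrightarrow> \<bar>gap u z\<bar> powr p" for n
    using AE_M[OF lim]
  proof eventually_elim
    case (elim z)
    have "(\<lambda>i. v (r (i + n)) (fst z)) \<longlonglongrightarrow> u (fst z)" "(\<lambda>i. v (r (i + n)) (snd z)) \<longlonglongrightarrow> u (snd z)"
      using elim LIMSEQ_ignore_initial_segment[of _ _ n] by blast+
    then show ?case using p by (intro tendsto_intros) auto
  qed
  have u: "u \<in> X"
  proof -
    have "integrable M (\<lambda>z. \<bar>gap u z\<bar> powr p)"
      by (rule integrable_AE_limit(1)[where f = "\<lambda>i z. \<bar>gap (v (r (i + 0))) z\<bar> powr p" and C = E0])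
         (use E0 X_D(3)[OF v(1)] lim2[of 0] in \<open>auto simp: energy_def\<close>)
    then show ?thesis using u_out by (simp add: X_def)
  qed
  \<comment> \<open>Lower semicontinuity with a margin: Fatou's lemma bounds the energy of
    \<open>u\<close> by a bound along the tail, where \<open>J\<close> is within
    \<open>e / 2\<close> of the infimum and the integral of \<open>F * H\<close> within
    \<open>e / 2\<close> of its value at \<open>u\<close>.\<close>
  have "J u \<le> I + e" if e: "0 < e" for e
  proof -
    define e' where "e' = e / (2 * (B * K + 1))"
    have BK': "0 \<le> B * K" using BK by simp
    have "0 < 2 * (c + 1)" "c * (e / (2 * (c + 1))) \<le> e / 2" if "0 \<le> c" for c :: real
      using that e by (auto simp: field_simps)
    then have e': "0 < e'" "B * K * e' \<le> e / 2" using BK' e by (simp_all add: e'_def)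
    from L1[OF e'(1)] obtain n1 where n1: "\<And>i. n1 \<le> i \<Longrightarrow> (\<integral>x. \<bar>v (r i) x - u x\<bar> \<partial>lborel) \<le> e'" by blast
    obtain n2 where n2: "2 / e < real n2" using reals_Archimedean2 by blast
    define n where "n = max n1 n2"
    let ?C = "p * (I + e + (\<integral>x. F x * H (u x) \<partial>lborel))"
    have "energy u \<le> ?C"
      unfolding energy_def
    proof (rule integrable_AE_limit(2)[OF _ _ _ _ _ lim2[of n]])
      fix i
      let ?k = "r (i + n)"
      have "energy (v ?k) / p = J (v ?k) + (\<integral>x. F x * H (v ?k x) \<partial>lborel)" by (simp add: J_def)
      also have "\<dots> \<le> (I + e / 2) + ((\<integral>x. F x * H (u x) \<partial>lborel) + e / 2)"
      proof (rule add_mono)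
        have "i + n \<le> ?k" by (rule seq_suble[OF r(1)])
        then have "2 / e < real (Suc ?k)" using n2 by (simp add: n_def)
        then have "1 / real (Suc ?k) < e / 2" using e by (simp add: field_simps)
        then show "J (v ?k) \<le> I + e / 2" using v(2)[of ?k] by linarith
        have "\<bar>(\<integral>x. F x * H (v ?k x) \<partial>lborel) - (\<integral>x. F x * H (u x) \<partial>lborel)\<bar>
            \<le> B * K * (\<integral>x. \<bar>v ?k x - u x\<bar> \<partial>lborel)" by (rule FH_diff[OF v(1) u])
        also have "\<dots> \<le> B * K * e'" using n1[of "i + n"] BK by (intro mult_left_mono) (auto simp: n_def)
        also have "\<dots> \<le> e / 2" by (rule e')
        finally show "(\<integral>x. F x * H (v ?k x) \<partial>lborel) \<le> (\<integral>x. F x * H (u x) \<partial>lborel) + e / 2" by linarith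
      qed
      finally have "energy (v ?k) \<le> ?C" using p by (simp add: field_simps)
      then show "(\<integral>z. \<bar>gap (v ?k) z\<bar> powr p \<partial>M) \<le> ?C" by (simp add: energy_def)
    qed (use X_D(3)[OF v(1)] in auto)
    then show ?thesis using p by (simp add: J_def field_simps)
  qed
  then have "J u \<le> I" by (rule field_le_epsilon)
  then show ?thesis using that[OF u] I by force
qed

text \<open>Flux and nonlinearity are evaluated at the varied function \<open>u + t * \<phi>\<close>
  and not at \<open>u\<close>: the tangent inequalities then give an estimate valid for each
  \<open>t > 0\<close>, without differentiating under the integral. Only afterwards \<open>t\<close>
  tends to 0, by dominated convergence.\<close>

lemma euler_lagrange_le:
  assumes u: "u \<in> X" and min: "\<And>v. v \<in> X \<Longrightarrow> J u \<le> J v" and \<phi>: "\<phi> \<in> X"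
  shows "(\<integral>x. F x * h (u x) * \<phi> x \<partial>lborel) \<le> form u \<phi>"
proof -
  note [measurable] = X_D(1)[OF u] X_D(1)[OF \<phi>]
  define t where "t n = 1 / real (Suc n)" for n
  have t: "0 < t n" "t n \<le> 1" for n by (auto simp: t_def)
  have t0: "t \<longlonglongrightarrow> 0" unfolding t_def[abs_def] using LIMSEQ_inverse_real_of_nat by (simp add: inverse_eq_divide)
  define w where "w n x = u x + t n * \<phi> x" for n x
  have w: "w n \<in> X" for n unfolding w_def[abs_def] by (rule X_add_scaled[OF u \<phi>])
  note [measurable] = X_D(1)[OF w]
  have gap_w: "gap (w n) z = gap u z + t n * gap \<phi> z" for n z by (simp add: w_def algebra_simps)
  have le: "(\<integral>x. F x * h (w n x) * \<phi> x \<partial>lborel) \<le> form (w n) \<phi>" for n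
  proof -
    have "energy (w n) - energy u \<le> p * t n * form (w n) \<phi>"
    proof -
      have "energy (w n) - energy u = (\<integral>z. \<bar>gap (w n) z\<bar> powr p - \<bar>gap u z\<bar> powr p \<partial>M)"
        unfolding energy_def using X_D(3)[OF w] X_D(3)[OF u] by simp
      also have "\<dots> \<le> (\<integral>z. p * t n * (pflux p (gap (w n) z) * gap \<phi> z) \<partial>M)"
      proof (rule integral_mono)
        show "integrable M (\<lambda>z. \<bar>gap (w n) z\<bar> powr p - \<bar>gap u z\<bar> powr p)"
          using X_D(3)[OF w] X_D(3)[OF u] by simp
        show "integrable M (\<lambda>z. p * t n * (pflux p (gap (w n) z) * gap \<phi> z))"
          using form_integrable[OF w \<phi>] by simp
        fix z
        have e: "gap u z - gap (w n) z = - (t n * gap \<phi> z)" unfolding gap_w by simp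
        show "\<bar>gap (w n) z\<bar> powr p - \<bar>gap u z\<bar> powr p \<le> p * t n * (pflux p (gap (w n) z) * gap \<phi> z)"
          using powr_tangent[OF p, of "gap (w n) z" "gap u z", unfolded e] by (simp add: algebra_simps)
      qed
      finally show ?thesis by (simp add: form_def)
    qed
    moreover have "t n * (\<integral>x. F x * h (w n x) * \<phi> x \<partial>lborel) \<le> (\<integral>x. F x * H (w n x) \<partial>lborel) - (\<integral>x. F x * H (u x) \<partial>lborel)"
    proof -
      have "t n * (\<integral>x. F x * h (w n x) * \<phi> x \<partial>lborel) = (\<integral>x. t n * (F x * h (w n x) * \<phi> x) \<partial>lborel)" by simp
      also have "\<dots> \<le> (\<integral>x. F x * H (w n x) - F x * H (u x) \<partial>lborel)"
      proof (rule integral_mono)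
        show "integrable lborel (\<lambda>x. t n * (F x * h (w n x) * \<phi> x))"
          using rhs_integrable[OF _ \<phi>, of "w n"] by simp
        show "integrable lborel (\<lambda>x. F x * H (w n x) - F x * H (u x))"
          using FH_integrable[OF w] FH_integrable[OF u] by simp
        fix x
        have "F x * (h (w n x) * (w n x - u x)) \<le> F x * (H (w n x) - H (u x))"
          using F H by (intro mult_left_mono) auto
        then show "t n * (F x * h (w n x) * \<phi> x) \<le> F x * H (w n x) - F x * H (u x)"
          by (simp add: w_def algebra_simps)
      qed
      finally show ?thesis using FH_integrable[OF w] FH_integrable[OF u] by simp
    qed
    moreover have "J u \<le> J (w n)" by (rule min[OF w])
    ultimately have "t n * (\<integral>x. F x * h (w n x) * \<phi> x \<partial>lborel) \<le> (energy (w n) - energy u) / p"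
      by (simp add: J_def diff_divide_distrib)
    also have "\<dots> \<le> (p * t n * form (w n) \<phi>) / p"
      using \<open>energy (w n) - energy u \<le> p * t n * form (w n) \<phi>\<close> p by (intro divide_right_mono) auto
    finally have "t n * (\<integral>x. F x * h (w n x) * \<phi> x \<partial>lborel) \<le> t n * form (w n) \<phi>" using p by simp
    then show ?thesis using t by simp
  qed
  have w_lim: "(\<lambda>n. w n x) \<longlonglongrightarrow> u x" for x
  proof -
    have "(\<lambda>n. u x + t n * \<phi> x) \<longlonglongrightarrow> u x + 0 * \<phi> x" by (intro tendsto_intros t0)
    then show ?thesis by (simp add: w_def)
  qed
  have lim1: "(\<lambda>n. form (w n) \<phi>) \<longlonglongrightarrow> form u \<phi>"
    unfolding form_def
  proof (rule integral_dominated_convergence)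
    \<comment> \<open>A majorant independent of \<open>n\<close>, because
      \<open>t n \<le> 1\<close>.\<close>
    show "integrable M (\<lambda>z. 2 powr p * (\<bar>gap u z\<bar> powr p + \<bar>gap \<phi> z\<bar> powr p) + \<bar>gap \<phi> z\<bar> powr p)"
      using X_D(3)[OF u] X_D(3)[OF \<phi>] by simp
    show "AE z in M. (\<lambda>n. pflux p (gap (w n) z) * gap \<phi> z) \<longlonglongrightarrow> pflux p (gap u z) * gap \<phi> z"
    proof (rule AE_I2)
      fix z
      have "(\<lambda>n. gap (w n) z) \<longlonglongrightarrow> gap u z" by (intro tendsto_intros w_lim)
      moreover have "isCont (pflux p) (gap u z)"
        using continuous_pflux[OF p] by (simp add: continuous_on_eq_continuous_at)
      ultimately have "(\<lambda>n. pflux p (gap (w n) z)) \<longlonglongrightarrow> pflux p (gap u z)"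
        by (rule isCont_tendsto_compose[rotated])
      then show "(\<lambda>n. pflux p (gap (w n) z) * gap \<phi> z) \<longlonglongrightarrow> pflux p (gap u z) * gap \<phi> z"
        by (intro tendsto_intros)
    qed
    show "AE z in M. norm (pflux p (gap (w n) z) * gap \<phi> z)
        \<le> 2 powr p * (\<bar>gap u z\<bar> powr p + \<bar>gap \<phi> z\<bar> powr p) + \<bar>gap \<phi> z\<bar> powr p" for n
    proof (rule AE_I2)
      fix z
      have "norm (pflux p (gap (w n) z) * gap \<phi> z) = \<bar>gap (w n) z\<bar> powr (p - 1) * \<bar>gap \<phi> z\<bar>"
        unfolding real_norm_def abs_mult abs_pflux ..
      also have "\<dots> \<le> \<bar>gap (w n) z\<bar> powr p + \<bar>gap \<phi> z\<bar> powr p" by (rule powr_mult_le_sum[OF p])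
      also have "\<bar>gap (w n) z\<bar> powr p \<le> 2 powr p * (\<bar>gap u z\<bar> powr p + \<bar>t n * gap \<phi> z\<bar> powr p)"
        unfolding gap_w using p by (intro powr_sum_le) auto
      also have "\<bar>t n * gap \<phi> z\<bar> powr p \<le> \<bar>gap \<phi> z\<bar> powr p"
        using t[of n] p by (intro powr_mono2) (auto simp: abs_mult mult_left_le_one_le)
      finally show "norm (pflux p (gap (w n) z) * gap \<phi> z)
        \<le> 2 powr p * (\<bar>gap u z\<bar> powr p + \<bar>gap \<phi> z\<bar> powr p) + \<bar>gap \<phi> z\<bar> powr p" by simp
    qed
  qed measurable
  have lim2: "(\<lambda>n. \<integral>x. F x * h (w n x) * \<phi> x \<partial>lborel) \<longlonglongrightarrow> (\<integral>x. F x * h (u x) * \<phi> x \<partial>lborel)"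
  proof (rule integral_dominated_convergence)
    obtain C where "integrable lborel \<phi>" using X_L1 \<phi> by metis
    then show "integrable lborel (\<lambda>x. B * K * \<bar>\<phi> x\<bar>)" by simp
    show "AE x in lborel. (\<lambda>n. F x * h (w n x) * \<phi> x) \<longlonglongrightarrow> F x * h (u x) * \<phi> x"
    proof (rule AE_I2)
      fix x
      have "isCont h (u x)" using h_cont by (simp add: continuous_on_eq_continuous_at)
      then have "(\<lambda>n. h (w n x)) \<longlonglongrightarrow> h (u x)" by (rule isCont_tendsto_compose[OF _ w_lim])
      then show "(\<lambda>n. F x * h (w n x) * \<phi> x) \<longlonglongrightarrow> F x * h (u x) * \<phi> x" by (intro tendsto_intros)
    qed
    show "AE x in lborel. norm (F x * h (w n x) * \<phi> x) \<le> B * K * \<bar>\<phi> x\<bar>" for n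
      using F h BK by (simp add: abs_mult mult_mono mult_right_mono)
  qed measurable
  show ?thesis by (rule LIMSEQ_le[OF lim2 lim1]) (use le in auto)
qed

lemma weak_solution_from_antiderivative:
  obtains u where "u \<in> X" "\<And>\<phi>. \<phi> \<in> X \<Longrightarrow> form u \<phi> = (\<integral>x. F x * h (u x) * \<phi> x \<partial>lborel)"
proof -
  obtain u where u: "u \<in> X" and min: "\<And>v. v \<in> X \<Longrightarrow> J u \<le> J v" using J_minimizer by blast
  have "form u \<phi> = (\<integral>x. F x * h (u x) * \<phi> x \<partial>lborel)" if \<phi>: "\<phi> \<in> X" for \<phi>
  proof (rule antisym)
    show "(\<integral>x. F x * h (u x) * \<phi> x \<partial>lborel) \<le> form u \<phi>" by (rule euler_lagrange_le[OF u min \<phi>])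
    have \<phi>': "(\<lambda>x. 0 - \<phi> x) \<in> X" by (rule X_diff[OF X_zero \<phi>])
    have "(\<integral>x. F x * h (u x) * (0 - \<phi> x) \<partial>lborel) \<le> form u (\<lambda>x. 0 - \<phi> x)"
      using euler_lagrange_le[OF u _ \<phi>'] min by blast
    moreover have "form u (\<lambda>x. 0 - \<phi> x) = - form u \<phi>"
    proof -
      have "form u (\<lambda>x. 0 - \<phi> x) = (\<integral>z. - (pflux p (gap u z) * gap \<phi> z) \<partial>M)"
        unfolding form_def by (intro Bochner_Integration.integral_cong) (auto simp: algebra_simps)
      then show ?thesis by (simp add: form_def)
    qed
    moreover have "(\<integral>x. F x * h (u x) * (0 - \<phi> x) \<partial>lborel) = - (\<integral>x. F x * h (u x) * \<phi> x \<partial>lborel)" by simp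
    ultimately show "form u \<phi> \<le> (\<integral>x. F x * h (u x) * \<phi> x \<partial>lborel)" by linarith
  qed
  then show ?thesis using that[OF u] by blast
qed

end

text \<open>The right-hand side is nonnegative, so comparison with the zero function gives
  \<open>0 \<le> u\<close> almost everywhere. Passing to \<open>max 0 u\<close> makes the sign hold
  everywhere and changes neither side of the equation.\<close>

theorem nonneg_weak_solution:
  obtains u where "u \<in> X" "\<And>x. 0 \<le> u x"
    "\<And>\<phi>. \<phi> \<in> X \<Longrightarrow> form u \<phi> = (\<integral>x. F x * h (u x) * \<phi> x \<partial>lborel)"
proof -
  obtain H where "H 0 = 0" "\<And>a b. h b * (b - a) \<le> H b - H a"
    using concave_antiderivative[OF h_cont h_anti] by blast
  from weak_solution_from_antiderivative[OF this]
  obtain u where u: "u \<in> X" and eq: "\<And>\<phi>. \<phi> \<in> X \<Longrightarrow> form u \<phi> = (\<integral>x. F x * h (u x) * \<phi> x \<partial>lborel)" by blast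
  note [measurable] = X_D(1)[OF u]
  have "AE x in lborel. 0 \<le> u x"
  proof (rule comparison[OF X_zero u])
    let ?\<phi> = "\<lambda>x. max 0 (0 - u x)"
    have "?\<phi> \<in> X" using X_pos_part[OF X_diff[OF X_zero u]] by simp
    then have "form u ?\<phi> = (\<integral>x. F x * h (u x) * ?\<phi> x \<partial>lborel)" by (rule eq)
    also have "0 \<le> \<dots>" using F h by (intro integral_nonneg_AE) auto
    finally have "0 \<le> form u ?\<phi>" by simp
    moreover have "form (\<lambda>x. 0) ?\<phi> = 0" by (simp add: form_def)
    ultimately show "form (\<lambda>x. 0) ?\<phi> \<le> form u ?\<phi>" by simp
  qed
  then have ae: "AE x in lborel. u x = max 0 (u x)" by eventually_elim simp
  show ?thesis
  proof (rule that)
    show X: "(\<lambda>x. max 0 (u x)) \<in> X" by (rule X_pos_part[OF u])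
    fix \<phi> assume \<phi>: "\<phi> \<in> X"
    note [measurable] = X_D(1)[OF \<phi>]
    have "form (\<lambda>x. max 0 (u x)) \<phi> = form u \<phi>"
      by (rule X_AE_cong(3)[OF u _ _ ae \<phi>]) (use X_D(2)[OF u] in auto)
    also have "\<dots> = (\<integral>x. F x * h (u x) * \<phi> x \<partial>lborel)" by (rule eq[OF \<phi>])
    also have "\<dots> = (\<integral>x. F x * h (max 0 (u x)) * \<phi> x \<partial>lborel)"
    proof (rule integral_cong_AE)
      show "AE x in lborel. F x * h (u x) * \<phi> x = F x * h (max 0 (u x)) * \<phi> x"
        using ae by eventually_elim simp
    qed measurable
    finally show "form (\<lambda>x. max 0 (u x)) \<phi> = (\<integral>x. F x * h (max 0 (u x)) * \<phi> x \<partial>lborel)" .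
  qed simp
qed

end

subsection \<open>Interior positivity of supersolutions\<close>

lemma fast_geometric_convergence:
  fixes \<beta> C B :: real
  assumes \<beta>: "1 < \<beta>" and C: "0 < C" and B: "1 < B"
  obtains \<nu> where "0 < \<nu>"
    "\<And>a. (\<And>j. 0 \<le> a j) \<Longrightarrow> a 0 \<le> \<nu> \<Longrightarrow> (\<And>j. a (Suc j) \<le> (C * B ^ j * a j) powr \<beta>)
        \<Longrightarrow> (a \<longlonglongrightarrow> (0::real))"
proof -
  \<comment> \<open>The bound \<open>a j \<le> \<nu> * l ^ j\<close> is reproduced by the recursion
    if \<open>(B * l) powr \<beta> = l\<close> and
    \<open>(C * \<nu>) powr \<beta> = \<nu> * l\<close>; these two equations determine
    \<open>l\<close> and \<open>\<nu>\<close>.\<close>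
  define l where "l = B powr (- (\<beta> / (\<beta> - 1)))"
  define \<nu> where "\<nu> = (l / C powr \<beta>) powr (1 / (\<beta> - 1))"
  have l: "0 < l" using B by (simp add: l_def)
  have "B powr (- (\<beta> / (\<beta> - 1))) < B powr 0" using B \<beta> by (intro powr_less_mono) auto
  then have l1: "l < 1" using B by (simp add: l_def)
  have Bl: "(B * l) powr \<beta> = l"
  proof -
    have "1 + - (\<beta> / (\<beta> - 1)) = - (1 / (\<beta> - 1))" using \<beta> by (simp add: field_simps)
    then have "B * l = B powr (- (1 / (\<beta> - 1)))"
      unfolding l_def using powr_mult_base[of B "- (\<beta> / (\<beta> - 1))"] B by simp
    then show ?thesis by (simp add: l_def powr_powr)
  qed
  have \<nu>: "0 < \<nu>" using l C by (simp add: \<nu>_def)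
  have C\<nu>: "(C * \<nu>) powr \<beta> = \<nu> * l"
  proof -
    have "\<nu> powr \<beta> = \<nu> * \<nu> powr (\<beta> - 1)" using powr_mult_base[of \<nu> "\<beta> - 1"] \<nu> by simp
    also have "\<nu> powr (\<beta> - 1) = l / C powr \<beta>" using l C \<beta> by (simp add: \<nu>_def powr_powr)
    finally show ?thesis using C \<nu> by (simp add: powr_mult)
  qed
  have conv: "a \<longlonglongrightarrow> 0"
    if a: "\<And>j. 0 \<le> a j" "a 0 \<le> \<nu>" "\<And>j. a (Suc j) \<le> (C * B ^ j * a j) powr \<beta>" for a :: "nat \<Rightarrow> real"
  proof -
    have le: "a j \<le> \<nu> * l ^ j" for j
    proof (induction j)
      case (Suc j)
      have "a (Suc j) \<le> (C * B ^ j * a j) powr \<beta>" by (rule a)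
      also have "\<dots> \<le> (C * B ^ j * (\<nu> * l ^ j)) powr \<beta>"
        using Suc a(1) C B \<beta> by (intro powr_mono2 mult_left_mono mult_nonneg_nonneg) auto
      also have "C * B ^ j * (\<nu> * l ^ j) = (C * \<nu>) * (B * l) ^ j" by (simp add: power_mult_distrib)
      also have "((C * \<nu>) * (B * l) ^ j) powr \<beta> = (C * \<nu>) powr \<beta> * ((B * l) ^ j) powr \<beta>"
        using C \<nu> B l by (simp add: powr_mult)
      also have "((B * l) ^ j) powr \<beta> = l ^ j"
      proof -
        have Bl0: "0 < B * l" using B l by simp
        have "((B * l) ^ j) powr \<beta> = ((B * l) powr real j) powr \<beta>"
          by (simp only: powr_realpow[OF Bl0])
        also have "\<dots> = ((B * l) powr \<beta>) powr real j"
          by (simp only: powr_powr mult.commute[of \<beta>])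
        also have "\<dots> = l ^ j" using l by (simp only: Bl powr_realpow)
        finally show ?thesis .
      qed
      finally show ?case by (simp add: C\<nu> mult_ac)
    qed (use a(2) in simp)
    have "(\<lambda>j. \<nu> * l ^ j) \<longlonglongrightarrow> \<nu> * 0" using l l1 by (intro tendsto_intros LIMSEQ_power_zero) auto
    then have "(\<lambda>j. \<nu> * l ^ j) \<longlonglongrightarrow> 0" by simp
    then show ?thesis
      by (rule tendsto_sandwich[rotated 3]) (use le a(1) in auto)
  qed
  show ?thesis using that[OF \<nu>] conv by blast
qed

context frac_space
begin

section \<open>De Giorgi iteration for a nonnegative supersolution\<close>

context
  fixes u \<psi> :: "'a \<Rightarrow> real" and C :: real
  assumes u: "u \<in> X" and u_nonneg: "\<And>x. 0 \<le> u x"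
    and super: "\<And>\<phi>. \<phi> \<in> X \<Longrightarrow> (\<And>x. 0 \<le> \<phi> x) \<Longrightarrow> 0 \<le> form u \<phi>"
    and \<psi>: "\<psi> \<in> X" "\<And>x. 0 \<le> \<psi> x" "\<And>x. \<psi> x \<le> 1" and C: "0 \<le> C"
    and gap_\<psi>: "\<And>S. S \<in> sets borel \<Longrightarrow>
       (\<integral>\<^sup>+z. ennreal (\<bar>gap \<psi> z\<bar> powr p) * indicator S (fst z) \<partial>M) \<le> ennreal C * emeasure lborel S"
      "\<And>S. S \<in> sets borel \<Longrightarrow>
       (\<integral>\<^sup>+z. ennreal (\<bar>gap \<psi> z\<bar> powr p) * indicator S (snd z) \<partial>M) \<le> ennreal C * emeasure lborel S"
begin

definition excess :: "real \<Rightarrow> real \<Rightarrow> 'a \<Rightarrow> real" where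
  "excess k t x = max 0 (k * \<psi> x - t - u x)"

text \<open>The positivity set of \<open>excess k t\<close>.\<close>

definition level :: "real \<Rightarrow> real \<Rightarrow> 'a set" where
  "level k t = {x. t < k * \<psi> x - u x}"

text \<open>The error in the Caccioppoli inequality without its factor \<open>k powr p\<close>: the
  gap of the barrier \<open>k * \<psi> - t\<close> counts only on pairs that meet the level
  set.\<close>

definition remainder :: "real \<Rightarrow> real \<Rightarrow> 'a \<times> 'a \<Rightarrow> real" where
  "remainder k t z = \<bar>gap \<psi> z\<bar> powr p * (indicat_real (level k t) (fst z) + indicat_real (level k t) (snd z))"

lemma measurable_u_\<psi> [measurable]: "u \<in> borel_measurable borel" "\<psi> \<in> borel_measurable borel"
  using X_D(1) u \<psi> by auto

lemma level_sets [measurable]: "level k t \<in> sets borel"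
  unfolding level_def by measurable

lemma level_subset: "0 \<le> t \<Longrightarrow> level k t \<subseteq> \<Omega>"
  using X_D(2)[OF \<psi>(1)] X_D(2)[OF u] by (force simp: level_def)

lemma level_finite: "0 \<le> t \<Longrightarrow> emeasure lborel (level k t) < \<infinity>"
  using emeasure_mono[OF level_subset, of t lborel k] emeasure_\<Omega> by (simp add: le_less_trans)

lemma emeasure_level: "0 \<le> t \<Longrightarrow> emeasure lborel (level k t) = ennreal (measure lborel (level k t))"
  using level_finite[of t k] by (intro emeasure_eq_ennreal_measure) auto

lemma excess_X: "0 \<le> t \<Longrightarrow> excess k t \<in> X"
proof -
  assume t: "0 \<le> t"
  have "(\<lambda>x. 0 + k * \<psi> x) \<in> X" by (rule X_add_scaled[OF X_zero \<psi>(1)])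
  then have "(\<lambda>x. k * \<psi> x - u x) \<in> X" using X_diff[OF _ u, of "\<lambda>x. k * \<psi> x"] by simp
  from X_excess[OF this t] show ?thesis by (simp add: excess_def[abs_def] algebra_simps)
qed

lemma measurable_excess [measurable]: "excess k t \<in> borel_measurable borel"
  unfolding excess_def[abs_def] by measurable

lemma measurable_indicator_pair [measurable]:
  "(\<lambda>z. indicat_real S (fst z)) \<in> borel_measurable (borel :: ('a \<times> 'a) measure)"
  "(\<lambda>z. indicat_real S (snd z)) \<in> borel_measurable (borel :: ('a \<times> 'a) measure)"
  if "S \<in> sets borel" for S :: "'a set"
  using that by (simp_all add: borel_prod[symmetric])

lemma remainder_integral:
  assumes t: "0 \<le> t"
  shows "integrable M (remainder k t)" "(\<integral>z. remainder k t z \<partial>M) \<le> 2 * C * measure lborel (level k t)"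
proof -
  let ?S = "level k t"
  have nn: "0 \<le> remainder k t z" for z by (simp add: remainder_def)
  have [measurable]: "remainder k t \<in> borel_measurable borel"
    unfolding remainder_def[abs_def] by measurable
  have [measurable]: "(\<lambda>z. indicator ?S (fst z) :: ennreal) \<in> borel_measurable (borel :: ('a \<times> 'a) measure)"
      "(\<lambda>z. indicator ?S (snd z) :: ennreal) \<in> borel_measurable (borel :: ('a \<times> 'a) measure)"
    by (simp_all add: borel_prod[symmetric])
  have "(\<integral>\<^sup>+z. ennreal (remainder k t z) \<partial>M) = (\<integral>\<^sup>+z. ennreal (\<bar>gap \<psi> z\<bar> powr p) * indicator ?S (fst z)
          + ennreal (\<bar>gap \<psi> z\<bar> powr p) * indicator ?S (snd z) \<partial>M)"
    by (intro nn_integral_cong) (auto simp: remainder_def indicator_def ennreal_plus[symmetric] simp del: ennreal_plus)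
  also have "\<dots> = (\<integral>\<^sup>+z. ennreal (\<bar>gap \<psi> z\<bar> powr p) * indicator ?S (fst z) \<partial>M)
     + (\<integral>\<^sup>+z. ennreal (\<bar>gap \<psi> z\<bar> powr p) * indicator ?S (snd z) \<partial>M)"
    by (rule nn_integral_add) auto
  also have "\<dots> \<le> ennreal C * emeasure lborel ?S + ennreal C * emeasure lborel ?S"
    by (intro add_mono gap_\<psi>) auto
  also have "\<dots> = ennreal (2 * C * measure lborel ?S)"
    using C by (simp add: emeasure_level[OF t] ennreal_mult[symmetric] ennreal_plus[symmetric] del: ennreal_plus)
  finally have le: "(\<integral>\<^sup>+z. ennreal (remainder k t z) \<partial>M) \<le> ennreal (2 * C * measure lborel ?S)" .
  then show i: "integrable M (remainder k t)"
    using nn by (intro integrableI_nonneg) (auto simp: le_less_trans)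
  have "(\<integral>\<^sup>+z. ennreal (remainder k t z) \<partial>M) = ennreal (\<integral>z. remainder k t z \<partial>M)"
    by (rule nn_integral_eq_integral[OF i]) (use nn in auto)
  with le show "(\<integral>z. remainder k t z \<partial>M) \<le> 2 * C * measure lborel ?S"
    using C by (simp add: ennreal_le_iff)
qed

lemma pointwise_caccioppoli:
  assumes k: "0 \<le> k"
  shows "pflux p (gap u z) * gap (excess k t) z
    \<le> 2 powr p * k powr p * remainder k t z - 2 powr (- p - 1) * \<bar>gap (excess k t) z\<bar> powr p"
proof -
  obtain x y where z: "z = (x, y)" by (cases z)
  have "pflux p (u x - u y) * (excess k t x - excess k t y)
    \<le> 2 powr p * (if excess k t x > 0 \<or> excess k t y > 0 then \<bar>(k * \<psi> x - t) - (k * \<psi> y - t)\<bar> powr p else 0)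
      - 2 powr (- p - 1) * \<bar>excess k t x - excess k t y\<bar> powr p"
    unfolding excess_def by (rule pflux_caccioppoli[OF p])
  also have "(if excess k t x > 0 \<or> excess k t y > 0 then \<bar>(k * \<psi> x - t) - (k * \<psi> y - t)\<bar> powr p else 0)
     \<le> k powr p * remainder k t z"
  proof -
    have "\<bar>(k * \<psi> x - t) - (k * \<psi> y - t)\<bar> = k * \<bar>\<psi> x - \<psi> y\<bar>"
      using k by (simp add: abs_mult right_diff_distrib[symmetric])
    moreover have "0 < excess k t v \<longleftrightarrow> v \<in> level k t" for v by (auto simp: excess_def level_def)
    ultimately show ?thesis
      using k by (auto simp: z remainder_def powr_mult indicator_def)
  qed
  finally show ?thesis by (simp add: z algebra_simps)
qed

text \<open>The supersolution property makes the tested form nonnegative, so the coercive term is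
  bounded by the error term. Of the constant, one \<open>2 powr (p + 1)\<close> inverts the
  coercivity factor; the other consists of \<open>2 powr p\<close> and the two strips.\<close>

lemma caccioppoli:
  assumes k: "0 \<le> k" and t: "0 \<le> t"
  shows "energy (excess k t) \<le> 4 powr (p + 1) * C * k powr p * measure lborel (level k t)"
proof -
  note ex = excess_X[OF t, of k]
  have "0 \<le> form u (excess k t)" by (rule super[OF ex]) (simp add: excess_def)
  also have "\<dots> \<le> (\<integral>z. 2 powr p * k powr p * remainder k t z - 2 powr (- p - 1) * \<bar>gap (excess k t) z\<bar> powr p \<partial>M)"
    unfolding form_def
    by (rule integral_mono) (use form_integrable[OF u ex] remainder_integral(1)[OF t] X_D(3)[OF ex]
        pointwise_caccioppoli[OF k] in auto)
  also have "\<dots> = 2 powr p * k powr p * (\<integral>z. remainder k t z \<partial>M) - 2 powr (- p - 1) * energy (excess k t)"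
    using remainder_integral(1)[OF t] X_D(3)[OF ex] by (simp add: energy_def)
  finally have "2 powr (- p - 1) * energy (excess k t) \<le> 2 powr p * k powr p * (\<integral>z. remainder k t z \<partial>M)" by simp
  also have "\<dots> \<le> 2 powr p * k powr p * (2 * C * measure lborel (level k t))"
    by (intro mult_left_mono remainder_integral(2)[OF t]) auto
  finally have "2 powr (p + 1) * (2 powr (- p - 1) * energy (excess k t))
      \<le> 2 powr (p + 1) * (2 powr p * k powr p * (2 * C * measure lborel (level k t)))"
    by (rule mult_left_mono) simp
  also have "2 powr (p + 1) * (2 powr (- p - 1) * energy (excess k t)) = energy (excess k t)"
    by (simp add: mult.assoc[symmetric] powr_add[symmetric])
  also have "2 powr (p + 1) * (2 powr p * k powr p * (2 * C * measure lborel (level k t)))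
      = (2 powr (p + 1) * 2 powr (p + 1)) * C * k powr p * measure lborel (level k t)"
    by (simp add: powr_add)
  also have "2 powr (p + 1) * 2 powr (p + 1) = (4::real) powr (p + 1)"
    by (simp add: powr_mult[symmetric])
  finally show ?thesis .
qed

text \<open>The nonlocal effect: the set \<open>E\<close> on which \<open>u\<close> is large pushes \<open>u\<close> up everywhere in \<open>\<Omega>\<close>.\<close>

lemma excess_integral:
  assumes k: "0 \<le> k" and kd: "2 * k \<le> \<delta>" and \<delta>: "0 < \<delta>"
    and E [measurable]: "E \<in> sets borel" and E_def: "\<And>y. y \<in> E \<Longrightarrow> \<delta> \<le> u y"
    and \<kappa>: "0 \<le> \<kappa>" "\<And>x y. x \<in> \<Omega> \<Longrightarrow> y \<in> \<Omega> \<Longrightarrow> x \<noteq> y \<Longrightarrow> \<kappa> \<le> kernel (x, y)"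
  shows "(\<delta> / 2) powr (p - 1) * (\<kappa> * measure lborel E * (\<integral>x. excess k 0 x \<partial>lborel))
      \<le> 2 powr (p + 1) * C * k powr p * measure lborel (level k 0)"
proof -
  let ?f = "excess k 0"
  have ex: "?f \<in> X" by (rule excess_X) simp
  obtain C1 where f_int: "integrable lborel ?f" using X_L1 ex by metis
  have f_nn: "0 \<le> ?f x" for x by (simp add: excess_def)
  have E_sub: "E \<subseteq> \<Omega>" using E_def \<delta> X_D(2)[OF u] by force
  have E_fin: "emeasure lborel E = ennreal (measure lborel E)"
    using emeasure_mono[OF E_sub, of lborel] emeasure_\<Omega>
    by (intro emeasure_eq_ennreal_measure) (auto simp: top_unique)
  define d where "d = (\<delta> / 2) powr (p - 1)"
  have d: "0 < d" using \<delta> by (simp add: d_def)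
  have pos: "u x < k \<and> x \<in> \<Omega>" if "0 < ?f x" for x
  proof -
    have "u x < k * \<psi> x" using that by (auto simp: excess_def)
    moreover have "k * \<psi> x \<le> k" using k \<psi>(3)[of x] mult_left_mono[of "\<psi> x" 1 k] by simp
    moreover have "x \<in> \<Omega>" using that X_D(2)[OF ex, of x] by fastforce
    ultimately show ?thesis by simp
  qed
  \<comment> \<open>If the excess is positive at the first point and the second lies in
    \<open>E\<close>, then \<open>u\<close> rises from below \<open>k \<le> \<delta> / 2\<close> to
    at least \<open>\<delta>\<close>, so the flux is at most \<open>- d\<close>; on these pairs this
    gain is kept in place of the coercive term. All other pairs are covered by
    \<open>pointwise_caccioppoli\<close>.\<close>
  have pw: "pflux p (gap u z) * gap ?f z \<le> 2 powr p * k powr p * remainder k 0 z - d * (?f (fst z) * indicat_real E (snd z))" for z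
  proof (cases "0 < ?f (fst z) \<and> snd z \<in> E")
    case True
    let ?x = "fst z" and ?y = "snd z"
    have x: "u ?x < k" using pos True by blast
    have y: "\<delta> \<le> u ?y" using E_def True by blast
    have fy: "?f ?y = 0" using pos[of ?y] y kd k \<delta> f_nn[of ?y] by (cases "0 < ?f ?y") auto
    have "pflux p (gap u z) \<le> pflux p (- (\<delta> / 2))" using x y kd by (intro pflux_mono p) auto
    also have "\<dots> = - d" using \<delta> by (simp add: d_def pflux_nonneg)
    finally have "pflux p (gap u z) * ?f ?x \<le> - d * ?f ?x" by (intro mult_right_mono f_nn)
    moreover have "0 \<le> 2 powr p * k powr p * remainder k 0 z" by (simp add: remainder_def)
    ultimately show ?thesis using True fy by simp
  next
    case False
    then have e: "?f (fst z) * indicat_real E (snd z) = 0" using f_nn[of "fst z"] by (auto simp: indicator_def)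
    have "0 \<le> 2 powr (- p - 1) * \<bar>gap ?f z\<bar> powr p" by simp
    then show ?thesis unfolding e mult_zero_right using pointwise_caccioppoli[OF k, of z 0] by linarith
  qed
  have [measurable]: "(\<lambda>z. ?f (fst z)) \<in> borel_measurable (borel :: ('a \<times> 'a) measure)"
    by (simp add: borel_prod[symmetric])
  \<comment> \<open>Integrability of the gain is itself a consequence of \<open>pw\<close>, which
    places it between 0 and a difference of integrable functions.\<close>
  have int: "integrable M (\<lambda>z. d * (?f (fst z) * indicat_real E (snd z)))"
  proof (rule Bochner_Integration.integrable_bound)
    show "integrable M (\<lambda>z. 2 powr p * k powr p * remainder k 0 z - pflux p (gap u z) * gap ?f z)"
      using remainder_integral(1)[of 0 k] form_integrable[OF u ex] by simp
    show "AE z in M. norm (d * (?f (fst z) * indicat_real E (snd z)))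
        \<le> norm (2 powr p * k powr p * remainder k 0 z - pflux p (gap u z) * gap ?f z)"
    proof (rule AE_I2)
      fix z
      have "0 \<le> d * (?f (fst z) * indicat_real E (snd z))" using d f_nn by simp
      then show "norm (d * (?f (fst z) * indicat_real E (snd z)))
        \<le> norm (2 powr p * k powr p * remainder k 0 z - pflux p (gap u z) * gap ?f z)"
        using pw[of z] by (simp only: real_norm_def abs_of_nonneg)
    qed
  qed measurable
  from integrable_mult_right[OF this, of "1 / d"]
  have int': "integrable M (\<lambda>z. ?f (fst z) * indicat_real E (snd z))"
    using d by simp
  have "0 \<le> form u ?f" by (rule super[OF ex f_nn])
  also have "\<dots> \<le> (\<integral>z. 2 powr p * k powr p * remainder k 0 z - d * (?f (fst z) * indicat_real E (snd z)) \<partial>M)"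
    unfolding form_def
    by (rule integral_mono) (use form_integrable[OF u ex] remainder_integral(1)[of 0 k] int pw in auto)
  also have "\<dots> = 2 powr p * k powr p * (\<integral>z. remainder k 0 z \<partial>M) - d * (\<integral>z. ?f (fst z) * indicat_real E (snd z) \<partial>M)"
    using remainder_integral(1)[of 0 k] int' by simp
  finally have "d * (\<integral>z. ?f (fst z) * indicat_real E (snd z) \<partial>M) \<le> 2 powr p * k powr p * (\<integral>z. remainder k 0 z \<partial>M)" by simp
  also have "\<dots> \<le> 2 powr p * k powr p * (2 * C * measure lborel (level k 0))"
    by (intro mult_left_mono remainder_integral(2)) auto
  finally have 1: "d * (\<integral>z. ?f (fst z) * indicat_real E (snd z) \<partial>M) \<le> 2 powr (p + 1) * C * k powr p * measure lborel (level k 0)"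
    by (simp add: powr_add mult_ac)
  \<comment> \<open>A lower bound for the gain by Tonelli: over each \<open>x\<close>, the fibre
    contributes at least \<open>\<kappa> * measure lborel E\<close> times the excess at
    \<open>x\<close>.\<close>
  have "ennreal (\<kappa> * measure lborel E * (\<integral>x. ?f x \<partial>lborel)) = ennreal (\<kappa> * measure lborel E) * (\<integral>\<^sup>+x. ennreal (?f x) \<partial>lborel)"
    using \<kappa> f_nn by (subst nn_integral_eq_integral[OF f_int]) (auto simp: ennreal_mult integral_nonneg_AE)
  also have "\<dots> = (\<integral>\<^sup>+x. ennreal (\<kappa> * measure lborel E) * ennreal (?f x) \<partial>lborel)"
    by (rule nn_integral_cmult[symmetric]) simp
  also have "\<dots> \<le> (\<integral>\<^sup>+x. \<integral>\<^sup>+y. ennreal (kernel (x, y)) * ennreal (?f x * indicat_real E y) \<partial>lborel \<partial>lborel)"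
  proof (rule nn_integral_mono)
    fix x
    have "ennreal (\<kappa> * measure lborel E) * ennreal (?f x) = ennreal (\<kappa> * ?f x) * emeasure lborel E"
      using \<kappa> f_nn by (simp add: E_fin ennreal_mult[symmetric] mult_ac)
    also have "\<dots> = (\<integral>\<^sup>+y. ennreal (\<kappa> * ?f x) * indicator E y \<partial>lborel)"
      by (subst nn_integral_cmult) (auto intro!: borel_measurable_indicator)
    also have "\<dots> \<le> (\<integral>\<^sup>+y. ennreal (kernel (x, y)) * ennreal (?f x * indicat_real E y) \<partial>lborel)"
    proof (rule nn_integral_mono)
      fix y
      show "ennreal (\<kappa> * ?f x) * indicator E y \<le> ennreal (kernel (x, y)) * ennreal (?f x * indicat_real E y)"
      proof (cases "0 < ?f x \<and> y \<in> E")
        case True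
        have "x \<noteq> y" using pos[of x] E_def[of y] True kd k by auto
        then have "\<kappa> \<le> kernel (x, y)" using pos True E_sub by (intro \<kappa>) auto
        then have "\<kappa> * ?f x \<le> kernel (x, y) * ?f x" by (intro mult_right_mono f_nn)
        then show ?thesis using True by (simp add: ennreal_mult[symmetric] f_nn ennreal_leI)
      next
        case False
        then show ?thesis using f_nn[of x] by (auto simp: indicator_def order_less_le)
      qed
    qed
    finally show "ennreal (\<kappa> * measure lborel E) * ennreal (?f x)
      \<le> (\<integral>\<^sup>+y. ennreal (kernel (x, y)) * ennreal (?f x * indicat_real E y) \<partial>lborel)" .
  qed
  also have "\<dots> = (\<integral>\<^sup>+z. ennreal (?f (fst z) * indicat_real E (snd z)) \<partial>M)"
    by (subst nn_integral_M(1)) auto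
  also have "\<dots> = ennreal (\<integral>z. ?f (fst z) * indicat_real E (snd z) \<partial>M)"
    by (rule nn_integral_eq_integral[OF int']) (use f_nn in auto)
  finally have "\<kappa> * measure lborel E * (\<integral>x. ?f x \<partial>lborel) \<le> (\<integral>z. ?f (fst z) * indicat_real E (snd z) \<partial>M)"
    using f_nn by (subst (asm) ennreal_le_iff) (auto intro!: integral_nonneg_AE)
  then have "d * (\<kappa> * measure lborel E * (\<integral>x. ?f x \<partial>lborel)) \<le> d * (\<integral>z. ?f (fst z) * indicat_real E (snd z) \<partial>M)"
    using d by (intro mult_left_mono) auto
  with 1 show ?thesis unfolding d_def by linarith
qed

text \<open>Markov's inequality, since \<open>excess k t\<close> exceeds \<open>t' - t\<close> on
  the higher level set. It serves with \<open>\<theta> = pst\<close> in the recursion and with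
  \<open>\<theta> = 1\<close> for its starting value.\<close>

lemma level_markov:
  assumes \<theta>: "0 < \<theta>" and t: "0 \<le> t" "t < t'"
    and int: "integrable lborel (\<lambda>x. excess k t x powr \<theta>)"
  shows "(t' - t) powr \<theta> * measure lborel (level k t') \<le> (\<integral>x. excess k t x powr \<theta> \<partial>lborel)"
proof -
  have fin: "emeasure lborel (level k t') < \<infinity>" using t by (intro level_finite) auto
  have "(t' - t) powr \<theta> * measure lborel (level k t') = (\<integral>x. (t' - t) powr \<theta> * indicator (level k t') x \<partial>lborel)"
    by simp
  also have "\<dots> \<le> (\<integral>x. excess k t x powr \<theta> \<partial>lborel)"
  proof (rule integral_mono)
    show "integrable lborel (\<lambda>x. (t' - t) powr \<theta> * indicator (level k t') x)"
      using fin by (intro integrable_mult_right) auto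
    fix x
    show "(t' - t) powr \<theta> * indicator (level k t') x \<le> excess k t x powr \<theta>"
      using t \<theta> by (auto simp: indicator_def level_def excess_def intro!: powr_mono2)
  qed (rule int)
  finally show ?thesis .
qed

text \<open>Markov, Sobolev and Caccioppoli in turn. The exponent \<open>pst / p > 1\<close> makes
  the recursion superlinear, which drives the iteration; \<open>C + 1\<close> stands for
  \<open>C\<close> to keep the constant positive.\<close>

lemma level_recursion:
  assumes k: "0 \<le> k" and t: "0 \<le> t" "t < t'"
  shows "measure lborel (level k t')
     \<le> (sob * 4 powr (p + 1) * (C + 1) * (k / (t' - t)) powr p * measure lborel (level k t)) powr (pst / p)"
proof -
  let ?a = "measure lborel (level k t)"
  have ex: "excess k t \<in> X" by (rule excess_X[OF t(1)])
  have nn: "\<bar>excess k t x\<bar> = excess k t x" for x by (simp add: excess_def)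
  have T: "0 < t' - t" using t by simp
  have "(t' - t) powr pst * measure lborel (level k t') \<le> (\<integral>x. excess k t x powr pst \<partial>lborel)"
    by (rule level_markov[OF pst_pos t]) (use sobolev(1)[OF ex] in \<open>simp add: nn\<close>)
  also have "\<dots> \<le> (sob * energy (excess k t)) powr (pst / p)"
    using sobolev(2)[OF ex] by (simp add: nn)
  also have "\<dots> \<le> (sob * (4 powr (p + 1) * (C + 1) * k powr p * ?a)) powr (pst / p)"
  proof -
    have "energy (excess k t) \<le> 4 powr (p + 1) * C * k powr p * ?a" by (rule caccioppoli[OF k t(1)])
    also have "\<dots> \<le> 4 powr (p + 1) * (C + 1) * k powr p * ?a"
      using C by (intro mult_right_mono mult_left_mono) auto
    finally show ?thesis
      using sob_pos pst_pos p by (intro powr_mono2 mult_left_mono) auto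
  qed
  finally have "(t' - t) powr (- pst) * ((t' - t) powr pst * measure lborel (level k t'))
     \<le> (t' - t) powr (- pst) * (sob * (4 powr (p + 1) * (C + 1) * k powr p * ?a)) powr (pst / p)"
    by (rule mult_left_mono) simp
  also have "(t' - t) powr (- pst) * ((t' - t) powr pst * measure lborel (level k t')) = measure lborel (level k t')"
    using T by (simp add: mult.assoc[symmetric] powr_add[symmetric])
  also have "(t' - t) powr (- pst) = ((t' - t) powr (- p)) powr (pst / p)"
    using p by (simp add: powr_powr)
  also have "((t' - t) powr (- p)) powr (pst / p) * (sob * (4 powr (p + 1) * (C + 1) * k powr p * ?a)) powr (pst / p)
     = ((t' - t) powr (- p) * (sob * (4 powr (p + 1) * (C + 1) * k powr p * ?a))) powr (pst / p)"
    using T sob_pos C k by (simp add: powr_mult)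
  also have "(t' - t) powr (- p) * (sob * (4 powr (p + 1) * (C + 1) * k powr p * ?a))
     = sob * 4 powr (p + 1) * (C + 1) * (k / (t' - t)) powr p * ?a"
    using T k by (simp add: powr_divide powr_minus_divide)
  finally show ?thesis .
qed

text \<open>Where \<open>\<psi> = 1\<close> the conclusion reads \<open>k / 2 \<le> u\<close>. The
  order of choices matters: the smallness threshold \<open>\<nu>\<close> of the iteration does not
  depend on \<open>k\<close>, and \<open>k\<close> is then taken so small that the nonlocal estimate
  brings the starting level set below \<open>\<nu>\<close>.\<close>

lemma eventually_above:
  assumes "\<not> (AE x in lborel. u x = 0)"
  obtains k where "0 < k" "AE x in lborel. k * \<psi> x - u x \<le> k / 2"
proof -
  \<comment> \<open>As \<open>u\<close> is not almost everywhere 0, one of these superlevel sets has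
    positive measure; it is the source of the nonlocal effect.\<close>
  define E where "E n = {x. 1 / real (Suc n) \<le> u x}" for n
  have E_sets: "E n \<in> sets borel" for n unfolding E_def by measurable
  have "\<exists>n. emeasure lborel (E n) \<noteq> 0"
  proof (rule ccontr)
    assume "\<not> ?thesis"
    then have "AE x in lborel. x \<notin> E n" for n
      using E_sets[of n] by (intro AE_not_in) (auto simp: null_sets_def)
    then have "AE x in lborel. \<forall>n. x \<notin> E n" by (simp add: AE_all_countable)
    then have "AE x in lborel. u x = 0"
    proof eventually_elim
      case (elim x)
      show ?case
      proof (rule ccontr)
        assume "u x \<noteq> 0"
        then have "0 < u x" using u_nonneg[of x] by simp
        then obtain n where "inverse (real (Suc n)) < u x" using reals_Archimedean by blast
        then show False using elim by (auto simp: E_def inverse_eq_divide not_le dest!: spec[of _ n])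
      qed
    qed
    then show False using assms by simp
  qed
  then obtain n where n: "emeasure lborel (E n) \<noteq> 0" by blast
  define \<delta> where "\<delta> = 1 / real (Suc n)"
  have \<delta>: "0 < \<delta>" by (simp add: \<delta>_def)
  have E\<delta>: "\<delta> \<le> u y" if "y \<in> E n" for y using that by (simp add: E_def \<delta>_def)
  have "E n \<subseteq> \<Omega>" using E\<delta> \<delta> X_D(2)[OF u] by force
  then have "emeasure lborel (E n) < \<infinity>"
    using emeasure_mono[of "E n" \<Omega> lborel] emeasure_\<Omega> by (simp add: le_less_trans)
  then have mE: "0 < measure lborel (E n)"
    using n by (simp add: measure_def enn2real_positive_iff zero_less_iff_neq_zero)
  obtain b where b: "\<And>x. x \<in> \<Omega> \<Longrightarrow> norm x \<le> b" using bounded_\<Omega> by (auto simp: bounded_iff)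
  define D where "D = 2 * \<bar>b\<bar> + 1"
  \<comment> \<open>\<open>D\<close> exceeds the diameter of \<open>\<Omega>\<close>, so
    \<open>\<kappa>\<close> bounds the kernel from below on pairs of distinct points of
    \<open>\<Omega>\<close>; on the diagonal the kernel is \<open>1 / 0 = 0\<close>.\<close>
  define \<kappa> where "\<kappa> = D powr (- (N + s * p))"
  have D: "0 < D" by (simp add: D_def add_nonneg_pos)
  then have \<kappa>0: "0 < \<kappa>" by (simp add: \<kappa>_def)
  have \<kappa>: "\<kappa> \<le> kernel (x, y)" if "x \<in> \<Omega>" "y \<in> \<Omega>" "x \<noteq> y" for x y
  proof -
    have "norm (x - y) \<le> D" using norm_triangle_ineq4[of x y] b[OF that(1)] b[OF that(2)] by (simp add: D_def)
    then have "\<kappa> \<le> norm (x - y) powr (- (N + s * p))"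
      unfolding \<kappa>_def using that N_pos sp_pos by (intro powr_mono2') auto
    also have "\<dots> = kernel (x, y)" unfolding kernel_def by (simp only: powr_minus_divide fst_conv snd_conv)
    finally show ?thesis .
  qed
  define \<beta> where "\<beta> = pst / p"
  have \<beta>: "1 < \<beta>" using pst_gt p by (simp add: \<beta>_def)
  define A where "A = sob * 4 powr (p + 1) * (C + 1) * 8 powr p"
  have A: "0 < A" using sob_pos C by (simp add: A_def)
  have B: "1 < (2::real) powr p" using p by simp
  obtain \<nu> where \<nu>: "0 < \<nu>" "\<And>a. (\<And>j. 0 \<le> a j) \<Longrightarrow> a 0 \<le> \<nu> \<Longrightarrow> (\<And>j. a (Suc j) \<le> (A * (2 powr p) ^ j * a j) powr \<beta>)
        \<Longrightarrow> (a \<longlonglongrightarrow> (0::real))"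
    using fast_geometric_convergence[OF \<beta> A B] by blast
  define m where "m = measure lborel \<Omega>"
  have m: "0 \<le> m" by (simp add: m_def)
  define W where "W = (\<delta> / 2) powr (p - 1) * (\<kappa> * measure lborel (E n))"
  have W: "0 < W" using \<delta> \<kappa>0 mE by (simp add: W_def)
  define V where "V = 4 * (2 powr (p + 1) * C * m) / W"
  have V: "0 \<le> V" using C m W by (simp add: V_def)
  \<comment> \<open>The nonlocal estimate carries \<open>k powr p\<close> on the right, and Markov's
    inequality at height \<open>k / 4\<close> costs one factor \<open>k\<close>; since
    \<open>p > 1\<close>, a positive power of \<open>k\<close> remains.\<close>
  have small: "measure lborel (level k (k / 4)) \<le> V * k powr (p - 1)" if k: "0 < k" "2 * k \<le> \<delta>" for k
  proof -
    obtain C1 where "integrable lborel (excess k 0)" using X_L1 excess_X[of 0 k] by (metis order_refl)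
    then have i: "integrable lborel (\<lambda>x. excess k 0 x powr 1)" by (simp add: excess_def[abs_def])
    have "(k / 4 - 0) powr 1 * measure lborel (level k (k / 4)) \<le> (\<integral>x. excess k 0 x powr 1 \<partial>lborel)"
      by (rule level_markov[OF _ _ _ i]) (use k in auto)
    then have 1: "k / 4 * measure lborel (level k (k / 4)) \<le> (\<integral>x. excess k 0 x \<partial>lborel)"
      using k by (simp add: excess_def)
    have "W * (\<integral>x. excess k 0 x \<partial>lborel) \<le> 2 powr (p + 1) * C * k powr p * measure lborel (level k 0)"
      unfolding W_def using excess_integral[OF _ k(2) \<delta> E_sets E\<delta> _ \<kappa>] k \<kappa>0 by (simp add: mult.assoc)
    also have "\<dots> \<le> 2 powr (p + 1) * C * k powr p * m"
    proof (rule mult_left_mono)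
      have "\<Omega> \<in> fmeasurable lborel" using emeasure_\<Omega> by (intro fmeasurableI) auto
      then show "measure lborel (level k 0) \<le> m"
        unfolding m_def using level_subset[of 0 k] level_sets by (intro measure_mono_fmeasurable) auto
    qed (use C in auto)
    also have "k powr p = k * k powr (p - 1)" using powr_mult_base[of k "p - 1"] k by simp
    finally have "W * (k / 4 * measure lborel (level k (k / 4))) \<le> 2 powr (p + 1) * C * (k * k powr (p - 1)) * m"
      using mult_left_mono[OF 1, of W] W by linarith
    then have "k * (W * measure lborel (level k (k / 4))) \<le> k * (4 * (2 powr (p + 1) * C * m) * k powr (p - 1))"
      by (simp add: algebra_simps)
    then have "W * measure lborel (level k (k / 4)) \<le> 4 * (2 powr (p + 1) * C * m) * k powr (p - 1)"
      using k by simp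
    then show ?thesis using W by (simp add: V_def field_simps)
  qed
  define k where "k = min (\<delta> / 2) ((\<nu> / (V + 1)) powr (1 / (p - 1)))"
  have k: "0 < k" "2 * k \<le> \<delta>" using \<delta> \<nu>(1) V by (auto simp: k_def)
  have k\<nu>: "V * k powr (p - 1) \<le> \<nu>"
  proof -
    have "k powr (p - 1) \<le> ((\<nu> / (V + 1)) powr (1 / (p - 1))) powr (p - 1)"
      using k p by (intro powr_mono2) (auto simp: k_def)
    also have "\<dots> = \<nu> / (V + 1)" using \<nu>(1) V p by (simp add: powr_powr)
    finally have "V * k powr (p - 1) \<le> V * (\<nu> / (V + 1))" using V by (intro mult_left_mono)
    also have "\<dots> \<le> \<nu>" using V \<nu>(1) by (simp add: field_simps)
    finally show ?thesis .
  qed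
  \<comment> \<open>The levels rise from \<open>k / 4\<close> towards \<open>k / 2\<close> with
    steps proportional to \<open>k\<close>. Hence \<open>k / (t (Suc j) - t j) = 8 * 2 ^ j\<close>,
    and the constants \<open>A\<close> and \<open>2 powr p\<close> of the recursion are free of
    \<open>k\<close>.\<close>
  define t where "t j = k / 2 - k / 4 * (1 / 2) ^ j" for j
  have t_step: "t (Suc j) - t j = k / 8 * (1 / 2) ^ j" for j by (simp add: t_def field_simps)
  have t_range: "k / 4 \<le> t j" "t j < k / 2" for j
  proof -
    have "(1 / 2 :: real) ^ j \<le> 1" by (simp add: power_le_one)
    then have "k * (1 / 2) ^ j \<le> k * 1" using k by (intro mult_left_mono) auto
    then show "k / 4 \<le> t j" by (simp add: t_def)
    show "t j < k / 2" using k by (simp add: t_def)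
  qed
  have lim: "(\<lambda>j. measure lborel (level k (t j))) \<longlonglongrightarrow> 0"
  proof (rule \<nu>(2))
    show "measure lborel (level k (t 0)) \<le> \<nu>" using small[OF k] k\<nu> by (simp add: t_def)
    fix j
    have step: "0 < t (Suc j) - t j" unfolding t_step using k by simp
    have "measure lborel (level k (t (Suc j)))
       \<le> (sob * 4 powr (p + 1) * (C + 1) * (k / (t (Suc j) - t j)) powr p * measure lborel (level k (t j))) powr (pst / p)"
      by (rule level_recursion) (use k t_range[of j] step in auto)
    also have "k / (t (Suc j) - t j) = 8 * 2 ^ j" unfolding t_step using k by (simp add: field_simps)
    also have "(8 * 2 ^ j) powr p = 8 powr p * (2 powr p) ^ j"
      by (simp add: powr_mult powr_realpow[symmetric] powr_powr mult.commute)
    finally show "measure lborel (level k (t (Suc j))) \<le> (A * (2 powr p) ^ j * measure lborel (level k (t j))) powr \<beta>"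
      by (simp add: A_def \<beta>_def mult.assoc)
  qed simp
  have le: "measure lborel (level k (k / 2)) \<le> measure lborel (level k (t j))" for j
  proof (rule measure_mono_fmeasurable)
    show "level k (k / 2) \<subseteq> level k (t j)" using t_range(2)[of j] by (auto simp: level_def)
    show "level k (t j) \<in> fmeasurable lborel"
      using level_finite[of "t j" k] t_range(1)[of j] k by (intro fmeasurableI) auto
  qed simp
  have "measure lborel (level k (k / 2)) \<le> 0" by (rule LIMSEQ_le_const[OF lim]) (use le in auto)
  then have "emeasure lborel (level k (k / 2)) = 0"
    using emeasure_level[of "k / 2" k] k by (simp add: measure_le_0_iff)
  then have "AE x in lborel. x \<notin> level k (k / 2)" by (intro AE_not_in) (auto simp: null_sets_def)
  then have "AE x in lborel. k * \<psi> x - u x \<le> k / 2" by eventually_elim (auto simp: level_def not_less)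
  then show ?thesis using that k by blast
qed

end

text \<open>The distance to the complement, scaled by the separation \<open>d\<close> of
  \<open>K\<close> from it and cut off at 1. It is positive on all of \<open>\<Omega>\<close> and
  not only near \<open>K\<close>, so integrals against it detect every nonnegative datum that is not
  null.\<close>

lemma cutoff_function:
  assumes K: "compact K" "K \<subseteq> \<Omega>"
  shows "\<exists>\<psi> L. \<psi> \<in> X \<and> (\<forall>x. 0 \<le> \<psi> x \<and> \<psi> x \<le> 1) \<and>
    0 \<le> L \<and> (\<forall>x y. \<bar>\<psi> x - \<psi> y\<bar> \<le> L * norm (x - y)) \<and> (\<forall>x\<in>K. \<psi> x = 1) \<and> (\<forall>x\<in>\<Omega>. 0 < \<psi> x)"
proof -
  \<comment> \<open>\<open>infdist\<close> to the empty set is 0 by convention, so the distance is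
    meaningful only because the complement is nonempty.\<close>
  have ne: "- \<Omega> \<noteq> {}" using bounded_\<Omega> not_bounded_UNIV by (metis Compl_UNIV_eq double_complement)
  have "K \<inter> - \<Omega> = {}" using K(2) by blast
  then obtain d where d: "0 < d" "\<And>x y. x \<in> K \<Longrightarrow> y \<in> - \<Omega> \<Longrightarrow> d \<le> dist x y"
    using separate_compact_closed[OF K(1), of "- \<Omega>"] open_\<Omega> by (auto simp: closed_def)
  define \<psi> where "\<psi> x = min 1 (infdist x (- \<Omega>) / d)" for x
  have nn: "0 \<le> \<psi> x" and le1: "\<psi> x \<le> 1" for x using d by (auto simp: \<psi>_def infdist_nonneg)
  have lip: "\<bar>\<psi> x - \<psi> y\<bar> \<le> 1 / d * norm (x - y)" for x y
  proof -
    have "\<bar>infdist x (- \<Omega>) - infdist y (- \<Omega>)\<bar> \<le> norm (x - y)"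
      using infdist_triangle[of x "- \<Omega>" y] infdist_triangle[of y "- \<Omega>" x] by (simp add: dist_norm norm_minus_commute)
    then have "\<bar>infdist x (- \<Omega>) / d - infdist y (- \<Omega>) / d\<bar> \<le> 1 / d * norm (x - y)"
      using d by (simp add: diff_divide_distrib[symmetric] divide_right_mono)
    then show ?thesis by (auto simp: \<psi>_def min_def abs_if split: if_splits)
  qed
  have out: "\<psi> x = 0" if "x \<notin> \<Omega>" for x using that by (simp add: \<psi>_def)
  have one: "\<psi> x = 1" if "x \<in> K" for x
  proof -
    have "d \<le> infdist x (- \<Omega>)" unfolding infdist_notempty[OF ne] using d(2)[OF that] ne by (intro cINF_greatest) auto
    then show ?thesis using d by (simp add: \<psi>_def)
  qed
  have pos: "0 < \<psi> x" if "x \<in> \<Omega>" for x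
  proof -
    have "infdist x (- \<Omega>) \<noteq> 0" using in_closed_iff_infdist_zero[of "- \<Omega>" x] ne open_\<Omega> that by (simp add: closed_def)
    then have "0 < infdist x (- \<Omega>)" using infdist_nonneg[of x "- \<Omega>"] by simp
    then show ?thesis using d by (simp add: \<psi>_def)
  qed
  have [measurable]: "\<psi> \<in> borel_measurable borel"
    unfolding \<psi>_def[abs_def] by (intro borel_measurable_continuous_onI continuous_intros) (use d in auto)
  have "\<psi> \<in> X"
    by (rule X_lipschitz[of \<psi> 1 "1 / d"]) (use nn le1 lip out d in auto)
  then show ?thesis using nn le1 lip one pos d by (intro exI[of _ \<psi>] exI[of _ "1 / d"]) auto
qed

theorem supersolution_lower_bound:
  assumes u: "u \<in> X" and u_nonneg: "\<And>x. 0 \<le> u x"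
    and super: "\<And>\<phi>. \<phi> \<in> X \<Longrightarrow> (\<And>x. 0 \<le> \<phi> x) \<Longrightarrow> 0 \<le> form u \<phi>"
    and nz: "\<not> (AE x in lborel. u x = 0)" and K: "compact K" "K \<subseteq> \<Omega>"
  shows "\<exists>c>0. AE x in lborel. x \<in> K \<longrightarrow> c \<le> u x"
proof -
  obtain \<psi> L where \<psi>: "\<psi> \<in> X" "\<And>x. 0 \<le> \<psi> x" "\<And>x. \<psi> x \<le> 1" "0 \<le> L"
    "\<And>x y. \<bar>\<psi> x - \<psi> y\<bar> \<le> L * norm (x - y)" "\<And>x. x \<in> K \<Longrightarrow> \<psi> x = 1"
    using cutoff_function[OF K] by metis
  have B: "\<bar>\<psi> x\<bar> \<le> 1" for x using \<psi>(2,3) by (simp add: abs_of_nonneg)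
  obtain C where C: "0 \<le> C" "\<And>S. S \<in> sets borel \<Longrightarrow>
       (\<integral>\<^sup>+z. ennreal (\<bar>gap \<psi> z\<bar> powr p) * indicator S (fst z) \<partial>M) \<le> ennreal C * emeasure lborel S"
    "\<And>S. S \<in> sets borel \<Longrightarrow>
       (\<integral>\<^sup>+z. ennreal (\<bar>gap \<psi> z\<bar> powr p) * indicator S (snd z) \<partial>M) \<le> ennreal C * emeasure lborel S"
    using lipschitz_gap_integral[OF X_D(1)[OF \<psi>(1)] B \<psi>(4,5)] by blast
  obtain k where k: "0 < k" "AE x in lborel. k * \<psi> x - u x \<le> k / 2"
    using eventually_above[OF u u_nonneg super \<psi>(1-3) C nz] by blast
  from k(2) have "AE x in lborel. x \<in> K \<longrightarrow> k / 2 \<le> u x"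
    by eventually_elim (use \<psi>(6) in auto)
  then show ?thesis using k(1) by (intro exI[of _ "k / 2"]) auto
qed

end

subsection \<open>Passage to the limit\<close>

text \<open>By monotone convergence the supremum has finite integral, hence is finite almost
  everywhere.\<close>

lemma AE_convergent_of_mono_bounded:
  fixes f :: "nat \<Rightarrow> 'b \<Rightarrow> real"
  assumes int: "\<And>n. integrable M (f n)" and nn: "\<And>n x. 0 \<le> f n x"
    and mono: "\<And>n. AE x in M. f n x \<le> f (Suc n) x" and C: "\<And>n. integral\<^sup>L M (f n) \<le> C"
  shows "AE x in M. convergent (\<lambda>n. f n x)"
proof -
  have [measurable]: "f n \<in> borel_measurable M" for n using int by auto
  have mono': "AE x in M. ennreal (f n x) \<le> ennreal (f (Suc n) x)" for n
    using mono[of n] by eventually_elim (rule ennreal_leI)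
  have "(\<integral>\<^sup>+x. (SUP n. ennreal (f n x)) \<partial>M) = (SUP n. \<integral>\<^sup>+x. ennreal (f n x) \<partial>M)"
    by (rule nn_integral_monotone_convergence_SUP_AE) (use mono' in auto)
  also have "\<dots> \<le> ennreal C"
    using C by (intro SUP_least) (simp add: nn_integral_eq_integral[OF int] nn ennreal_leI)
  finally have "(\<integral>\<^sup>+x. (SUP n. ennreal (f n x)) \<partial>M) \<noteq> \<infinity>" by (auto simp: top_unique)
  then have "AE x in M. (SUP n. ennreal (f n x)) \<noteq> \<infinity>"
    by (intro nn_integral_noteq_infinite) auto
  moreover have "AE x in M. \<forall>n. f n x \<le> f (Suc n) x" using mono by (simp add: AE_all_countable)
  ultimately show ?thesis
  proof eventually_elim
    case (elim x)
    obtain b where b: "(SUP n. ennreal (f n x)) = ennreal b" "0 \<le> b"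
      using elim(1) by (cases "SUP n. ennreal (f n x)") auto
    have le: "f n x \<le> b" for n
      using SUP_upper[of n UNIV "\<lambda>n. ennreal (f n x)"] b by (simp add: ennreal_le_iff)
    have "incseq (\<lambda>n. f n x)" using elim(2) by (auto intro: incseq_SucI)
    then obtain L where "(\<lambda>n. f n x) \<longlonglongrightarrow> L" using incseq_convergent[of "\<lambda>n. f n x" b] le by blast
    then show ?case by (auto simp: convergent_def)
  qed
qed

text \<open>Let \<open>y\<close> be the difference of the fluxes.  Where \<open>y \<le> T * \<bar>b\<bar> powr (p - 1)\<close>, dominated
  convergence applies; elsewhere \<open>y * \<bar>b\<bar>\<close> is at most \<open>T powr (- (1 / (p - 1)))\<close> times an integrand
  bounded in \<open>L\<^sup>1\<close>, which is small for large \<open>T\<close>.\<close>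

lemma pflux_weak_convergence:
  fixes g :: "nat \<Rightarrow> 'b \<Rightarrow> real" and r :: "nat \<Rightarrow> 'b \<Rightarrow> real"
  assumes p: "1 < p"
    and m [measurable]: "\<And>n. g n \<in> borel_measurable M" "l \<in> borel_measurable M" "b \<in> borel_measurable M"
    and b: "integrable M (\<lambda>z. \<bar>b z\<bar> powr p)"
    and lim: "AE z in M. (\<lambda>n. g n z) \<longlonglongrightarrow> l z"
    and r: "\<And>n. integrable M (r n)" "\<And>n. integral\<^sup>L M (r n) \<le> C" "integrable M r'"
    and gr: "\<And>n. AE z in M. b z \<noteq> 0 \<longrightarrow> \<bar>g n z\<bar> powr p \<le> r n z"
    and lr: "AE z in M. b z \<noteq> 0 \<longrightarrow> \<bar>l z\<bar> powr p \<le> r' z"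
    and rnn: "\<And>n z. 0 \<le> r n z" "\<And>z. 0 \<le> r' z"
  shows "integrable M (\<lambda>z. pflux p (l z) * b z)"
    and "(\<lambda>n. \<integral>z. pflux p (g n z) * b z \<partial>M) \<longlonglongrightarrow> (\<integral>z. pflux p (l z) * b z \<partial>M)"
proof -
  have int_gen: "integrable M (\<lambda>z. pflux p (v z) * b z)"
    if [measurable]: "v \<in> borel_measurable M" and R: "integrable M R" and vR: "AE z in M. b z \<noteq> 0 \<longrightarrow> \<bar>v z\<bar> powr p \<le> R z"
      and Rnn: "\<And>z. 0 \<le> R z" for v R
  proof (rule Bochner_Integration.integrable_bound)
    show "integrable M (\<lambda>z. R z + \<bar>b z\<bar> powr p)" using R b by simp
    show "AE z in M. norm (pflux p (v z) * b z) \<le> norm (R z + \<bar>b z\<bar> powr p)"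
      using vR
    proof eventually_elim
      case (elim z)
      show ?case
      proof (cases "b z = 0")
        case False
        have "norm (pflux p (v z) * b z) \<le> \<bar>v z\<bar> powr p + \<bar>b z\<bar> powr p"
          using powr_mult_le_sum[OF p, of "v z" "b z"] by (simp add: abs_mult abs_pflux)
        then show ?thesis using elim False by auto
      qed simp
    qed
  qed measurable
  show int_l: "integrable M (\<lambda>z. pflux p (l z) * b z)" by (rule int_gen[OF _ r(3) lr rnn(2)]) simp
  have int_g: "integrable M (\<lambda>z. pflux p (g n z) * b z)" for n by (rule int_gen[OF _ r(1) gr rnn(1)]) simp
  \<comment> \<open>The conjugate exponent of \<open>p\<close>: the q-th power of the absolute value
    of a flux is the p-th power of its argument.\<close>
  define q where "q = p / (p - 1)"
  have q: "1 < q" "(p - 1) * q = p" "1 + 1 / (p - 1) = q" using p by (auto simp: q_def field_simps)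
  define y where "y n z = \<bar>pflux p (g n z) - pflux p (l z)\<bar>" for n z
  have [measurable]: "y n \<in> borel_measurable M" for n unfolding y_def[abs_def] by measurable
  have y_lim: "AE z in M. (\<lambda>n. y n z) \<longlonglongrightarrow> 0"
    using lim
  proof eventually_elim
    case (elim z)
    have "isCont (pflux p) (l z)" using continuous_pflux[OF p] by (simp add: continuous_on_eq_continuous_at)
    then have "(\<lambda>n. pflux p (g n z)) \<longlonglongrightarrow> pflux p (l z)" by (rule isCont_tendsto_compose[OF _ elim])
    then have "(\<lambda>n. \<bar>pflux p (g n z) - pflux p (l z)\<bar>) \<longlonglongrightarrow> \<bar>pflux p (l z) - pflux p (l z)\<bar>"
      by (intro tendsto_intros)
    then show ?case by (simp add: y_def)
  qed
  have y_q: "y n z powr q \<le> 2 powr q * (\<bar>g n z\<bar> powr p + \<bar>l z\<bar> powr p)" for n z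
    using powr_diff_le[of q "pflux p (g n z)" "pflux p (l z)"] q by (simp add: y_def abs_pflux powr_powr)
  define D where "D = 2 powr q * (\<bar>C\<bar> + integral\<^sup>L M r')"
  have D: "0 \<le> D" using rnn(2) by (simp add: D_def integral_nonneg_AE)
  have split: "y n z * \<bar>b z\<bar> \<le> min (y n z) (T * \<bar>b z\<bar> powr (p - 1)) * \<bar>b z\<bar> + T powr (- (1 / (p - 1))) * y n z powr q"
    if T: "0 < T" for T n z
  proof (cases "y n z \<le> T * \<bar>b z\<bar> powr (p - 1)")
    case False
    have y: "0 \<le> y n z" by (simp add: y_def)
    have "\<bar>b z\<bar> = (\<bar>b z\<bar> powr (p - 1)) powr (1 / (p - 1))" using p by (simp add: powr_powr)
    also have "\<dots> \<le> (y n z / T) powr (1 / (p - 1))"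
      using False T p by (intro powr_mono2) (auto simp: field_simps)
    also have "\<dots> = T powr (- (1 / (p - 1))) * y n z powr (1 / (p - 1))"
      using T y by (simp add: powr_divide powr_minus_divide)
    finally have "y n z * \<bar>b z\<bar> \<le> y n z * (T powr (- (1 / (p - 1))) * y n z powr (1 / (p - 1)))"
      using y by (rule mult_left_mono)
    also have "\<dots> = T powr (- (1 / (p - 1))) * y n z powr q"
      using powr_mult_base[of "y n z" "1 / (p - 1)"] y by (simp add: q(3) mult_ac)
    finally show ?thesis using False T y by (simp add: min_def) (simp add: add_increasing)
  qed (use y_def in auto)
  have split': "AE z in M. y n z * \<bar>b z\<bar> \<le> min (y n z) (T * \<bar>b z\<bar> powr (p - 1)) * \<bar>b z\<bar>
      + T powr (- (1 / (p - 1))) * (2 powr q * (r n z + r' z))" if T: "0 < T" for T n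
    using gr[of n] lr
  proof eventually_elim
    case (elim z)
    show ?case
    proof (cases "b z = 0")
      case False
      have "y n z powr q \<le> 2 powr q * (r n z + r' z)"
        using y_q[of n z] elim False by (intro order_trans[OF y_q] mult_left_mono add_mono) auto
      then have "T powr (- (1 / (p - 1))) * y n z powr q \<le> T powr (- (1 / (p - 1))) * (2 powr q * (r n z + r' z))"
        by (rule mult_left_mono) simp
      then show ?thesis using split[OF T, of n z] by linarith
    qed (use rnn in simp)
  qed
  have int_yb: "integrable M (\<lambda>z. y n z * \<bar>b z\<bar>)" for n
  proof -
    have "integrable M (\<lambda>z. \<bar>pflux p (g n z) * b z - pflux p (l z) * b z\<bar>)"
      using int_g int_l by simp
    then show ?thesis by (simp add: y_def left_diff_distrib[symmetric] abs_mult)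
  qed
  have to0: "(\<lambda>n. \<integral>z. y n z * \<bar>b z\<bar> \<partial>M) \<longlonglongrightarrow> 0"
  proof (rule LIMSEQ_I)
    fix e :: real assume e: "0 < e"
    \<comment> \<open>With this \<open>T\<close> the second part of the splitting contributes at
      most \<open>e / (2 * (D + 1)) * D \<le> e / 2\<close>, uniformly in \<open>n\<close>.\<close>
    define T where "T = (2 * (D + 1) / e) powr (p - 1)"
    have T: "0 < T" using D e by (simp add: T_def)
    have "T powr (- (1 / (p - 1))) = (2 * (D + 1) / e) powr (- 1)"
      using p by (simp add: T_def powr_powr)
    also have "\<dots> = e / (2 * (D + 1))" using D e by (simp add: powr_minus)
    finally have T': "T powr (- (1 / (p - 1))) = e / (2 * (D + 1))" .
    have min_nn: "0 \<le> min (y n z) (T * \<bar>b z\<bar> powr (p - 1))" for n z using T by (simp add: y_def)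
    have int_min: "integrable M (\<lambda>z. min (y n z) (T * \<bar>b z\<bar> powr (p - 1)) * \<bar>b z\<bar>)" for n
    proof (rule Bochner_Integration.integrable_bound[OF int_yb[of n]])
      have "norm (min (y n z) (T * \<bar>b z\<bar> powr (p - 1)) * \<bar>b z\<bar>) \<le> norm (y n z * \<bar>b z\<bar>)" for z
      proof -
        have "norm (min (y n z) (T * \<bar>b z\<bar> powr (p - 1))) \<le> norm (y n z)" using min_nn[of n z] by simp
        then show ?thesis unfolding norm_mult by (rule mult_right_mono) simp
      qed
      then show "AE z in M. norm (min (y n z) (T * \<bar>b z\<bar> powr (p - 1)) * \<bar>b z\<bar>) \<le> norm (y n z * \<bar>b z\<bar>)" by simp
    qed measurable
    have lim_min: "(\<lambda>n. \<integral>z. min (y n z) (T * \<bar>b z\<bar> powr (p - 1)) * \<bar>b z\<bar> \<partial>M) \<longlonglongrightarrow> (\<integral>z. 0 \<partial>M)"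
    proof (rule integral_dominated_convergence)
      show "integrable M (\<lambda>z. T * \<bar>b z\<bar> powr p)" using b by simp
      show "AE z in M. (\<lambda>n. min (y n z) (T * \<bar>b z\<bar> powr (p - 1)) * \<bar>b z\<bar>) \<longlonglongrightarrow> 0"
        using y_lim
      proof eventually_elim
        case (elim z)
        have "(\<lambda>n. min (y n z) (T * \<bar>b z\<bar> powr (p - 1)) * \<bar>b z\<bar>) \<longlonglongrightarrow> min 0 (T * \<bar>b z\<bar> powr (p - 1)) * \<bar>b z\<bar>"
          by (intro tendsto_intros elim)
        then show ?case using T by simp
      qed
      show "AE z in M. norm (min (y n z) (T * \<bar>b z\<bar> powr (p - 1)) * \<bar>b z\<bar>) \<le> T * \<bar>b z\<bar> powr p" for n
      proof (rule AE_I2)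
        fix z
        have "norm (min (y n z) (T * \<bar>b z\<bar> powr (p - 1)) * \<bar>b z\<bar>) = min (y n z) (T * \<bar>b z\<bar> powr (p - 1)) * \<bar>b z\<bar>"
          using T by (simp add: y_def)
        also have "\<dots> \<le> (T * \<bar>b z\<bar> powr (p - 1)) * \<bar>b z\<bar>" by (intro mult_right_mono) auto
        also have "\<dots> = T * \<bar>b z\<bar> powr p" using powr_mult_base[of "\<bar>b z\<bar>" "p - 1"] by (simp add: mult_ac)
        finally show "norm (min (y n z) (T * \<bar>b z\<bar> powr (p - 1)) * \<bar>b z\<bar>) \<le> T * \<bar>b z\<bar> powr p" .
      qed
    qed measurable
    then obtain n0 where n0: "\<And>n. n0 \<le> n \<Longrightarrow> norm ((\<integral>z. min (y n z) (T * \<bar>b z\<bar> powr (p - 1)) * \<bar>b z\<bar> \<partial>M) - 0) < e / 2"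
      using LIMSEQ_D[OF lim_min, of "e / 2"] e by auto
    have "norm ((\<integral>z. y n z * \<bar>b z\<bar> \<partial>M) - 0) < e" if n: "n0 \<le> n" for n
    proof -
      have "(\<integral>z. y n z * \<bar>b z\<bar> \<partial>M) \<le> (\<integral>z. min (y n z) (T * \<bar>b z\<bar> powr (p - 1)) * \<bar>b z\<bar>
         + T powr (- (1 / (p - 1))) * (2 powr q * (r n z + r' z)) \<partial>M)"
        by (rule integral_mono_AE[OF int_yb _ split'[OF T]]) (use int_min r in auto)
      also have "\<dots> = (\<integral>z. min (y n z) (T * \<bar>b z\<bar> powr (p - 1)) * \<bar>b z\<bar> \<partial>M)
         + T powr (- (1 / (p - 1))) * (2 powr q * (integral\<^sup>L M (r n) + integral\<^sup>L M r'))"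
        using int_min r by simp
      also have "\<dots> < e / 2 + e / 2"
      proof (rule add_less_le_mono)
        show "(\<integral>z. min (y n z) (T * \<bar>b z\<bar> powr (p - 1)) * \<bar>b z\<bar> \<partial>M) < e / 2" using n0[OF n] by auto
        have "2 powr q * (integral\<^sup>L M (r n) + integral\<^sup>L M r') \<le> D"
          unfolding D_def using r(2)[of n] by (intro mult_left_mono) auto
        then have "T powr (- (1 / (p - 1))) * (2 powr q * (integral\<^sup>L M (r n) + integral\<^sup>L M r')) \<le> e / (2 * (D + 1)) * D"
          unfolding T' using D e by (intro mult_left_mono) auto
        also have "\<dots> \<le> e / 2" using D e by (simp add: field_simps)
        finally show "T powr (- (1 / (p - 1))) * (2 powr q * (integral\<^sup>L M (r n) + integral\<^sup>L M r')) \<le> e / 2" .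
      qed
      finally show ?thesis by (simp add: y_def integral_nonneg_AE)
    qed
    then show "\<exists>n0. \<forall>n\<ge>n0. norm ((\<integral>z. y n z * \<bar>b z\<bar> \<partial>M) - 0) < e" by blast
  qed
  show "(\<lambda>n. \<integral>z. pflux p (g n z) * b z \<partial>M) \<longlonglongrightarrow> (\<integral>z. pflux p (l z) * b z \<partial>M)"
  proof (rule Lim_transform_bound[THEN LIM_zero_cancel, OF _ to0])
    show "\<forall>\<^sub>F n in sequentially. norm ((\<integral>z. pflux p (g n z) * b z \<partial>M) - (\<integral>z. pflux p (l z) * b z \<partial>M))
        \<le> norm (\<integral>z. y n z * \<bar>b z\<bar> \<partial>M)"
    proof (rule always_eventually, rule allI)
      fix n
      have "norm ((\<integral>z. pflux p (g n z) * b z \<partial>M) - (\<integral>z. pflux p (l z) * b z \<partial>M))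
         = \<bar>\<integral>z. pflux p (g n z) * b z - pflux p (l z) * b z \<partial>M\<bar>" using int_g int_l by simp
      also have "\<dots> \<le> (\<integral>z. \<bar>pflux p (g n z) * b z - pflux p (l z) * b z\<bar> \<partial>M)" by (rule integral_abs_bound)
      also have "\<dots> = (\<integral>z. y n z * \<bar>b z\<bar> \<partial>M)"
        by (simp add: y_def left_diff_distrib[symmetric] abs_mult)
      finally show "norm ((\<integral>z. pflux p (g n z) * b z \<partial>M) - (\<integral>z. pflux p (l z) * b z \<partial>M))
        \<le> norm (\<integral>z. y n z * \<bar>b z\<bar> \<partial>M)" by simp
    qed
  qed
qed

text \<open>Truncation bounds the slope of the power by its value at \<open>T\<close>; this is what
  makes powers of the solutions admissible as test functions.\<close>

lemma truncated_power_lipschitz: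
  fixes a b T \<theta> :: real
  assumes \<theta>: "1 \<le> \<theta>" and ab: "0 \<le> a" "0 \<le> b" and T: "0 \<le> T"
  shows "\<bar>min a T powr \<theta> - min b T powr \<theta>\<bar> \<le> (\<theta> * T powr (\<theta> - 1)) * \<bar>a - b\<bar>"
proof -
  have *: "\<bar>min a T powr \<theta> - min b T powr \<theta>\<bar> \<le> (\<theta> * T powr (\<theta> - 1)) * \<bar>a - b\<bar>"
    if "b \<le> a" "0 \<le> b" for a b
  proof -
    let ?A = "min a T" and ?B = "min b T"
    have AB: "0 \<le> ?B" "?B \<le> ?A" using that T by auto
    have "\<bar>?A powr \<theta> - ?B powr \<theta>\<bar> = ?A powr \<theta> - ?B powr \<theta>"
      using powr_mono2[OF _ AB] \<theta> by simp
    also have "\<dots> \<le> \<theta> * ?A powr (\<theta> - 1) * (?A - ?B)" by (rule powr_diff_upper[OF \<theta> AB])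
    also have "\<dots> \<le> \<theta> * T powr (\<theta> - 1) * \<bar>a - b\<bar>"
      using AB \<theta> T that by (intro mult_mono powr_mono2 mult_left_mono) auto
    finally show ?thesis .
  qed
  show ?thesis
    using *[of b a] *[of a b] ab by (cases "b \<le> a") (auto simp: abs_minus_commute)
qed

section \<open>Powers and weighted integrals of functions in the energy space\<close>

context frac_space
begin

lemma truncated_power_X:
  assumes u: "u \<in> X" and nn: "\<And>x. 0 \<le> u x" and T: "0 \<le> T" and \<theta>: "1 \<le> \<theta>"
  shows "(\<lambda>x. min (u x) T powr \<theta>) \<in> X"
proof -
  have "(\<lambda>x. (\<lambda>t. min t T powr \<theta>) (u x)) \<in> X"
  proof (rule X_lipschitz_comp(1)[OF u])
    show "\<bar>min (u x) T powr \<theta> - min (u y) T powr \<theta>\<bar> \<le> (\<theta> * T powr (\<theta> - 1)) * \<bar>u x - u y\<bar>" for x y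
      by (rule truncated_power_lipschitz[OF \<theta> nn nn T])
  qed (use T \<theta> in auto)
  then show ?thesis by simp
qed

text \<open>In general the power is not a Lipschitz function of \<open>u\<close>, so its membership
  in \<open>X\<close> comes from the energy bound uniform in \<open>T\<close> and Fatou's
  lemma.\<close>

lemma power_untruncated:
  assumes u: "u \<in> X" and nn: "\<And>x. 0 \<le> u x" and \<theta>: "1 \<le> \<theta>"
    and E: "\<And>T. 0 < T \<Longrightarrow> energy (\<lambda>x. min (u x) T powr \<theta>) \<le> C"
  shows "(\<lambda>x. u x powr \<theta>) \<in> X" "energy (\<lambda>x. u x powr \<theta>) \<le> C"
proof -
  note [measurable] = X_D(1)[OF u]
  let ?v = "\<lambda>n x. min (u x) (real (Suc n)) powr \<theta>"
  have v: "?v n \<in> X" for n using truncated_power_X[OF u nn _ \<theta>, of "real (Suc n)"] by simp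
  have lim: "AE z in M. (\<lambda>n. \<bar>gap (?v n) z\<bar> powr p) \<longlonglongrightarrow> \<bar>gap (\<lambda>x. u x powr \<theta>) z\<bar> powr p"
  proof (rule AE_I2)
    fix z
    obtain n0 where n0: "max (u (fst z)) (u (snd z)) < real n0" using reals_Archimedean2 by blast
    show "(\<lambda>n. \<bar>gap (?v n) z\<bar> powr p) \<longlonglongrightarrow> \<bar>gap (\<lambda>x. u x powr \<theta>) z\<bar> powr p"
    proof (rule tendsto_eventually, rule eventually_sequentiallyI)
      fix n assume "n0 \<le> n"
      then have "u (fst z) \<le> real (Suc n)" "u (snd z) \<le> real (Suc n)" using n0 by auto
      then show "\<bar>gap (?v n) z\<bar> powr p = \<bar>gap (\<lambda>x. u x powr \<theta>) z\<bar> powr p" by (simp add: min_absorb1)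
    qed
  qed
  have E': "(\<integral>z. \<bar>gap (?v n) z\<bar> powr p \<partial>M) \<le> C" for n
    using E[of "real (Suc n)"] by (simp add: energy_def)
  have m: "(\<lambda>z. \<bar>gap (?v n) z\<bar> powr p) \<in> borel_measurable M" for n using X_D(3)[OF v] by blast
  have m': "(\<lambda>z. \<bar>gap (\<lambda>x. u x powr \<theta>) z\<bar> powr p) \<in> borel_measurable M" by measurable
  note * = integrable_AE_limit[OF m m' _ X_D(3)[OF v] E' lim]
  have i: "integrable M (\<lambda>z. \<bar>gap (\<lambda>x. u x powr \<theta>) z\<bar> powr p)" by (rule *(1)) simp
  show "(\<lambda>x. u x powr \<theta>) \<in> X"
    unfolding X_def mem_Collect_eq
  proof (intro conjI allI impI i)
    show "(\<lambda>x. u x powr \<theta>) \<in> borel_measurable borel" by measurable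
    fix x assume "x \<notin> \<Omega>"
    then show "u x powr \<theta> = 0" by (simp add: X_D(2)[OF u])
  qed
  show "energy (\<lambda>x. u x powr \<theta>) \<le> C" unfolding energy_def by (rule *(2)) simp
qed

text \<open>In substance Hoelder's inequality with the exponents
  \<open>1 / (1 - \<alpha> / pst)\<close> and \<open>pst / \<alpha>\<close>, followed by Sobolev's.
  It is carried out as Young's inequality with a weight \<open>\<mu>\<close>; the choice
  \<open>\<mu> = (sob * energy v) powr (\<alpha> / p)\<close> normalises the Sobolev term to at most
  1.\<close>

lemma sobolev_hoelder:
  assumes f [measurable]: "f \<in> borel_measurable borel" and f_nn: "\<And>x. 0 \<le> f x"
    and \<alpha>: "0 < \<alpha>" "\<alpha> < pst" and fm: "integrable lborel (\<lambda>x. f x powr (1 / (1 - \<alpha> / pst)))"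
  shows "\<exists>C\<ge>0. \<forall>v\<in>X. (\<forall>x. 0 \<le> v x) \<longrightarrow> integrable lborel (\<lambda>x. f x * v x powr \<alpha>) \<and>
      (\<integral>x. f x * v x powr \<alpha> \<partial>lborel) \<le> C * energy v powr (\<alpha> / p)"
proof -
  define m where "m = 1 / (1 - \<alpha> / pst)"
  define m' where "m' = pst / \<alpha>"
  have mm: "1 < m" "1 < m'" "1 / m + 1 / m' = 1"
    using \<alpha> by (auto simp: m_def m'_def field_simps)
  define G where "G = (\<integral>x. f x powr m \<partial>lborel)"
  have G: "0 \<le> G" by (simp add: G_def)
  have fm': "integrable lborel (\<lambda>x. f x powr m)" using fm by (simp add: m_def)
  define C where "C = sob powr (\<alpha> / p) * (G + 1)"
  have C: "0 \<le> C" using G by (simp add: C_def)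
  have "integrable lborel (\<lambda>x. f x * v x powr \<alpha>) \<and> (\<integral>x. f x * v x powr \<alpha> \<partial>lborel) \<le> C * energy v powr (\<alpha> / p)"
    if v: "v \<in> X" and v_nn: "\<And>x. 0 \<le> v x" for v
  proof -
    note [measurable] = X_D(1)[OF v]
    define A where "A = (\<integral>x. v x powr pst \<partial>lborel)"
    have iv: "integrable lborel (\<lambda>x. v x powr pst)" using sobolev(1)[OF v] v_nn by simp
    have pw: "f x * v x powr \<alpha> \<le> \<mu> * (f x powr m + \<mu> powr (- m') * v x powr pst)" if \<mu>: "0 < \<mu>" for x \<mu>
    proof -
      have "f x * (v x powr \<alpha> / \<mu>) \<le> f x powr m / m + (v x powr \<alpha> / \<mu>) powr m' / m'"
        by (rule Youngs_inequality) (use mm f_nn \<mu> in auto)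
      also have "\<dots> \<le> f x powr m + (v x powr \<alpha> / \<mu>) powr m'"
        using mm by (intro add_mono) (auto simp: divide_le_eq mult_le_cancel_left1)
      also have "(v x powr \<alpha> / \<mu>) powr m' = \<mu> powr (- m') * v x powr pst"
        using \<mu> \<alpha> by (simp add: powr_divide powr_powr m'_def powr_minus_divide)
      finally have "\<mu> * (f x * (v x powr \<alpha> / \<mu>)) \<le> \<mu> * (f x powr m + \<mu> powr (- m') * v x powr pst)"
        using \<mu> by (intro mult_left_mono) auto
      then show ?thesis using \<mu> by simp
    qed
    have ir: "integrable lborel (\<lambda>x. \<mu> * (f x powr m + \<mu> powr (- m') * v x powr pst))" for \<mu>
      using fm' iv by simp
    have int: "integrable lborel (\<lambda>x. f x * v x powr \<alpha>)"
      by (rule Bochner_Integration.integrable_bound[OF ir[of 1]]) (use pw[of 1] f_nn in auto)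
    have "(\<integral>x. f x * v x powr \<alpha> \<partial>lborel) \<le> C * energy v powr (\<alpha> / p)"
    proof (cases "energy v = 0")
      case True
      then have "AE x in lborel. v x = 0" by (intro energy_zero_imp_AE_zero v) simp
      then have "AE x in lborel. f x * v x powr \<alpha> = 0" by eventually_elim simp
      then have "(\<integral>x. f x * v x powr \<alpha> \<partial>lborel) = 0" by (rule integral_eq_zero_AE)
      then show ?thesis using C by simp
    next
      case False
      then have E: "0 < sob * energy v" using sob_pos by (simp add: order_less_le)
      define \<mu> where "\<mu> = (sob * energy v) powr (\<alpha> / p)"
      have \<mu>: "0 < \<mu>" using E by (auto simp: \<mu>_def)
      have "A \<le> (sob * energy v) powr (pst / p)" using sobolev(2)[OF v] v_nn by (simp add: A_def)
      also have "\<dots> = \<mu> powr m'" using \<alpha> by (simp add: \<mu>_def powr_powr m'_def)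
      finally have "\<mu> powr (- m') * A \<le> \<mu> powr (- m') * \<mu> powr m'" by (rule mult_left_mono) simp
      also have "\<dots> = 1" using \<mu> by (simp add: powr_add[symmetric])
      finally have A: "\<mu> powr (- m') * A \<le> 1" .
      have "(\<integral>x. f x * v x powr \<alpha> \<partial>lborel) \<le> (\<integral>x. \<mu> * (f x powr m + \<mu> powr (- m') * v x powr pst) \<partial>lborel)"
        by (rule integral_mono[OF int ir]) (rule pw[OF \<mu>])
      also have "\<dots> = \<mu> * (G + \<mu> powr (- m') * A)" using fm' iv by (simp add: G_def A_def)
      also have "\<dots> \<le> \<mu> * (G + 1)" using A \<mu> by (intro mult_left_mono) auto
      also have "\<dots> = C * energy v powr (\<alpha> / p)" using sob_pos by (simp add: \<mu>_def C_def powr_mult)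
      finally show ?thesis .
    qed
    with int show ?thesis by simp
  qed
  then show ?thesis using C by blast
qed

end

subsection \<open>The approximation scheme\<close>

text \<open>In the case \<open>\<gamma> < 1\<close> the exponent of integrability of the datum is the dual of
  \<open>pst / (1 - \<gamma>)\<close>, where \<open>pst\<close> is the Sobolev exponent.\<close>

locale singular_problem = frac_space p s N \<Omega>
  for p s N :: real and \<Omega> :: "'a::euclidean_space set" +
  fixes f :: "'a \<Rightarrow> real" and \<gamma> :: real
  assumes f_meas [measurable]: "f \<in> borel_measurable borel"
    and f_nonneg: "\<And>x. 0 \<le> f x" and f_out: "\<And>x. x \<notin> \<Omega> \<Longrightarrow> f x = 0"
    and f_int: "integrable lborel f" and f_nonzero: "\<not> (AE x in lborel. f x = 0)"
    and \<gamma>_pos: "0 < \<gamma>"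
    and growth: "\<gamma> < 1 \<Longrightarrow> integrable lborel (\<lambda>x. f x powr (1 / (1 - (1 - \<gamma>) / pst)))"
begin

definition rhs :: "nat \<Rightarrow> 'a \<Rightarrow> real" where
  "rhs n x = min (f x) (real (Suc n))"

text \<open>The shift to \<open>Suc n\<close> admits the index 0, so \<open>u 0\<close> below is the
  function \<open>u\<^sub>1\<close> of the overview. The positive part makes the nonlinearity
  continuous, bounded and antitone on the whole line.\<close>

definition sing :: "nat \<Rightarrow> real \<Rightarrow> real" where
  "sing n t = (max 0 t + 1 / real (Suc n)) powr (- \<gamma>)"

lemma approx: "bounded_rhs p s N \<Omega> (rhs n) (sing n) (real (Suc n)) ((1 / real (Suc n)) powr (- \<gamma>))"
proof unfold_locales
  show "rhs n \<in> borel_measurable borel" unfolding rhs_def[abs_def] by measurable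
  show "0 \<le> rhs n x" "rhs n x \<le> real (Suc n)" for x using f_nonneg[of x] by (auto simp: rhs_def)
  have pos: "0 < max 0 t + 1 / real (Suc n)" for t :: real by (intro add_nonneg_pos) auto
  show "continuous_on UNIV (sing n)"
    unfolding sing_def[abs_def] using pos by (intro continuous_on_powr continuous_intros) (auto simp: less_imp_neq[THEN not_sym])
  show "antimono (sing n)"
  proof (rule antimonoI)
    fix x y :: real assume "x \<le> y"
    then show "sing n y \<le> sing n x"
      unfolding sing_def using \<gamma>_pos pos by (intro powr_mono2') auto
  qed
  show "0 \<le> sing n t" for t by (simp add: sing_def)
  show "sing n t \<le> (1 / real (Suc n)) powr (- \<gamma>)" for t
    unfolding sing_def using \<gamma>_pos by (intro powr_mono2') auto
qed

definition u :: "nat \<Rightarrow> 'a \<Rightarrow> real" where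
  "u n = (SOME v. v \<in> X \<and> (\<forall>x. 0 \<le> v x) \<and>
     (\<forall>\<phi>\<in>X. form v \<phi> = (\<integral>x. rhs n x * sing n (v x) * \<phi> x \<partial>lborel)))"

lemma u_props: "u n \<in> X \<and> (\<forall>x. 0 \<le> u n x) \<and>
     (\<forall>\<phi>\<in>X. form (u n) \<phi> = (\<integral>x. rhs n x * sing n (u n x) * \<phi> x \<partial>lborel))"
proof -
  interpret bounded_rhs p s N \<Omega> "rhs n" "sing n" "real (Suc n)" "(1 / real (Suc n)) powr (- \<gamma>)"
    by (rule approx)
  have "\<exists>v. v \<in> X \<and> (\<forall>x. 0 \<le> v x) \<and>
     (\<forall>\<phi>\<in>X. form v \<phi> = (\<integral>x. rhs n x * sing n (v x) * \<phi> x \<partial>lborel))"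
    by (rule nonneg_weak_solution) blast
  then show ?thesis unfolding u_def by (rule someI_ex)
qed

lemma u_X: "u n \<in> X" and u_nonneg: "0 \<le> u n x"
  and u_eq: "\<phi> \<in> X \<Longrightarrow> form (u n) \<phi> = (\<integral>x. rhs n x * sing n (u n x) * \<phi> x \<partial>lborel)"
  using u_props[of n] by auto

lemma measurable_u [measurable]: "u n \<in> borel_measurable borel"
  by (rule X_D(1)[OF u_X])

lemma measurable_rhs [measurable]: "rhs n \<in> borel_measurable borel"
  unfolding rhs_def[abs_def] by measurable

lemma measurable_sing [measurable]: "sing n \<in> borel_measurable borel"
  unfolding sing_def[abs_def] by measurable

lemma rhs_nonneg: "0 \<le> rhs n x" and rhs_le: "rhs n x \<le> f x"
  using f_nonneg[of x] by (auto simp: rhs_def)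

lemma sing_nonneg: "0 \<le> sing n t"
  by (simp add: sing_def)

lemma u_rhs_integrable: "\<phi> \<in> X \<Longrightarrow> integrable lborel (\<lambda>x. rhs n x * sing n (u n x) * \<phi> x)"
proof -
  interpret bounded_rhs p s N \<Omega> "rhs n" "sing n" "real (Suc n)" "(1 / real (Suc n)) powr (- \<gamma>)"
    by (rule approx)
  show "\<phi> \<in> X \<Longrightarrow> integrable lborel (\<lambda>x. rhs n x * sing n (u n x) * \<phi> x)" by (rule rhs_integrable) auto
qed

text \<open>Where \<open>u n\<close> exceeds \<open>u (Suc n)\<close>, both the argument and the
  shift are larger in the singular factor with index \<open>n\<close>, so that factor is the smaller
  one, and the truncated datum is no larger either; comparison applies.\<close>

lemma u_mono: "AE x in lborel. u n x \<le> u (Suc n) x"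
proof (rule comparison[OF u_X u_X])
  let ?\<phi> = "\<lambda>x. max 0 (u n x - u (Suc n) x)"
  have \<phi>: "?\<phi> \<in> X" using X_pos_part[OF X_diff[OF u_X u_X]] by simp
  have "form (u n) ?\<phi> = (\<integral>x. rhs n x * sing n (u n x) * ?\<phi> x \<partial>lborel)" by (rule u_eq[OF \<phi>])
  also have "\<dots> \<le> (\<integral>x. rhs (Suc n) x * sing (Suc n) (u (Suc n) x) * ?\<phi> x \<partial>lborel)"
  proof (rule integral_mono[OF u_rhs_integrable[OF \<phi>] u_rhs_integrable[OF \<phi>]])
    fix x
    show "rhs n x * sing n (u n x) * ?\<phi> x \<le> rhs (Suc n) x * sing (Suc n) (u (Suc n) x) * ?\<phi> x"
    proof (cases "u (Suc n) x < u n x")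
      case True
      have "1 / real (Suc (Suc n)) \<le> 1 / real (Suc n)" by (intro divide_left_mono) auto
      then have "sing n (u n x) \<le> sing (Suc n) (u (Suc n) x)"
        unfolding sing_def using True \<gamma>_pos u_nonneg[of "Suc n" x]
        by (intro powr_mono2') (auto intro!: add_nonneg_pos)
      moreover have "rhs n x \<le> rhs (Suc n) x" by (auto simp: rhs_def)
      ultimately show ?thesis
        by (intro mult_right_mono mult_mono) (auto simp: rhs_nonneg sing_nonneg)
    qed simp
  qed
  also have "\<dots> = form (u (Suc n)) ?\<phi>" by (rule u_eq[OF \<phi>, symmetric])
  finally show "form (u n) ?\<phi> \<le> form (u (Suc n)) ?\<phi>" .
qed

text \<open>If \<open>u 0\<close> vanished, testing with a function positive on all of
  \<open>\<Omega>\<close> would force the truncated datum, and with it \<open>f\<close>, to vanish,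
  because the regularised singular factor is strictly positive.\<close>

lemma u_0_nonzero: "\<not> (AE x in lborel. u 0 x = 0)"
proof
  assume ae: "AE x in lborel. u 0 x = 0"
  obtain \<psi> where \<psi>: "\<psi> \<in> X" "\<And>x. 0 \<le> \<psi> x" "\<And>x. x \<in> \<Omega> \<Longrightarrow> 0 < \<psi> x"
    using cutoff_function[of "{}"] by auto
  note [measurable] = X_D(1)[OF \<psi>(1)]
  have "form (\<lambda>x. 0) \<psi> = form (u 0) \<psi>" by (rule X_AE_cong(3)[OF u_X _ _ ae \<psi>(1)]) auto
  then have "(\<integral>x. rhs 0 x * sing 0 (u 0 x) * \<psi> x \<partial>lborel) = 0"
    using u_eq[OF \<psi>(1), of 0] by (simp add: form_def)
  then have "AE x in lborel. rhs 0 x * sing 0 (u 0 x) * \<psi> x = 0"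
    using u_rhs_integrable[OF \<psi>(1), of 0]
    by (subst (asm) integral_nonneg_eq_0_iff_AE) (auto simp: rhs_nonneg sing_nonneg \<psi>(2))
  then have "AE x in lborel. f x = 0"
  proof eventually_elim
    case (elim x)
    show ?case
    proof (cases "x \<in> \<Omega>")
      case True
      have "0 < max 0 (u 0 x) + 1 / real (Suc 0)" by simp
      then have "sing 0 (u 0 x) \<noteq> 0" by (simp add: sing_def)
      then have "rhs 0 x = 0" using elim \<psi>(3)[OF True] by auto
      then show ?thesis by (auto simp: rhs_def min_def split: if_splits)
    qed (rule f_out)
  qed
  then show False using f_nonzero by simp
qed

text \<open>Only the first approximation is treated as a supersolution; monotonicity carries its
  bound to all \<open>n\<close> with the same constant.\<close>

lemma u_lower_bound:
  assumes K: "compact K" "K \<subseteq> \<Omega>"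
  shows "\<exists>c>0. AE x in lborel. x \<in> K \<longrightarrow> (\<forall>n. c \<le> u n x)"
proof -
  have super: "0 \<le> form (u 0) \<phi>" if "\<phi> \<in> X" "\<And>x. 0 \<le> \<phi> x" for \<phi>
    unfolding u_eq[OF that(1)] using that(2)
    by (intro integral_nonneg_AE) (auto simp: rhs_nonneg sing_nonneg)
  obtain c where c: "0 < c" "AE x in lborel. x \<in> K \<longrightarrow> c \<le> u 0 x"
    using supersolution_lower_bound[OF u_X u_nonneg super u_0_nonzero K] by blast
  have "AE x in lborel. \<forall>n. u n x \<le> u (Suc n) x" using u_mono by (simp add: AE_all_countable)
  with c(2) have "AE x in lborel. x \<in> K \<longrightarrow> (\<forall>n. c \<le> u n x)"
  proof eventually_elim
    case (elim x)
    have "u 0 x \<le> u n x" for n by (rule lift_Suc_mono_le[of "\<lambda>n. u n x"]) (use elim in auto)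
    then show ?case using elim(1) order_trans by blast
  qed
  then show ?thesis using c(1) by blast
qed

text \<open>For \<open>\<gamma> < 1\<close> the power \<open>t powr \<gamma>\<close> is not
  Lipschitz at 0, so testing with it could leave \<open>X\<close>; the exponent 1 is used instead,
  and then \<open>q = 1\<close>.\<close>

definition gm :: real where "gm = max \<gamma> 1"

definition q :: real where "q = (gm + p - 1) / p"

lemma gm_ge: "1 \<le> gm" "\<gamma> \<le> gm"
  by (auto simp: gm_def)

lemma q_ge: "1 \<le> q"
  using gm_ge p by (simp add: q_def field_simps)

lemma test_with_power:
  assumes T: "0 < T"
  shows "integrable lborel (\<lambda>x. f x * min (u n x) T powr (gm - \<gamma>))"
    and "energy (\<lambda>x. min (u n x) T powr q) \<le> q powr p * (\<integral>x. f x * min (u n x) T powr (gm - \<gamma>) \<partial>lborel)"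
proof -
  let ?\<phi> = "\<lambda>x. min (u n x) T powr gm" and ?v = "\<lambda>x. min (u n x) T powr q"
  have \<phi>: "?\<phi> \<in> X" by (rule truncated_power_X[OF u_X u_nonneg _ gm_ge(1)]) (use T in simp)
  have v: "?v \<in> X" by (rule truncated_power_X[OF u_X u_nonneg _ q_ge]) (use T in simp)
  show int: "integrable lborel (\<lambda>x. f x * min (u n x) T powr (gm - \<gamma>))"
  proof (rule Bochner_Integration.integrable_bound)
    show "integrable lborel (\<lambda>x. f x * T powr (gm - \<gamma>))" using f_int by simp
    have "min (u n x) T powr (gm - \<gamma>) \<le> T powr (gm - \<gamma>)" for x
      using gm_ge u_nonneg[of n x] T by (intro powr_mono2) auto
    then show "AE x in lborel. norm (f x * min (u n x) T powr (gm - \<gamma>)) \<le> norm (f x * T powr (gm - \<gamma>))"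
      using f_nonneg by (intro AE_I2) (simp add: abs_mult mult_left_mono)
  qed measurable
  have "energy ?v \<le> (\<integral>z. q powr p * (pflux p (gap (u n) z) * gap ?\<phi> z) \<partial>M)"
    unfolding energy_def
  proof (rule integral_mono[OF X_D(3)[OF v]])
    show "integrable M (\<lambda>z. q powr p * (pflux p (gap (u n) z) * gap ?\<phi> z))"
      using form_integrable[OF u_X \<phi>] by simp
    show "\<bar>gap ?v z\<bar> powr p \<le> q powr p * (pflux p (gap (u n) z) * gap ?\<phi> z)" for z
      unfolding q_def by (rule pflux_test_power[OF p gm_ge(1) _ u_nonneg u_nonneg]) (use T in simp)
  qed
  also have "\<dots> = q powr p * form (u n) ?\<phi>" by (simp add: form_def)
  also have "\<dots> \<le> q powr p * (\<integral>x. f x * min (u n x) T powr (gm - \<gamma>) \<partial>lborel)"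
    unfolding u_eq[OF \<phi>]
  proof (intro mult_left_mono, rule integral_mono[OF u_rhs_integrable[OF \<phi>] int])
    fix x
    \<comment> \<open>The test function gives up \<gamma> of its powers to the singular factor,
      which is at most \<open>min (u n x) T powr (- \<gamma>)\<close> for positive
      \<open>u n x\<close>; at zeros of \<open>u n\<close> the test function vanishes.\<close>
    have "sing n (u n x) * ?\<phi> x \<le> min (u n x) T powr (gm - \<gamma>)"
    proof (cases "u n x = 0")
      case False
      then have m: "0 < min (u n x) T" using T u_nonneg[of n x] by auto
      have "sing n (u n x) \<le> min (u n x) T powr (- \<gamma>)"
        unfolding sing_def using m \<gamma>_pos u_nonneg[of n x] by (intro powr_mono2') (auto simp: add_increasing2)
      then have "sing n (u n x) * ?\<phi> x \<le> min (u n x) T powr (- \<gamma>) * ?\<phi> x" by (rule mult_right_mono) simp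
      also have "\<dots> = min (u n x) T powr (gm - \<gamma>)" by (simp add: powr_add[symmetric])
      finally show ?thesis .
    qed (use T gm_ge in simp)
    then have "rhs n x * (sing n (u n x) * ?\<phi> x) \<le> f x * min (u n x) T powr (gm - \<gamma>)"
      by (intro mult_mono rhs_le) (auto simp: f_nonneg sing_nonneg)
    then show "rhs n x * sing n (u n x) * ?\<phi> x \<le> f x * min (u n x) T powr (gm - \<gamma>)" by (simp add: mult.assoc)
  qed simp
  finally show "energy ?v \<le> q powr p * (\<integral>x. f x * min (u n x) T powr (gm - \<gamma>) \<partial>lborel)" .
qed

text \<open>For \<open>\<gamma> \<ge> 1\<close> the remaining exponent \<open>gm - \<gamma>\<close>
  is 0 and only the L1 norm of \<open>f\<close> is left. For \<open>\<gamma> < 1\<close> the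
  right-hand side contains the energy to the power \<open>(1 - \<gamma>) / p < 1\<close>, which is
  absorbed.\<close>

lemma uniform_energy_bound:
  "\<exists>C. \<forall>n T. 0 < T \<longrightarrow> energy (\<lambda>x. min (u n x) T powr q) \<le> C"
proof (cases "1 \<le> \<gamma>")
  case True
  then have gm: "gm = \<gamma>" by (simp add: gm_def)
  have "energy (\<lambda>x. min (u n x) T powr q) \<le> q powr p * (\<integral>x. f x \<partial>lborel)" if T: "0 < T" for n T
  proof -
    have "energy (\<lambda>x. min (u n x) T powr q) \<le> q powr p * (\<integral>x. f x * min (u n x) T powr (gm - \<gamma>) \<partial>lborel)"
      by (rule test_with_power(2)[OF T])
    \<comment> \<open>The factor with exponent 0 is 1 for a nonzero base and 0 for the base 0, hence
      at most 1.\<close>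
    also have "\<dots> \<le> q powr p * (\<integral>x. f x \<partial>lborel)"
      by (intro mult_left_mono integral_mono test_with_power(1)[OF T] f_int)
         (auto simp: gm f_nonneg powr_def)
    finally show ?thesis .
  qed
  then show ?thesis by blast
next
  case False
  then have gm: "gm = 1" "q = 1" using p by (auto simp: gm_def q_def)
  have pst1: "1 - \<gamma> < pst" using pst_gt p \<gamma>_pos by linarith
  obtain C where C: "0 \<le> C" "\<And>v. v \<in> X \<Longrightarrow> (\<And>x. 0 \<le> v x) \<Longrightarrow>
      (\<integral>x. f x * v x powr (1 - \<gamma>) \<partial>lborel) \<le> C * energy v powr ((1 - \<gamma>) / p)"
    using sobolev_hoelder[OF f_meas f_nonneg _ pst1] growth False by auto
  have \<theta>: "0 \<le> (1 - \<gamma>) / p" "(1 - \<gamma>) / p < 1" using p \<gamma>_pos False by auto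
  obtain C' where C': "\<And>E. 0 \<le> E \<Longrightarrow> C * E powr ((1 - \<gamma>) / p) \<le> 1 / 2 * E + C'"
    using sublinear_absorb[OF C(1) \<theta>, of "1 / 2"] by auto
  have "energy (\<lambda>x. min (u n x) T powr q) \<le> 2 * C'" if T: "0 < T" for n T
  proof -
    let ?v = "\<lambda>x. min (u n x) T powr q"
    have vx: "?v x = min (u n x) T" for x using T u_nonneg[of n x] by (simp add: gm)
    have v: "?v \<in> X" by (rule truncated_power_X[OF u_X u_nonneg _ q_ge]) (use T in simp)
    have "energy ?v \<le> (\<integral>x. f x * ?v x powr (1 - \<gamma>) \<partial>lborel)"
      using test_with_power(2)[OF T, of n] unfolding vx by (simp add: gm)
    also have "\<dots> \<le> C * energy ?v powr ((1 - \<gamma>) / p)" by (rule C(2)[OF v]) simp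
    also have "\<dots> \<le> 1 / 2 * energy ?v + C'" by (rule C') simp
    finally show ?thesis by simp
  qed
  then show ?thesis by blast
qed

lemma u_power_bound:
  "\<exists>C. \<forall>n. (\<lambda>x. u n x powr q) \<in> X \<and> energy (\<lambda>x. u n x powr q) \<le> C"
proof -
  obtain C where C: "\<And>n T. 0 < T \<Longrightarrow> energy (\<lambda>x. min (u n x) T powr q) \<le> C"
    using uniform_energy_bound by blast
  have "(\<lambda>x. u n x powr q) \<in> X" "energy (\<lambda>x. u n x powr q) \<le> C" for n
    by (rule power_untruncated[OF u_X u_nonneg q_ge], rule C, assumption)+
  then show ?thesis by blast
qed

text \<open>The default 1 takes effect only on a null set, by the lower bounds; it makes
  \<open>sol\<close> positive at every point of \<open>\<Omega>\<close>, as the notion of solution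
  demands.\<close>

definition sol :: "'a \<Rightarrow> real" where
  "sol x = (if x \<in> \<Omega> then if 0 < lim (\<lambda>n. u n x) then lim (\<lambda>n. u n x) else 1 else 0)"

lemma measurable_sol [measurable]: "sol \<in> borel_measurable borel"
  unfolding sol_def[abs_def] by measurable

lemma sol_pos: "x \<in> \<Omega> \<Longrightarrow> 0 < sol x" and sol_out: "x \<notin> \<Omega> \<Longrightarrow> sol x = 0"
  by (auto simp: sol_def)

lemma sol_nonneg: "0 \<le> sol x"
  by (auto simp: sol_def)

text \<open>Only the powers \<open>u n powr q\<close> have bounded energy. The norm estimate with
  exponent \<open>1 / q \<le> 1\<close>, applied to them, bounds the integrals of
  \<open>u n\<close>, and monotonicity does the rest.\<close>

lemma u_convergent: "AE x in lborel. convergent (\<lambda>n. u n x)"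
proof -
  obtain C where C: "\<And>n. (\<lambda>x. u n x powr q) \<in> X" "\<And>n. energy (\<lambda>x. u n x powr q) \<le> C"
    using u_power_bound by blast
  have "1 / q \<le> 1" using q_ge by simp
  then have "1 / q \<le> pst" using pst_gt p by linarith
  moreover have "0 < 1 / q" using q_ge by simp
  ultimately obtain D where D: "0 < D" "\<And>v. v \<in> X \<Longrightarrow> (\<integral>x. \<bar>v x\<bar> powr (1 / q) \<partial>lborel) \<le> D * energy v powr (1 / q / p)"
    using lower_norm_bound[of "1 / q"] by metis
  show ?thesis
  proof (rule AE_convergent_of_mono_bounded[where f = u, OF _ u_nonneg u_mono])
    show "integrable lborel (u n)" for n using X_L1 u_X by metis
    fix n
    have "(\<integral>x. u n x \<partial>lborel) = (\<integral>x. \<bar>u n x powr q\<bar> powr (1 / q) \<partial>lborel)"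
      using u_nonneg q_ge by (simp add: powr_powr)
    also have "\<dots> \<le> D * energy (\<lambda>x. u n x powr q) powr (1 / q / p)" by (rule D(2)[OF C(1)])
    also have "\<dots> \<le> D * C powr (1 / q / p)"
      using D(1) q_ge p C(2)[of n] by (intro mult_left_mono powr_mono2) auto
    finally show "(\<integral>x. u n x \<partial>lborel) \<le> D * C powr (1 / q / p)" .
  qed
qed

text \<open>Exhausting \<open>\<Omega>\<close> by countably many compact sets turns the local lower
  bounds into positivity of the limit almost everywhere, so the default in \<open>sol\<close> is
  avoided there.\<close>

lemma lim_eq_sol: "AE x in lborel. (\<lambda>n. u n x) \<longlonglongrightarrow> sol x"
proof -
  obtain K :: "nat \<Rightarrow> 'a set" where K: "\<And>n. compact (K n)" "\<And>n. K n \<subseteq> \<Omega>" "\<Union>(range K) = \<Omega>"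
    using open_\<Omega> by (metis open_Union_compact_subsets)
  have "AE x in lborel. x \<in> K j \<longrightarrow> (\<exists>c>0. \<forall>n. c \<le> u n x)" for j
  proof -
    obtain c where c: "0 < c" "AE x in lborel. x \<in> K j \<longrightarrow> (\<forall>n. c \<le> u n x)"
      using u_lower_bound[OF K(1,2)] by blast
    from c(2) show ?thesis by eventually_elim (use c(1) in blast)
  qed
  then have "AE x in lborel. \<forall>j. x \<in> K j \<longrightarrow> (\<exists>c>0. \<forall>n. c \<le> u n x)"
    by (subst AE_all_countable) blast
  with u_convergent show ?thesis
  proof eventually_elim
    case (elim x)
    have L: "(\<lambda>n. u n x) \<longlonglongrightarrow> lim (\<lambda>n. u n x)" using elim(1) by (simp add: convergent_LIMSEQ_iff)
    show ?case
    proof (cases "x \<in> \<Omega>")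
      case True
      then obtain c where c: "0 < c" "\<And>n. c \<le> u n x" using elim(2) K(3) by blast
      have "c \<le> lim (\<lambda>n. u n x)" by (rule LIMSEQ_le_const[OF L]) (use c in auto)
      then have "sol x = lim (\<lambda>n. u n x)" using c(1) True by (simp add: sol_def)
      then show ?thesis using L by simp
    next
      case False
      then show ?thesis using X_D(2)[OF u_X] by (simp add: sol_out)
    qed
  qed
qed

lemma sol_lower_bound:
  assumes K: "compact K" "K \<subseteq> \<Omega>"
  shows "\<exists>c>0. AE x in lborel. x \<in> K \<longrightarrow> c \<le> sol x \<and> (\<forall>n. c \<le> u n x)"
proof -
  obtain c where c: "0 < c" "AE x in lborel. x \<in> K \<longrightarrow> (\<forall>n. c \<le> u n x)"
    using u_lower_bound[OF K] by blast
  from c(2) lim_eq_sol have "AE x in lborel. x \<in> K \<longrightarrow> c \<le> sol x \<and> (\<forall>n. c \<le> u n x)"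
  proof eventually_elim
    case (elim x)
    then show ?case using LIMSEQ_le_const[OF elim(2), of c] by auto
  qed
  then show ?thesis using c(1) by blast
qed

lemma sol_power_X: "(\<lambda>x. sol x powr q) \<in> X"
proof -
  obtain C where C: "\<And>n. (\<lambda>x. u n x powr q) \<in> X" "\<And>n. energy (\<lambda>x. u n x powr q) \<le> C"
    using u_power_bound by blast
  have lim: "AE z in M. (\<lambda>n. \<bar>gap (\<lambda>x. u n x powr q) z\<bar> powr p) \<longlonglongrightarrow> \<bar>gap (\<lambda>x. sol x powr q) z\<bar> powr p"
    using AE_M[OF lim_eq_sol]
  proof eventually_elim
    case (elim z)
    have h: "(\<lambda>n. u n x powr q) \<longlonglongrightarrow> sol x powr q" if "(\<lambda>n. u n x) \<longlonglongrightarrow> sol x" for x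
      using that q_ge u_nonneg by (intro tendsto_powr' tendsto_const) auto
    have "(\<lambda>n. gap (\<lambda>x. u n x powr q) z) \<longlonglongrightarrow> gap (\<lambda>x. sol x powr q) z"
      by (intro tendsto_diff h) (use elim in auto)
    then have "(\<lambda>n. \<bar>gap (\<lambda>x. u n x powr q) z\<bar>) \<longlonglongrightarrow> \<bar>gap (\<lambda>x. sol x powr q) z\<bar>"
      by (rule tendsto_rabs)
    then show ?case by (rule tendsto_powr'[OF _ tendsto_const]) (use p in auto)
  qed
  have i: "integrable M (\<lambda>z. \<bar>gap (\<lambda>x. sol x powr q) z\<bar> powr p)"
    by (rule integrable_AE_limit(1)[OF _ _ _ X_D(3)[OF C(1)] _ lim, of C]; (measurable; fail)?)
       (use C(2) in \<open>auto simp: energy_def\<close>)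
  show ?thesis
    unfolding X_def mem_Collect_eq
  proof (intro conjI allI impI i)
    show "(\<lambda>x. sol x powr q) \<in> borel_measurable borel" by measurable
  qed (use q_ge in \<open>simp add: sol_out\<close>)
qed

theorem sol_equation:
  assumes \<phi>: "\<phi> \<in> X" and K: "compact K" "K \<subseteq> \<Omega>" and out: "\<And>x. x \<notin> K \<Longrightarrow> \<phi> x = 0" and B: "\<And>x. \<bar>\<phi> x\<bar> \<le> B"
  shows "integrable M (\<lambda>z. pflux p (gap sol z) * gap \<phi> z)"
    and "form sol \<phi> = (\<integral>x. f x * sol x powr (- \<gamma>) * \<phi> x \<partial>lborel)"
proof -
  note [measurable] = X_D(1)[OF \<phi>]
  obtain C where C: "\<And>n. (\<lambda>x. u n x powr q) \<in> X" "\<And>n. energy (\<lambda>x. u n x powr q) \<le> C"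
    using u_power_bound by blast
  obtain c where c: "0 < c" "AE x in lborel. x \<in> K \<longrightarrow> c \<le> sol x \<and> (\<forall>n. c \<le> u n x)"
    using sol_lower_bound[OF K] by blast
  have B_nn: "0 \<le> B" using B[of undefined] by linarith
  define k where "k = (c powr (1 - q)) powr p"
  have k: "0 \<le> k" by (simp add: k_def)
  have gap_le: "\<bar>gap v z\<bar> powr p \<le> k * \<bar>gap (\<lambda>x. v x powr q) z\<bar> powr p"
    if v: "\<And>x. 0 \<le> v x" and z: "c \<le> v (fst z) \<or> c \<le> v (snd z)" for v :: "'a \<Rightarrow> real" and z
  proof -
    have "\<bar>gap v z\<bar> \<le> c powr (1 - q) * \<bar>gap (\<lambda>x. v x powr q) z\<bar>"
      using z
    proof
      assume "c \<le> v (fst z)"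
      then show ?thesis by (rule abs_diff_le_powr_diff[OF q_ge c(1) _ v])
    next
      assume "c \<le> v (snd z)"
      then have "\<bar>v (snd z) - v (fst z)\<bar> \<le> c powr (1 - q) * \<bar>v (snd z) powr q - v (fst z) powr q\<bar>"
        by (rule abs_diff_le_powr_diff[OF q_ge c(1) _ v])
      then show ?thesis by (simp add: abs_minus_commute)
    qed
    then have "\<bar>gap v z\<bar> powr p \<le> (c powr (1 - q) * \<bar>gap (\<lambda>x. v x powr q) z\<bar>) powr p"
      using p by (intro powr_mono2) auto
    then show ?thesis by (simp add: k_def powr_mult)
  qed
  \<comment> \<open>A pair seen by \<open>\<phi>\<close> has at least one point in \<open>K\<close>,
    and a lower bound at one point is all that \<open>gap_le\<close> asks for.\<close>
  have supp: "fst z \<in> K \<or> snd z \<in> K" if "gap \<phi> z \<noteq> 0" for z using out that by fastforce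
  note weak = pflux_weak_convergence[OF p, where M = M and g = "\<lambda>n. gap (u n)" and l = "gap sol" and b = "gap \<phi>"
      and r = "\<lambda>n z. k * \<bar>gap (\<lambda>x. u n x powr q) z\<bar> powr p" and r' = "\<lambda>z. k * \<bar>gap (\<lambda>x. sol x powr q) z\<bar> powr p"
      and C = "k * C"]
  have prem: "AE z in M. (\<lambda>n. gap (u n) z) \<longlonglongrightarrow> gap sol z"
    "integrable M (\<lambda>z. k * \<bar>gap (\<lambda>x. u n x powr q) z\<bar> powr p)"
    "integrable M (\<lambda>z. k * \<bar>gap (\<lambda>x. sol x powr q) z\<bar> powr p)"
    "(\<integral>z. k * \<bar>gap (\<lambda>x. u n x powr q) z\<bar> powr p \<partial>M) \<le> k * C"
    "AE z in M. gap \<phi> z \<noteq> 0 \<longrightarrow> \<bar>gap (u n) z\<bar> powr p \<le> k * \<bar>gap (\<lambda>x. u n x powr q) z\<bar> powr p"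
    "AE z in M. gap \<phi> z \<noteq> 0 \<longrightarrow> \<bar>gap sol z\<bar> powr p \<le> k * \<bar>gap (\<lambda>x. sol x powr q) z\<bar> powr p" for n
  proof -
    show "AE z in M. (\<lambda>n. gap (u n) z) \<longlonglongrightarrow> gap sol z"
      using AE_M[OF lim_eq_sol] by eventually_elim (intro tendsto_diff; blast)
    show "integrable M (\<lambda>z. k * \<bar>gap (\<lambda>x. u n x powr q) z\<bar> powr p)" using X_D(3)[OF C(1)] by simp
    show "integrable M (\<lambda>z. k * \<bar>gap (\<lambda>x. sol x powr q) z\<bar> powr p)" using X_D(3)[OF sol_power_X] by simp
    show "(\<integral>z. k * \<bar>gap (\<lambda>x. u n x powr q) z\<bar> powr p \<partial>M) \<le> k * C"
      using C(2)[of n] k by (simp add: energy_def mult_left_mono)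
    show "AE z in M. gap \<phi> z \<noteq> 0 \<longrightarrow> \<bar>gap (u n) z\<bar> powr p \<le> k * \<bar>gap (\<lambda>x. u n x powr q) z\<bar> powr p"
      using AE_M[OF c(2)]
    proof eventually_elim
      case (elim z)
      show ?case using gap_le[of "u n" z, OF u_nonneg] supp[of z] elim by blast
    qed
    show "AE z in M. gap \<phi> z \<noteq> 0 \<longrightarrow> \<bar>gap sol z\<bar> powr p \<le> k * \<bar>gap (\<lambda>x. sol x powr q) z\<bar> powr p"
      using AE_M[OF c(2)]
    proof eventually_elim
      case (elim z)
      show ?case using gap_le[of sol z, OF sol_nonneg] supp[of z] elim by blast
    qed
  qed
  have m: "gap (u n) \<in> borel_measurable M" "gap sol \<in> borel_measurable M" "gap \<phi> \<in> borel_measurable M" for n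
    by measurable
  have nn: "0 \<le> k * \<bar>a\<bar> powr p" for a using k by simp
  note weak' = weak[OF m X_D(3)[OF \<phi>] prem(1) prem(2) prem(4) prem(3) prem(5) prem(6) nn nn]
  show "integrable M (\<lambda>z. pflux p (gap sol z) * gap \<phi> z)" by (rule weak'(1))
  have l1: "(\<lambda>n. form (u n) \<phi>) \<longlonglongrightarrow> form sol \<phi>" unfolding form_def by (rule weak'(2))
  \<comment> \<open>On \<open>K\<close> the singular factor is at most
    \<open>c powr (- \<gamma>)\<close>, uniformly in \<open>n\<close>; outside \<open>K\<close> the
    test function is 0.\<close>
  have l2: "(\<lambda>n. \<integral>x. rhs n x * sing n (u n x) * \<phi> x \<partial>lborel) \<longlonglongrightarrow> (\<integral>x. f x * sol x powr (- \<gamma>) * \<phi> x \<partial>lborel)"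
  proof (rule integral_dominated_convergence)
    show "integrable lborel (\<lambda>x. f x * (c powr (- \<gamma>) * B))" using f_int by simp
    show "AE x in lborel. norm (rhs n x * sing n (u n x) * \<phi> x) \<le> f x * (c powr (- \<gamma>) * B)" for n
      using c(2)
    proof eventually_elim
      case (elim x)
      show ?case
      proof (cases "x \<in> K")
        case True
        have "sing n (u n x) \<le> c powr (- \<gamma>)"
          unfolding sing_def using elim True c(1) \<gamma>_pos
          by (intro powr_mono2') (auto intro!: order_trans[OF _ add_increasing2[OF _ order_refl]] simp: le_max_iff_disj)
        then have "sing n (u n x) * \<bar>\<phi> x\<bar> \<le> c powr (- \<gamma>) * B"
          by (intro mult_mono B) auto
        then have "rhs n x * (sing n (u n x) * \<bar>\<phi> x\<bar>) \<le> f x * (c powr (- \<gamma>) * B)"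
          by (rule mult_mono[OF rhs_le]) (auto simp: f_nonneg sing_nonneg)
        then show ?thesis by (simp add: abs_mult rhs_nonneg sing_nonneg mult.assoc)
      qed (use out f_nonneg B_nn in simp)
    qed
    show "AE x in lborel. (\<lambda>n. rhs n x * sing n (u n x) * \<phi> x) \<longlonglongrightarrow> f x * sol x powr (- \<gamma>) * \<phi> x"
      using lim_eq_sol
    proof eventually_elim
      case (elim x)
      show ?case
      proof (cases "x \<in> \<Omega>")
        case True
        have "(\<lambda>n. rhs n x) \<longlonglongrightarrow> f x"
        proof (rule tendsto_eventually)
          obtain n0 where "f x \<le> real n0" using real_arch_simple by blast
          then show "\<forall>\<^sub>F n in sequentially. rhs n x = f x"
            unfolding rhs_def by (intro eventually_sequentiallyI[of n0]) (simp add: min_absorb1)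
        qed
        moreover have "(\<lambda>n. sing n (u n x)) \<longlonglongrightarrow> sol x powr (- \<gamma>)"
        proof -
          have "(\<lambda>n. 1 / real (Suc n)) \<longlonglongrightarrow> 0"
            using LIMSEQ_inverse_real_of_nat by (simp add: inverse_eq_divide)
          then have "(\<lambda>n. max 0 (u n x) + 1 / real (Suc n)) \<longlonglongrightarrow> max 0 (sol x) + 0"
            by (intro tendsto_intros elim)
          then show ?thesis
            unfolding sing_def using sol_pos[OF True] by (intro tendsto_powr tendsto_const) auto
        qed
        ultimately show ?thesis by (intro tendsto_intros)
      next
        case False
        then have "\<phi> x = 0" using out K(2) by blast
        then show ?thesis by simp
      qed
    qed
  qed measurable
  show "form sol \<phi> = (\<integral>x. f x * sol x powr (- \<gamma>) * \<phi> x \<partial>lborel)"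
    using l1 l2 by (intro LIMSEQ_unique[OF l1]) (simp add: u_eq[OF \<phi>])
qed

end

subsection \<open>Lebesgue measurable data and test functions\<close>

text \<open>The derivative is 0 off \<open>K\<close>, since the function vanishes on that open set;
  on \<open>K\<close> each directional derivative is continuous, hence bounded.
  \<open>Ck_fun\<close> speaks of each fixed direction separately, so the operator norm is bounded
  by the sum over the basis.\<close>

lemma Ck_fun_1_lipschitz:
  fixes \<phi> :: "'a::euclidean_space \<Rightarrow> real"
  assumes smooth: "Ck_fun (Suc 0) \<phi>" and K: "compact K" and out: "\<And>x. x \<notin> K \<Longrightarrow> \<phi> x = 0"
  shows "\<exists>L\<ge>0. \<forall>x y. \<bar>\<phi> x - \<phi> y\<bar> \<le> L * norm (x - y)"
proof -
  define D where "D x = frechet_derivative \<phi> (at x)" for x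
  have D: "(\<phi> has_derivative D x) (at x)" for x
    using smooth by (simp add: D_def frechet_derivative_works[symmetric])
  have D_cont: "continuous_on UNIV (\<lambda>x. D x b)" for b using smooth by (simp add: D_def)
  have D_out: "D x = (\<lambda>v. 0)" if "x \<notin> K" for x
  proof -
    have K': "open (- K)" using compact_imp_closed[OF K] by (simp add: open_Compl)
    have "((\<lambda>y. 0) has_derivative (\<lambda>v. 0)) (at x)" by simp
    then have "(\<phi> has_derivative (\<lambda>v. 0)) (at x)"
      by (rule has_derivative_transform_within_open[OF _ K']) (use that out in auto)
    then show ?thesis using D[of x] by (rule has_derivative_unique[symmetric])
  qed
  have "\<exists>c\<ge>0. \<forall>x. \<bar>D x b\<bar> \<le> c" for b
  proof -
    have "bounded ((\<lambda>x. D x b) ` K)"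
      by (intro compact_imp_bounded compact_continuous_image continuous_on_subset[OF D_cont] K) auto
    then obtain c where c: "\<And>x. x \<in> K \<Longrightarrow> \<bar>D x b\<bar> \<le> c" by (auto simp: bounded_iff)
    have "\<bar>D x b\<bar> \<le> \<bar>c\<bar>" for x
      using c[of x] D_out[of x] by (cases "x \<in> K") auto
    then show ?thesis by (intro exI[of _ "\<bar>c\<bar>"]) auto
  qed
  then obtain c where c: "\<And>b. 0 \<le> c b" "\<And>b x. \<bar>D x b\<bar> \<le> c b" by metis
  define L where "L = (\<Sum>b\<in>Basis. c b)"
  have "norm (\<phi> x - \<phi> y) \<le> L * norm (x - y)" for x y
  proof (rule differentiable_bound[of UNIV \<phi> D])
    show "(\<phi> has_derivative D x) (at x within UNIV)" for x using D by simp
    show "onorm (D x) \<le> L" for x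
    proof (rule onorm_le)
      fix v :: 'a
      have lin: "linear (D x)" using D[of x] by (simp add: has_derivative_linear)
      have "D x v = D x (\<Sum>b\<in>Basis. (v \<bullet> b) *\<^sub>R b)" by (simp add: euclidean_representation)
      also have "\<dots> = (\<Sum>b\<in>Basis. (v \<bullet> b) * D x b)"
        by (simp add: linear_sum[OF lin] linear_scale[OF lin])
      also have "norm \<dots> \<le> (\<Sum>b\<in>Basis. norm v * c b)"
        by (intro sum_norm_le) (auto simp: abs_mult intro!: mult_mono Basis_le_norm c)
      also have "\<dots> = L * norm v" by (simp add: L_def sum_distrib_left mult.commute)
      finally show "norm (D x v) \<le> L * norm v" .
    qed
  qed auto
  then show ?thesis using c(1) by (intro exI[of _ L]) (auto simp: L_def sum_nonneg)
qed

lemma test_function_props: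
  fixes \<phi> :: "'a::euclidean_space \<Rightarrow> real"
  assumes "\<phi> \<in> test_functions \<Omega>"
  shows "\<exists>K B L. compact K \<and> K \<subseteq> \<Omega> \<and> (\<forall>x. x \<notin> K \<longrightarrow> \<phi> x = 0) \<and> (\<forall>x. \<bar>\<phi> x\<bar> \<le> B) \<and> 0 \<le> L \<and>
    (\<forall>x y. \<bar>\<phi> x - \<phi> y\<bar> \<le> L * norm (x - y)) \<and> \<phi> \<in> borel_measurable borel"
proof -
  define K where "K = closure {x. \<phi> x \<noteq> 0}"
  have K: "compact K" "K \<subseteq> \<Omega>" and smooth: "smooth_fun \<phi>"
    using assms by (auto simp: test_functions_def K_def)
  have out: "\<phi> x = 0" if "x \<notin> K" for x
    using that closure_subset[of "{x. \<phi> x \<noteq> 0}"] by (auto simp: K_def)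
  have C0: "Ck_fun 0 \<phi>" and C1: "Ck_fun (Suc 0) \<phi>" using smooth unfolding smooth_fun_def by blast+
  have cont: "continuous_on UNIV \<phi>" using C0 by simp
  have "bounded (\<phi> ` K)"
    by (intro compact_imp_bounded compact_continuous_image continuous_on_subset[OF cont] K) auto
  then obtain B where B: "\<And>x. x \<in> K \<Longrightarrow> \<bar>\<phi> x\<bar> \<le> B" by (auto simp: bounded_iff)
  have "\<bar>\<phi> x\<bar> \<le> \<bar>B\<bar>" for x using B[of x] out[of x] by (cases "x \<in> K") auto
  moreover obtain L where "0 \<le> L" "\<forall>x y. \<bar>\<phi> x - \<phi> y\<bar> \<le> L * norm (x - y)"
    using Ck_fun_1_lipschitz[OF C1 K(1) out] by blast
  moreover have "\<phi> \<in> borel_measurable borel" using cont by (rule borel_measurable_continuous_onI)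
  ultimately show ?thesis using K out by blast
qed

lemma integrable_lebesgue_on_iff:
  fixes g :: "'a::euclidean_space \<Rightarrow> real"
  assumes A: "A \<in> sets borel" and g: "g \<in> borel_measurable borel"
  shows "integrable (lebesgue_on A) g \<longleftrightarrow> integrable lborel (\<lambda>x. indicat_real A x * g x)"
proof -
  have "integrable (lebesgue_on A) g \<longleftrightarrow> integrable lebesgue (\<lambda>x. indicat_real A x *\<^sub>R g x)"
    using A by (intro integrable_restrict_space) auto
  also have "\<dots> \<longleftrightarrow> integrable lborel (\<lambda>x. indicat_real A x *\<^sub>R g x)"
    using A g by (intro integrable_completion) auto
  finally show ?thesis by simp
qed

lemma Lp_onI:
  fixes g :: "'a::euclidean_space \<Rightarrow> real"
  assumes A: "A \<in> sets borel" and g [measurable]: "g \<in> borel_measurable borel"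
    and int: "integrable lborel (\<lambda>x. \<bar>g x\<bar> powr r)"
  shows "g \<in> Lp_on r A"
proof -
  have "g \<in> borel_measurable lebesgue" using g by (simp add: measurable_completion)
  then have "g \<in> borel_measurable (lebesgue_on A)" by (rule measurable_restrict_space1)
  moreover have "integrable (lebesgue_on A) (\<lambda>x. \<bar>g x\<bar> powr r)"
    by (subst integrable_lebesgue_on_iff[OF A])
       (measurable, intro integrable_real_mult_indicator int integrable_mult_indicator[where 'b = real, simplified] A, use A int in auto)
  ultimately show ?thesis by (simp add: Lp_on_def)
qed

section \<open>Identification with the Gagliardo energy and the weak formulation\<close>

context frac_space
begin

text \<open>For Borel functions completing the measure does not change the integral, so the energy
  defined with Lebesgue measure is an integral over \<open>M\<close>; on the diagonal both
  integrands are 0.\<close>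

lemma gagliardo_energy_eq:
  assumes A: "A \<in> sets borel" and v [measurable]: "v \<in> borel_measurable borel"
  shows "gagliardo_energy s p A v = (\<integral>\<^sup>+z. ennreal (\<bar>gap v z\<bar> powr p) * indicator (A \<times> A) z \<partial>M)"
proof -
  have AA [measurable]: "A \<times> A \<in> sets (borel :: ('a \<times> 'a) measure)"
    using A by (simp add: borel_prod[symmetric])
  have "gagliardo_energy s p A v = (\<integral>\<^sup>+z. ennreal (\<bar>gap v z\<bar> powr p * kernel z) \<partial>lebesgue_on (A \<times> A))"
    unfolding gagliardo_energy_def by (simp add: kernel_def case_prod_unfold N_eq[symmetric])
  also have "\<dots> = (\<integral>\<^sup>+z. ennreal (\<bar>gap v z\<bar> powr p * kernel z) * indicator (A \<times> A) z \<partial>lebesgue)"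
    using AA by (intro nn_integral_restrict_space) auto
  also have "\<dots> = (\<integral>\<^sup>+z. ennreal (\<bar>gap v z\<bar> powr p * kernel z) * indicator (A \<times> A) z \<partial>lborel)"
    by (rule nn_integral_completion)
  also have "\<dots> = (\<integral>\<^sup>+z. ennreal (kernel z) * (ennreal (\<bar>gap v z\<bar> powr p) * indicator (A \<times> A) z) \<partial>lborel)"
    by (intro nn_integral_cong) (simp add: ennreal_mult mult_ac)
  also have "\<dots> = (\<integral>\<^sup>+z. ennreal (\<bar>gap v z\<bar> powr p) * indicator (A \<times> A) z \<partial>M)"
    unfolding M_def by (subst nn_integral_density) (auto intro!: borel_measurable_times_ennreal borel_measurable_indicator)
  finally show ?thesis .
qed

lemma frac_sobolev0_of_X:
  assumes v: "v \<in> X"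
  shows "v \<in> frac_sobolev0 s p \<Omega>"
proof -
  note [measurable] = X_D(1)[OF v]
  have "gagliardo_energy s p UNIV v = ennreal (energy v)"
    by (subst gagliardo_energy_eq) (simp_all add: nn_energy[OF v])
  then have "gagliardo_seminorm s p v < \<infinity>" by (simp add: gagliardo_seminorm_def)
  moreover have "v \<in> Lp_on p UNIV"
  proof (rule Lp_onI)
    show "integrable lborel (\<lambda>x. \<bar>v x\<bar> powr p)"
      using lower_norm_bound[of p] pst_gt p v by (metis less_imp_le less_trans zero_less_one)
  qed auto
  ultimately show ?thesis using X_D(2)[OF v] by (simp add: frac_sobolev0_def frac_sobolev_def)
qed

lemma frac_p_integrand_integral:
  assumes v [measurable]: "v \<in> borel_measurable borel" and \<phi> [measurable]: "\<phi> \<in> borel_measurable borel"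
  shows "integrable lebesgue (frac_p_integrand s p v \<phi>) \<longleftrightarrow> integrable M (\<lambda>z. pflux p (gap v z) * gap \<phi> z)"
    and "integral\<^sup>L lebesgue (frac_p_integrand s p v \<phi>) = form v \<phi>"
proof -
  have eq: "frac_p_integrand s p v \<phi> = (\<lambda>z. kernel z *\<^sub>R (pflux p (gap v z) * gap \<phi> z))"
    by (auto simp: frac_p_integrand_def pflux_def kernel_def N_eq[symmetric] fun_eq_iff)
  have m: "(\<lambda>z. kernel z *\<^sub>R (pflux p (gap v z) * gap \<phi> z)) \<in> borel_measurable lborel" by measurable
  have m': "(\<lambda>z. pflux p (gap v z) * gap \<phi> z) \<in> borel_measurable lborel" by measurable
  show "integrable lebesgue (frac_p_integrand s p v \<phi>) \<longleftrightarrow> integrable M (\<lambda>z. pflux p (gap v z) * gap \<phi> z)"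
    unfolding eq M_def using m m' by (subst integrable_density) (auto simp: integrable_completion)
  show "integral\<^sup>L lebesgue (frac_p_integrand s p v \<phi>) = form v \<phi>"
    unfolding eq M_def form_def using m m' by (subst integral_density) (auto simp: integral_completion)
qed

end

context singular_problem
begin

lemma q_eq: "q = max ((\<gamma> + p - 1) / p) 1"
  using p by (simp add: q_def gm_def max_def field_simps)

text \<open>\<open>sol powr r\<close> is the power \<open>r / q\<close> of
  \<open>sol powr q\<close>, and \<open>r / q \<le> pst\<close>. It is applied with
  \<open>r = p\<close> and with \<open>r = p - 1\<close>, which may be below 1.\<close>

lemma sol_power_integrable:
  assumes r: "0 < r" "r \<le> p"
  shows "integrable lborel (\<lambda>x. \<bar>sol x\<bar> powr r)"
proof -
  have "r / q \<le> r / 1" using r q_ge by (intro divide_left_mono) auto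
  then have "0 < r / q" "r / q \<le> pst" using r q_ge pst_gt by auto
  then have "integrable lborel (\<lambda>x. \<bar>sol x powr q\<bar> powr (r / q))"
    using lower_norm_bound[of "r / q"] sol_power_X by metis
  then show ?thesis using q_ge sol_nonneg by (simp add: powr_powr)
qed

lemma sol_ess_inf:
  assumes K: "compact K" "K \<subseteq> \<Omega>"
  shows "0 < ess_inf_on K sol"
proof -
  obtain c where c: "0 < c" "AE x in lborel. x \<in> K \<longrightarrow> c \<le> sol x \<and> (\<forall>n. c \<le> u n x)"
    using sol_lower_bound[OF K] by blast
  have Kb: "K \<in> sets borel" using K(1) by (simp add: borel_compact)
  have "esssup (lebesgue_on K) (\<lambda>x. - ereal (sol x)) \<le> - ereal c"
  proof (rule esssup_I)
    have "(\<lambda>x. - ereal (sol x)) \<in> borel_measurable lebesgue"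
      by (rule measurable_completion) measurable
    then show "(\<lambda>x. - ereal (sol x)) \<in> borel_measurable (lebesgue_on K)" by (rule measurable_restrict_space1)
    have "AE x in lebesgue. x \<in> K \<longrightarrow> c \<le> sol x"
      by (rule AE_completion) (use c(2) in \<open>eventually_elim, auto\<close>)
    then show "AE x in lebesgue_on K. - ereal (sol x) \<le> - ereal c"
      using Kb by (subst AE_restrict_space_iff) (auto elim!: eventually_mono)
  qed
  then have "ereal c \<le> ess_inf_on K sol"
    unfolding ess_inf_on_def by (metis ereal_minus_le_minus ereal_uminus_uminus)
  then show ?thesis using c(1) by (meson ereal_less(2) less_le_trans)
qed

text \<open>For \<open>q > 1\<close> it is only the power of \<open>sol\<close> that is known to lie
  in \<open>X\<close>. On \<open>K \<times> K\<close> the lower bound converts the gap of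
  \<open>sol\<close> into the gap of the power.\<close>

lemma sol_frac_sobolev_loc: "sol \<in> frac_sobolev_loc s p \<Omega>"
  unfolding frac_sobolev_loc_def
proof (intro CollectI allI impI conjI; elim conjE)
  fix K :: "'a set" assume K: "compact K" "K \<subseteq> \<Omega>"
  have Kb [measurable]: "K \<in> sets borel" using K(1) by (simp add: borel_compact)
  show "sol \<in> Lp_on p K" using sol_power_integrable[of p] p by (intro Lp_onI Kb) auto
  obtain c where c: "0 < c" "AE x in lborel. x \<in> K \<longrightarrow> c \<le> sol x \<and> (\<forall>n. c \<le> u n x)"
    using sol_lower_bound[OF K] by blast
  define k where "k = (c powr (1 - q)) powr p"
  have "gagliardo_energy s p K sol = (\<integral>\<^sup>+z. ennreal (\<bar>gap sol z\<bar> powr p) * indicator (K \<times> K) z \<partial>M)"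
    by (rule gagliardo_energy_eq) auto
  also have "\<dots> \<le> (\<integral>\<^sup>+z. ennreal k * ennreal (\<bar>gap (\<lambda>x. sol x powr q) z\<bar> powr p) \<partial>M)"
  proof (rule nn_integral_mono_AE)
    show "AE z in M. ennreal (\<bar>gap sol z\<bar> powr p) * indicator (K \<times> K) z
        \<le> ennreal k * ennreal (\<bar>gap (\<lambda>x. sol x powr q) z\<bar> powr p)"
      using AE_M[OF c(2)]
    proof eventually_elim
      case (elim z)
      show ?case
      proof (cases "z \<in> K \<times> K")
        case True
        then have "c \<le> sol (fst z)" using elim by auto
        then have "\<bar>gap sol z\<bar> \<le> c powr (1 - q) * \<bar>gap (\<lambda>x. sol x powr q) z\<bar>"
          by (rule abs_diff_le_powr_diff[OF q_ge c(1) _ sol_nonneg])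
        then have "\<bar>gap sol z\<bar> powr p \<le> (c powr (1 - q) * \<bar>gap (\<lambda>x. sol x powr q) z\<bar>) powr p"
          using p by (intro powr_mono2) auto
        then have "\<bar>gap sol z\<bar> powr p \<le> k * \<bar>gap (\<lambda>x. sol x powr q) z\<bar> powr p"
          by (simp add: k_def powr_mult)
        then show ?thesis using True by (simp add: k_def ennreal_mult[symmetric] ennreal_leI)
      qed simp
    qed
  qed
  also have "\<dots> = ennreal k * ennreal (energy (\<lambda>x. sol x powr q))"
    by (subst nn_integral_cmult) (auto simp: nn_energy[OF sol_power_X])
  also have "\<dots> < \<infinity>" by (simp add: ennreal_mult_less_top)
  finally show "gagliardo_energy s p K sol < \<infinity>" .
qed

text \<open>Here \<open>g\<close> is the given Lebesgue measurable datum and \<open>f\<close> the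
  Borel function of the locale. Each integral is first settled for \<open>f\<close>; agreement
  almost everywhere on \<open>\<Omega>\<close> then transfers it to \<open>g\<close>.\<close>

lemma sol_weak_solution:
  assumes g: "AE x in lborel. x \<in> \<Omega> \<longrightarrow> g x = f x" and g_meas: "g \<in> borel_measurable (lebesgue_on \<Omega>)"
  shows "weak_solution s p \<gamma> \<Omega> g sol"
  unfolding weak_solution_def
proof (intro conjI ballI allI impI)
  show "sol \<in> frac_sobolev_loc s p \<Omega>" by (rule sol_frac_sobolev_loc)
  show "sol \<in> Lp_on (p - 1) \<Omega>" using sol_power_integrable[of "p - 1"] p by (intro Lp_onI) auto
  show "0 < sol x" if "x \<in> \<Omega>" for x using that by (rule sol_pos)
  show "sol x = 0" if "x \<notin> \<Omega>" for x using that by (rule sol_out)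
  show "(\<lambda>x. sol x powr max ((\<gamma> + p - 1) / p) 1) \<in> frac_sobolev0 s p \<Omega>"
    using frac_sobolev0_of_X[OF sol_power_X] by (simp add: q_eq)
  have g': "AE x in lebesgue. x \<in> \<Omega> \<longrightarrow> g x = f x" by (rule AE_completion[OF g])
  show "(\<lambda>x. g x / sol x powr \<gamma>) \<in> L1_loc \<Omega>"
    unfolding L1_loc_def
  proof (intro CollectI allI impI; elim conjE)
    fix K :: "'a set" assume K: "compact K" "K \<subseteq> \<Omega>"
    have Kb [measurable]: "K \<in> sets borel" using K(1) by (simp add: borel_compact)
    obtain c where c: "0 < c" "AE x in lborel. x \<in> K \<longrightarrow> c \<le> sol x \<and> (\<forall>n. c \<le> u n x)"
      using sol_lower_bound[OF K] by blast
    have i: "integrable lborel (\<lambda>x. indicat_real K x * (f x / sol x powr \<gamma>))"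
    proof (rule Bochner_Integration.integrable_bound)
      show "integrable lborel (\<lambda>x. f x * c powr (- \<gamma>))" using f_int by simp
      show "AE x in lborel. norm (indicat_real K x * (f x / sol x powr \<gamma>)) \<le> norm (f x * c powr (- \<gamma>))"
        using c(2)
      proof eventually_elim
        case (elim x)
        show ?case
        proof (cases "x \<in> K")
          case True
          have "sol x powr (- \<gamma>) \<le> c powr (- \<gamma>)" using elim True c(1) \<gamma>_pos by (intro powr_mono2') auto
          then have "f x * sol x powr (- \<gamma>) \<le> f x * c powr (- \<gamma>)" by (rule mult_left_mono[OF _ f_nonneg])
          then show ?thesis using True f_nonneg by (simp add: powr_minus_divide abs_mult)
        qed simp
      qed
    qed measurable
    then have "integrable (lebesgue_on K) (\<lambda>x. f x / sol x powr \<gamma>)"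
      by (subst integrable_lebesgue_on_iff) auto
    moreover have "AE x in lebesgue_on K. f x / sol x powr \<gamma> = g x / sol x powr \<gamma>"
    proof -
      have "AE x in lebesgue. x \<in> K \<longrightarrow> f x / sol x powr \<gamma> = g x / sol x powr \<gamma>"
        using g' by eventually_elim (use K(2) in auto)
      then show ?thesis using Kb by (subst AE_restrict_space_iff) auto
    qed
    moreover have "(\<lambda>x. g x / sol x powr \<gamma>) \<in> borel_measurable (lebesgue_on K)"
    proof -
      have "g \<in> borel_measurable (lebesgue_on K)"
        using measurable_restrict_mono[OF g_meas K(2)] by simp
      moreover have "sol \<in> borel_measurable (lebesgue_on K)"
        by (intro measurable_restrict_space1 measurable_completion) simp
      ultimately show ?thesis by measurable
    qed
    ultimately show "integrable (lebesgue_on K) (\<lambda>x. g x / sol x powr \<gamma>)"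
      using integrable_cong_AE_imp by blast
  qed
  fix \<phi> assume "\<phi> \<in> test_functions \<Omega>"
  from test_function_props[OF this] obtain K B L where K: "compact K" "K \<subseteq> \<Omega>" "\<And>x. x \<notin> K \<Longrightarrow> \<phi> x = 0"
    and B: "\<And>x. \<bar>\<phi> x\<bar> \<le> B" and L: "0 \<le> L" "\<And>x y. \<bar>\<phi> x - \<phi> y\<bar> \<le> L * norm (x - y)"
    and \<phi>_meas [measurable]: "\<phi> \<in> borel_measurable borel" by blast
  have out: "\<phi> x = 0" if "x \<notin> \<Omega>" for x using K that by blast
  have \<phi>: "\<phi> \<in> X" by (rule X_lipschitz[OF \<phi>_meas B L out])
  note eqn = sol_equation[OF \<phi> K(1,2,3) B]
  show "integrable lebesgue (frac_p_integrand s p sol \<phi>)"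
    using eqn(1) by (simp add: frac_p_integrand_integral(1))
  have "(\<integral>x. g x / sol x powr \<gamma> * \<phi> x \<partial>lebesgue_on \<Omega>) = (\<integral>x. indicat_real \<Omega> x *\<^sub>R (g x / sol x powr \<gamma> * \<phi> x) \<partial>lebesgue)"
    by (intro integral_restrict_space) auto
  also have "\<dots> = (\<integral>x. f x * sol x powr (- \<gamma>) * \<phi> x \<partial>lebesgue)"
  proof (rule integral_cong_AE)
    show "AE x in lebesgue. indicat_real \<Omega> x *\<^sub>R (g x / sol x powr \<gamma> * \<phi> x) = f x * sol x powr (- \<gamma>) * \<phi> x"
      using g' by eventually_elim (auto simp: indicator_def out powr_minus_divide)
    show "(\<lambda>x. f x * sol x powr (- \<gamma>) * \<phi> x) \<in> borel_measurable lebesgue"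
      by (rule measurable_completion) measurable
    have "(\<lambda>x. g x / sol x powr \<gamma> * \<phi> x) \<in> borel_measurable (lebesgue_on \<Omega>)"
    proof -
      have "sol \<in> borel_measurable (lebesgue_on \<Omega>)" "\<phi> \<in> borel_measurable (lebesgue_on \<Omega>)"
        by (intro measurable_restrict_space1 measurable_completion; simp)+
      then show ?thesis using g_meas by measurable
    qed
    then show "(\<lambda>x. indicat_real \<Omega> x *\<^sub>R (g x / sol x powr \<gamma> * \<phi> x)) \<in> borel_measurable lebesgue"
      by (subst (asm) borel_measurable_restrict_space_iff) (auto simp: mult.commute)
  qed
  also have "\<dots> = (\<integral>x. f x * sol x powr (- \<gamma>) * \<phi> x \<partial>lborel)"
    by (rule integral_completion) measurable
  finally show "integral\<^sup>L lebesgue (frac_p_integrand s p sol \<phi>) = (\<integral>x. g x / sol x powr \<gamma> * \<phi> x \<partial>lebesgue_on \<Omega>)"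
    using eqn(2) by (simp add: frac_p_integrand_integral(2))
qed

end

text \<open>The datum is extended by 0, replaced by a Borel representative and clipped at 0, since
  the locale asks for sign and exterior values at every point. Integrability of \<open>f\<close>
  itself follows from \<open>f \<le> 1 + f powr m\<close> on \<open>\<Omega>\<close>, which has
  finite measure.\<close>

lemma singular_problem_from_datum:
  fixes \<Omega> :: "'a::euclidean_space set" and g :: "'a \<Rightarrow> real"
  assumes space: "frac_space p s N \<Omega>" and g_meas: "g \<in> borel_measurable (lebesgue_on \<Omega>)"
    and g_nn: "\<forall>x\<in>\<Omega>. 0 \<le> g x" and g_nz: "\<not> (AE x in lebesgue_on \<Omega>. g x = 0)" and \<gamma>: "0 < \<gamma>"
    and m: "1 \<le> m" "g \<in> Lp_on m \<Omega>"
    and growth: "\<gamma> < 1 \<Longrightarrow> m = 1 / (1 - (1 - \<gamma>) / frac_space.pst p s N)"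
  shows "\<exists>f. singular_problem p s N \<Omega> f \<gamma> \<and> (AE x in lborel. x \<in> \<Omega> \<longrightarrow> g x = f x)"
proof -
  interpret frac_space p s N \<Omega> by (rule space)
  have "(\<lambda>x. g x * indicat_real \<Omega> x) \<in> borel_measurable lebesgue"
    using g_meas by (subst (asm) borel_measurable_restrict_space_iff) (auto simp: mult.commute)
  from completion_ex_borel_measurable_real[OF this]
  obtain g' where g' [measurable]: "g' \<in> borel_measurable lborel"
    and ae: "AE x in lborel. g x * indicat_real \<Omega> x = g' x" by blast
  define f where "f x = (if x \<in> \<Omega> then max 0 (g' x) else 0)" for x
  have [measurable]: "g' \<in> borel_measurable borel" using g' by simp
  have f_meas [measurable]: "f \<in> borel_measurable borel" unfolding f_def[abs_def] by measurable
  have f_nn: "0 \<le> f x" for x by (simp add: f_def)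
  have eq: "AE x in lborel. x \<in> \<Omega> \<longrightarrow> g x = f x"
    using ae by eventually_elim (use g_nn in \<open>auto simp: f_def max_def\<close>)
  have eq': "AE x in lebesgue_on \<Omega>. g x = f x"
    using AE_completion[OF eq] by (subst AE_restrict_space_iff) auto
  have f_m: "integrable lborel (\<lambda>x. f x powr m)"
  proof -
    have i: "integrable (lebesgue_on \<Omega>) (\<lambda>x. \<bar>g x\<bar> powr m)" using m by (simp add: Lp_on_def)
    have "f \<in> borel_measurable (lebesgue_on \<Omega>)"
      by (intro measurable_restrict_space1 measurable_completion) simp
    then have "(\<lambda>x. f x powr m) \<in> borel_measurable (lebesgue_on \<Omega>)" by measurable
    moreover have "AE x in lebesgue_on \<Omega>. \<bar>g x\<bar> powr m = f x powr m"
      using eq' by eventually_elim (simp add: f_nn)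
    ultimately have "integrable (lebesgue_on \<Omega>) (\<lambda>x. f x powr m)"
      using integrable_cong_AE_imp[OF i] by blast
    then have "integrable lborel (\<lambda>x. indicat_real \<Omega> x * f x powr m)"
      by (subst (asm) integrable_lebesgue_on_iff) auto
    moreover have "(\<lambda>x. indicat_real \<Omega> x * f x powr m) = (\<lambda>x. f x powr m)"
      by (auto simp: f_def indicator_def)
    ultimately show ?thesis by simp
  qed
  have f_1: "integrable lborel f"
  proof (rule Bochner_Integration.integrable_bound)
    show "integrable lborel (\<lambda>x. indicat_real \<Omega> x + f x powr m)"
      using f_m emeasure_\<Omega> by (intro Bochner_Integration.integrable_add) auto
    have "f x \<le> indicat_real \<Omega> x + f x powr m" for x
    proof (cases "f x \<le> 1")
      case True
      then show ?thesis by (cases "x \<in> \<Omega>") (auto simp: f_def intro: add_increasing2)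
    next
      case False
      then have "f x powr 1 \<le> f x powr m" using m by (intro powr_mono) auto
      then show ?thesis using False by (simp add: add_increasing)
    qed
    then show "AE x in lborel. norm (f x) \<le> norm (indicat_real \<Omega> x + f x powr m)"
      using f_nn by (auto simp: abs_of_nonneg)
  qed simp
  have f_nz: "\<not> (AE x in lborel. f x = 0)"
  proof
    assume "AE x in lborel. f x = 0"
    with eq have "AE x in lborel. x \<in> \<Omega> \<longrightarrow> g x = 0" by eventually_elim auto
    then have "AE x in lebesgue_on \<Omega>. g x = 0"
      using AE_completion by (subst AE_restrict_space_iff) auto
    then show False using g_nz by simp
  qed
  have "singular_problem p s N \<Omega> f \<gamma>"
    by unfold_locales (use f_nn f_1 f_nz \<gamma> f_m growth in \<open>auto simp: f_def\<close>)
  then show ?thesis using eq by blast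
qed

theorem theorem1p2:
  fixes p s :: real
    and \<Omega> :: "'a::euclidean_space set"
    and f :: "'a \<Rightarrow> real"
  assumes "1 < p"
    and "0 < s" and "s < 1"
    and "smooth_bounded_domain \<Omega>"
    and "s * p < real DIM('a)"
    and "f \<in> borel_measurable (lebesgue_on \<Omega>)"
    and "\<forall>x\<in>\<Omega>. 0 \<le> f x"
    and "\<not> (AE x in lebesgue_on \<Omega>. f x = 0)"
  shows "(\<forall>\<gamma>. 0 < \<gamma> \<and> \<gamma> \<le> 1 \<and>
            f \<in> Lp_on (real DIM('a) * p /
                   (real DIM('a) * (p - 1) + s * p + \<gamma> * (real DIM('a) - s * p))) \<Omega> \<longrightarrow>
            (\<exists>u. weak_solution s p \<gamma> \<Omega> f u \<and> u \<in> frac_sobolev0 s p \<Omega> \<and>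
                 (\<forall>K. compact K \<and> K \<subseteq> \<Omega> \<longrightarrow> 0 < ess_inf_on K u))) \<and>
         (\<forall>\<gamma>. 1 < \<gamma> \<and> f \<in> Lp_on 1 \<Omega> \<longrightarrow>
            (\<exists>u. weak_solution s p \<gamma> \<Omega> f u \<and>
                 u \<in> frac_sobolev_loc s p \<Omega> \<and> u \<in> Lp_on (p - 1) \<Omega> \<and>
                 (\<lambda>x. u x powr ((\<gamma> + p - 1) / p)) \<in> frac_sobolev0 s p \<Omega> \<and>
                 (\<forall>K. compact K \<and> K \<subseteq> \<Omega> \<longrightarrow> 0 < ess_inf_on K u)))"
proof -
  define N where "N = real DIM('a)"
  have space: "frac_space p s N \<Omega>"
    using assms(1-5) by unfold_locales (auto simp: N_def smooth_bounded_domain_def)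
  interpret frac_space p s N \<Omega> by (rule space)
  show ?thesis
  proof (intro conjI allI impI; elim conjE)
    fix \<gamma> :: real
    let ?m = "real DIM('a) * p / (real DIM('a) * (p - 1) + s * p + \<gamma> * (real DIM('a) - s * p))"
    assume \<gamma>: "0 < \<gamma>" "\<gamma> \<le> 1" and f: "f \<in> Lp_on ?m \<Omega>"
    \<comment> \<open>The exponent of the statement has reciprocal
      \<open>1 - (1 - \<gamma>) / pst\<close>; for \<open>\<gamma> = 1\<close> it equals 1.\<close>
    have m: "?m = 1 / (1 - (1 - \<gamma>) / pst)"
    proof -
      have "1 - (1 - \<gamma>) / pst = (N * (p - 1) + s * p + \<gamma> * (N - s * p)) / (N * p)"
        using sp N_pos p by (simp add: pst_def field_simps)
      then show ?thesis by (simp add: N_def)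
    qed
    have "0 \<le> (1 - \<gamma>) / pst" "(1 - \<gamma>) / pst < 1" using \<gamma> pst_gt p by (auto simp: field_simps)
    then have "1 \<le> ?m" unfolding m by (simp add: field_simps)
    then obtain g where g: "singular_problem p s N \<Omega> g \<gamma>" "AE x in lborel. x \<in> \<Omega> \<longrightarrow> f x = g x"
      using singular_problem_from_datum[OF space assms(6-8) \<gamma>(1) _ f m] by blast
    interpret singular_problem p s N \<Omega> g \<gamma> by (rule g)
    \<comment> \<open>For \<open>\<gamma> \<le> 1\<close> no power is taken, so \<open>sol\<close>
      itself lies in the energy space.\<close>
    have "max \<gamma> 1 = 1" using \<gamma> by simp
    then have "q = 1" using p by (simp add: q_def gm_def)
    then have "sol \<in> frac_sobolev0 s p \<Omega>"
      using frac_sobolev0_of_X[OF sol_power_X] sol_nonneg by simp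
    then show "\<exists>u. weak_solution s p \<gamma> \<Omega> f u \<and> u \<in> frac_sobolev0 s p \<Omega> \<and>
                 (\<forall>K. compact K \<and> K \<subseteq> \<Omega> \<longrightarrow> 0 < ess_inf_on K u)"
      using sol_weak_solution[OF g(2) assms(6)] sol_ess_inf by blast
  next
    fix \<gamma> :: real
    assume \<gamma>: "1 < \<gamma>" and f: "f \<in> Lp_on 1 \<Omega>"
    obtain g where g: "singular_problem p s N \<Omega> g \<gamma>" "AE x in lborel. x \<in> \<Omega> \<longrightarrow> f x = g x"
      using singular_problem_from_datum[OF space assms(6-8) _ _ f, of \<gamma>] \<gamma> by auto
    interpret singular_problem p s N \<Omega> g \<gamma> by (rule g)
    have w: "weak_solution s p \<gamma> \<Omega> f sol" by (rule sol_weak_solution[OF g(2) assms(6)])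
    have "q = (\<gamma> + p - 1) / p" using \<gamma> by (simp add: q_def gm_def)
    then have "(\<lambda>x. sol x powr ((\<gamma> + p - 1) / p)) \<in> frac_sobolev0 s p \<Omega>"
      using frac_sobolev0_of_X[OF sol_power_X] by simp
    with w show "\<exists>u. weak_solution s p \<gamma> \<Omega> f u \<and>
                 u \<in> frac_sobolev_loc s p \<Omega> \<and> u \<in> Lp_on (p - 1) \<Omega> \<and>
                 (\<lambda>x. u x powr ((\<gamma> + p - 1) / p)) \<in> frac_sobolev0 s p \<Omega> \<and>
                 (\<forall>K. compact K \<and> K \<subseteq> \<Omega> \<longrightarrow> 0 < ess_inf_on K u)"
      using sol_ess_inf unfolding weak_solution_def by blast
  qed
qed

end
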